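(* Let $d\ge 1$. A T-mesh $\mathscr T$ is dimensionally stable for $\mathbf S_d$ if and only if, for any $\mathscr T_1,\mathscr T_2\in[\mathscr T]_{\mathrm I}$, $$\operatorname{rank}\bigl(M(T(\mathscr T_1))\bigr)=\operatorname{rank}\bigl(M(T(\mathscr T_2))\bigr),$$ where $[\mathscr T]_{\mathrm I}$ is the structurally isomorphic class of $\mathscr T$ and $M(T(\mathscr T_i))$ is the conformality matrix of the T-connected component of $\mathscr T_i$.
   Context: **T-mesh.** A T-mesh $\mathscr{T}=(\mathcal T_0,\mathcal T_1,\mathcal T_2)$ of $\mathbb R^2$ consists of a finite set $\mathcal T_2$ of closed axis-aligned rectangles (cells), a finite set $\mathcal T_1$ of closed horizontal and vertical segments (edges) contained in $\bigcup_{f\in\mathcal T_2}\partial f$, and the finite set $\mathcal T_0=\bigcup_{l\in\mathcal T_1}\partial l$ of vertices ($\partial l$ = endpoints of $l$), such that: each $\partial f$, $f\in\mathcal T_2$, is a finite union of edges; for distinct cells $f,f'$, $f\cap f'=\partial f\cap\partial f'$ is a finite union of elements of $\mathcal T_0\cup\mathcal T_1$; for distinct edges $l,l'$, $l\cap l'=\partial l\cap\partial l'\subseteq\mathcal T_0$; each vertex is the intersection of a horizontal and a vertical edge. The domain is $\Omega=\bigcup_{f\in\mathcal T_2}f$; it is assumed simply connected with connected interior $\Omega^0$. Vertices in $\Omega^0$ are interior vertices, the others boundary vertices; edges not contained in $\partial\Omega$ are interior edges. **$l$-edges.** A segment of $\mathscr T$ is a connected union of collinear mesh edges; an $l$-edge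 is a maximal such segment. An $l$-edge made of interior edges is an interior $l$-edge; a maximal segment contained in $\partial\Omega$ is a boundary $l$-edge. An interior $l$-edge is a cross-cut if both endpoints are boundary vertices, a ray if exactly one is, and a T $l$-edge if both are interior vertices. $B(\mathscr T),C(\mathscr T),R(\mathscr T)$ denote the sets of boundary $l$-edges, cross-cuts and rays. The T-connected component $T(\mathscr T)$ is the edge–vertex configuration formed by all T $l$-edges and all vertices on them; it is assumed connected; $L(T(\mathscr T))$ is the set of T $l$-edges. It is also assumed that no T $l$-edge is vanishable, i.e. every T $l$-edge carries at least $d+2$ vertices. **Spline space and dimensional stability.** $\mathbf S_d(\mathscr T)$ is the space of functions $s$ on $\Omega$ whose restriction to each cell is a polynomial of bi-degree $(d,d)$ and which are continuous of order $d-1$ along the $x$-direction and of order $d-1$ along the $y$-direction. Let $L(\mathscr T)$ be the set of all $l$-edges (boundary ones included), $L_1(\mathscr T)$, $L_2(\mathscr T)$ the horizontal and vertical ones, and $\operatorname{cor}(l)$ the constant $y$-coordinate (horizontal $l$) or $x$-coordinate (vertical $l$). $\mathscr T_1,\mathscr T_2$ are structurally isomorphic if there is a bijection $\alpha:L(\mathscr T_1)\to L(\mathscr T_2)$ (a structurally isomorphic map) with: (i) $\alpha(B(\mathscr T_1))=B(\mathscr T_2)$, $\alpha(C(\mathscr T_1))=C(\mathscr T_2)$, $\alpha(R(\mathscr T_1))=R(\mathscr T_2)$, $\alpha(L(T(\mathscr T_1)))=L(T(\mathscr T_2))$; (ii) $l_i\cap l_j\neq\varnothing\iff\alpha(l_i)\cap\alpha(l_j)\ne\varnothing$;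 (iii) for $k=1,2$ and $l_i,l_j\in L_k(\mathscr T_1)$, $\operatorname{cor}(l_i)<\operatorname{cor}(l_j)\Rightarrow\operatorname{cor}(\alpha(l_i))<\operatorname{cor}(\alpha(l_j))$. This is an equivalence relation on the set of all T-meshes; $[\mathscr T]_{\mathrm I}$ is the class of $\mathscr T$. $\mathscr T$ is dimensionally stable for $\mathbf S_d$ if $\dim\mathbf S_d(\mathscr T_1)=\dim\mathbf S_d(\mathscr T_2)$ for all $\mathscr T_1,\mathscr T_2\in[\mathscr T]_{\mathrm I}$. **Conformality matrix.** Assign an unknown $\delta_v$ to each vertex $v$ of $T(\mathscr T)$. For each T $l$-edge $l$ with vertices $v_1,\dots,v_r$ having coordinates $x_1,\dots,x_r$ along $l$ ($x$-coordinates if $l$ is horizontal, $y$-coordinates if vertical), impose the $d+1$ linear equations $\sum_{i=1}^r x_i^k\delta_{v_i}=0$, $k=0,\dots,d$ (equivalently $\sum_i\delta_{v_i}(x-x_i)^d=0$). $M(T(\mathscr T))$ is the coefficient matrix of all these equations. *)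

theory Defs
  imports "HOL-Analysis.Analysis" "HOL-Library.Function_Algebras"
begin

section \<open>Real-valued functions as a vector space\<close>

definition fun_scale :: "real \<Rightarrow> ('a \<Rightarrow> real) \<Rightarrow> 'a \<Rightarrow> real" where
  "fun_scale c f = (\<lambda>x. c * f x)"

interpretation fun_vs: vector_space "fun_scale :: real \<Rightarrow> ('a \<Rightarrow> real) \<Rightarrow> 'a \<Rightarrow> real"
  by unfold_locales (auto simp: fun_scale_def fun_eq_iff algebra_simps)

text \<open>A matrix with finite row index set \<open>R\<close> and column index set \<open>C\<close> is a function of a row
  index and a column index; only its entries on \<open>R \<times> C\<close> matter. As for the library
  constant \<open>rank\<close>, the rank is the dimension of the space spanned by the rows.\<close>

definition matrix_rank :: "'r set \<Rightarrow> 'c set \<Rightarrow> ('r \<Rightarrow> 'c \<Rightarrow> real) \<Rightarrow> nat" where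
  "matrix_rank R C A = fun_vs.dim ((\<lambda>r c. if c \<in> C then A r c else 0) ` R)"


section \<open>T-meshes\<close>

type_synonym point = "real \<times> real"

definition rectangle :: "point set \<Rightarrow> bool" where
  "rectangle f \<longleftrightarrow> (\<exists>a b c d. a < b \<and> c < d \<and> f = {a..b} \<times> {c..d})"

definition horizontal :: "point set \<Rightarrow> bool" where
  "horizontal l \<longleftrightarrow> (\<exists>a b y. a < b \<and> l = {a..b} \<times> {y})"

definition vertical :: "point set \<Rightarrow> bool" where
  "vertical l \<longleftrightarrow> (\<exists>x a b. a < b \<and> l = {x} \<times> {a..b})"

definition endpoints :: "point set \<Rightarrow> point set" where
  "endpoints l = {p. \<exists>q. l = closed_segment p q}"

record tmesh =
  cells :: "point set set"
  edges :: "point set set"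

definition vertices :: "tmesh \<Rightarrow> point set" where
  "vertices M = (\<Union>l\<in>edges M. endpoints l)"

definition mesh_domain :: "tmesh \<Rightarrow> point set" where
  "mesh_domain M = \<Union>(cells M)"

definition t_mesh :: "tmesh \<Rightarrow> bool" where
  "t_mesh M \<longleftrightarrow>
     finite (cells M) \<and> (\<forall>f\<in>cells M. rectangle f) \<and>
     finite (edges M) \<and> (\<forall>l\<in>edges M. horizontal l \<or> vertical l) \<and>
     (\<forall>l\<in>edges M. l \<subseteq> (\<Union>f\<in>cells M. frontier f)) \<and>
     (\<forall>f\<in>cells M. \<exists>E\<subseteq>edges M. frontier f = \<Union>E) \<and>
     (\<forall>f\<in>cells M. \<forall>f'\<in>cells M. f \<noteq> f' \<longrightarrow>
        f \<inter> f' = frontier f \<inter> frontier f' \<and>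
        (\<exists>V\<subseteq>vertices M. \<exists>E\<subseteq>edges M. f \<inter> f' = V \<union> \<Union>E)) \<and>
     (\<forall>l\<in>edges M. \<forall>l'\<in>edges M. l \<noteq> l' \<longrightarrow>
        l \<inter> l' = endpoints l \<inter> endpoints l' \<and> l \<inter> l' \<subseteq> vertices M) \<and>
     (\<forall>v\<in>vertices M. \<exists>h\<in>edges M. \<exists>w\<in>edges M. horizontal h \<and> vertical w \<and> h \<inter> w = {v}) \<and>
     simply_connected (mesh_domain M) \<and> connected (interior (mesh_domain M))"

definition interior_vertices :: "tmesh \<Rightarrow> point set" where
  "interior_vertices M = vertices M \<inter> interior (mesh_domain M)"

definition boundary_vertices :: "tmesh \<Rightarrow> point set" where
  "boundary_vertices M = vertices M - interior (mesh_domain M)"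

definition interior_edges :: "tmesh \<Rightarrow> point set set" where
  "interior_edges M = {l \<in> edges M. \<not> l \<subseteq> frontier (mesh_domain M)}"

definition boundary_edges :: "tmesh \<Rightarrow> point set set" where
  "boundary_edges M = {l \<in> edges M. l \<subseteq> frontier (mesh_domain M)}"


section \<open>l-edges\<close>

definition segments :: "point set set \<Rightarrow> point set set" where
  "segments E = {s. \<exists>F\<subseteq>E. F \<noteq> {} \<and> s = \<Union>F \<and> connected s \<and> collinear s}"

definition maximal_segments :: "point set set \<Rightarrow> point set set" where
  "maximal_segments E = {s \<in> segments E. \<forall>s'\<in>segments E. s \<subseteq> s' \<longrightarrow> s' = s}"

text \<open>Interior and boundary edges form l-edges separately: maximality is taken among the segments
  made of interior edges, respectively among the segments contained in the boundary. Otherwise, at a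
  reentrant corner of the domain, a boundary edge and an interior edge continuing it would be merged
  into an l-edge that is neither interior nor boundary.\<close>

definition interior_l_edges :: "tmesh \<Rightarrow> point set set" where
  "interior_l_edges M = maximal_segments (interior_edges M)"

definition boundary_l_edges :: "tmesh \<Rightarrow> point set set" where
  "boundary_l_edges M = maximal_segments (boundary_edges M)"

definition l_edges :: "tmesh \<Rightarrow> point set set" where
  "l_edges M = boundary_l_edges M \<union> interior_l_edges M"

definition cross_cuts :: "tmesh \<Rightarrow> point set set" where
  "cross_cuts M = {l \<in> interior_l_edges M. endpoints l \<subseteq> boundary_vertices M}"

definition rays :: "tmesh \<Rightarrow> point set set" where
  "rays M = {l \<in> interior_l_edges M. card (endpoints l \<inter> boundary_vertices M) = 1}"

definition T_l_edges :: "tmesh \<Rightarrow> point set set" where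
  "T_l_edges M = {l \<in> interior_l_edges M. endpoints l \<subseteq> interior_vertices M}"

definition T_vertices :: "tmesh \<Rightarrow> point set" where
  "T_vertices M = {v \<in> vertices M. \<exists>l\<in>T_l_edges M. v \<in> l}"

text \<open>Being connected and having no vanishable T l-edges are hypotheses on a T-mesh, not part of
  \<open>t_mesh\<close>. Both depend only on the intersection pattern of the l-edges, so that they carry over
  to every member of a structurally isomorphic class.\<close>

definition T_connected :: "tmesh \<Rightarrow> bool" where
  "T_connected M \<longleftrightarrow> connected (\<Union>(T_l_edges M))"

definition vanishable :: "nat \<Rightarrow> tmesh \<Rightarrow> point set \<Rightarrow> bool" where
  "vanishable d M l \<longleftrightarrow> card (vertices M \<inter> l) < d + 2"


section \<open>Spline spaces\<close>

text \<open>Continuity of order \<open>k\<close> along a direction: \<open>g i\<close> is the \<open>i\<close>-th partial derivative in that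
  direction, taken in the interior of the domain and continuous up to its boundary.\<close>

definition smooth_x :: "nat \<Rightarrow> point set \<Rightarrow> (point \<Rightarrow> real) \<Rightarrow> bool" where
  "smooth_x k D s \<longleftrightarrow> (\<exists>g. g 0 = s \<and> (\<forall>i\<le>k. continuous_on D (g i)) \<and>
     (\<forall>i<k. \<forall>x y. (x, y) \<in> interior D \<longrightarrow>
        ((\<lambda>t. g i (t, y)) has_real_derivative g (Suc i) (x, y)) (at x)))"

definition smooth_y :: "nat \<Rightarrow> point set \<Rightarrow> (point \<Rightarrow> real) \<Rightarrow> bool" where
  "smooth_y k D s \<longleftrightarrow> (\<exists>g. g 0 = s \<and> (\<forall>i\<le>k. continuous_on D (g i)) \<and>
     (\<forall>i<k. \<forall>x y. (x, y) \<in> interior D \<longrightarrow>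
        ((\<lambda>t. g i (x, t)) has_real_derivative g (Suc i) (x, y)) (at y)))"

definition bidegree_poly_on :: "nat \<Rightarrow> point set \<Rightarrow> (point \<Rightarrow> real) \<Rightarrow> bool" where
  "bidegree_poly_on d f s \<longleftrightarrow> (\<exists>c :: nat \<Rightarrow> nat \<Rightarrow> real.
     \<forall>x y. (x, y) \<in> f \<longrightarrow> s (x, y) = (\<Sum>i\<le>d. \<Sum>j\<le>d. c i j * x ^ i * y ^ j))"

text \<open>A function on the domain is represented by its extension by zero to the whole plane. The
  order \<open>d - 1\<close> is meant for \<open>d \<ge> 1\<close>.\<close>

definition spline_space :: "nat \<Rightarrow> tmesh \<Rightarrow> (point \<Rightarrow> real) set" where
  "spline_space d M = {s. (\<forall>p. p \<notin> mesh_domain M \<longrightarrow> s p = 0) \<and>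
     (\<forall>f\<in>cells M. bidegree_poly_on d f s) \<and>
     smooth_x (d - 1) (mesh_domain M) s \<and> smooth_y (d - 1) (mesh_domain M) s}"


section \<open>Structural isomorphism and dimensional stability\<close>

definition cor :: "point set \<Rightarrow> real" where
  "cor l = (THE c. \<forall>p\<in>l. (if horizontal l then snd p else fst p) = c)"

definition structurally_isomorphic_map :: "tmesh \<Rightarrow> tmesh \<Rightarrow> (point set \<Rightarrow> point set) \<Rightarrow> bool" where
  "structurally_isomorphic_map M N \<alpha> \<longleftrightarrow>
     bij_betw \<alpha> (l_edges M) (l_edges N) \<and>
     \<alpha> ` boundary_l_edges M = boundary_l_edges N \<and>
     \<alpha> ` cross_cuts M = cross_cuts N \<and>
     \<alpha> ` rays M = rays N \<and>
     \<alpha> ` T_l_edges M = T_l_edges N \<and>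
     (\<forall>l\<in>l_edges M. \<forall>l'\<in>l_edges M. l \<inter> l' \<noteq> {} \<longleftrightarrow> \<alpha> l \<inter> \<alpha> l' \<noteq> {}) \<and>
     (\<forall>l\<in>l_edges M. \<forall>l'\<in>l_edges M.
        (horizontal l \<and> horizontal l' \<or> vertical l \<and> vertical l') \<longrightarrow>
        cor l < cor l' \<longrightarrow> cor (\<alpha> l) < cor (\<alpha> l'))"

definition structurally_isomorphic :: "tmesh \<Rightarrow> tmesh \<Rightarrow> bool" where
  "structurally_isomorphic M N \<longleftrightarrow> (\<exists>\<alpha>. structurally_isomorphic_map M N \<alpha>)"

text \<open>The order condition on coordinates is an implication in one direction only, and l-edges with
  equal coordinates are unconstrained; so the class consists of the T-meshes that \<open>M\<close> maps to.\<close>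

definition iso_class :: "tmesh \<Rightarrow> tmesh set" where
  "iso_class M = {N. t_mesh N \<and> structurally_isomorphic M N}"

definition dimensionally_stable :: "nat \<Rightarrow> tmesh \<Rightarrow> bool" where
  "dimensionally_stable d M \<longleftrightarrow> (\<forall>M1\<in>iso_class M. \<forall>M2\<in>iso_class M.
     fun_vs.dim (spline_space d M1) = fun_vs.dim (spline_space d M2))"


section \<open>The conformality matrix\<close>

definition coord_along :: "point set \<Rightarrow> point \<Rightarrow> real" where
  "coord_along l v = (if horizontal l then fst v else snd v)"

text \<open>Row \<open>(l, k)\<close> is the equation of order \<open>k\<close> of the T l-edge \<open>l\<close>; column \<open>v\<close> belongs to the
  unknown of the vertex \<open>v\<close>. Note that \<open>0 ^ 0 = 1\<close>.\<close>

definition conformality_matrix :: "point set \<times> nat \<Rightarrow> point \<Rightarrow> real" where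
  "conformality_matrix = (\<lambda>(l, k) v. if v \<in> l then coord_along l v ^ k else 0)"

definition conformality_rank :: "nat \<Rightarrow> tmesh \<Rightarrow> nat" where
  "conformality_rank d M = matrix_rank (T_l_edges M \<times> {..d}) (T_vertices M) conformality_matrix"

end

theory Submission
  imports Defs
begin

text \<open>
  The dimension of the spline space and the rank of the conformality matrix add up to a number that
  can be read off from the structure of the mesh:
  \<open>dim + rank = (d + 1) ^ 2 + (d + 1) * c + v\<close>,
  where \<open>c\<close> counts the cross-cuts and \<open>v\<close> the interior vertices (\<open>dim_spline_space_formula\<close>). Since
  \<open>c\<close> and \<open>v\<close> are invariant under structural isomorphism, the dimension is constant on an isomorphism
  class exactly if the rank is.

  The formula comes from smoothing cofactors. Across a horizontal edge on the line \<open>y = y0\<close> the two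
  polynomial pieces of a spline differ by \<open>b(x) (y - y0) ^ d\<close>, across a vertical edge on \<open>x = x0\<close> by
  \<open>a(y) (x - x0) ^ d\<close>. The jumps around an interior vertex \<open>(x0, y0)\<close> cancel, and comparing the two
  kinds of terms shows that \<open>a\<close> changes at the vertex by \<open>\<delta> (y - y0) ^ d\<close> and \<open>b\<close> by \<open>\<delta> (x - x0) ^ d\<close>
  with the same number \<open>\<delta>\<close> (\<open>cofactor_steps\<close>). Along an l-edge the cofactor is therefore determined by
  the numbers \<open>\<delta>\<close> of its vertices and one starting value. It vanishes beyond an interior end point: so a
  cross-cut contributes a free polynomial, a ray contributes nothing, and a T l-edge imposes
  \<open>\<Sum> \<delta>\<^sub>i (x - x\<^sub>i) ^ d = 0\<close>, which are its rows of the conformality matrix. Together with the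
  polynomial on one cell these data determine the spline, because the interior of the domain is
  connected (\<open>edge_connected\<close>, \<open>dof_values_inj\<close>).

  Conversely, compatible data have to be integrated to a spline (\<open>dof_values_surj\<close>), and this is where
  the domain has to be simply connected. Around every vertex the cofactors have a local
  potential. Local integer potentials define a continuous map from the domain to the unit circle, whose
  continuous logarithm is a global potential (\<open>integer_potential\<close>); real ones are reduced to integer ones
  by a basis over the rational numbers (\<open>real_potential\<close>). The same argument excludes pinch points of
  the domain.

  Interior vertices correspond to pairs of intersecting interior l-edges such that no boundary l-edge
  meets both of them (\<open>bij_interior_crossings\<close>), a description that every structural isomorphism
  respects.

  All of this is done on a grid that refines the mesh, with integer indices in place of coordinates;
  statements about vertical edges follow from those about horizontal edges by exchanging the two
  coordinates.
\<close>



section \<open>Linear algebra\<close>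

lemma dim_linear_image:
  fixes f :: "('a \<Rightarrow> real) \<Rightarrow> ('b \<Rightarrow> real)"
  assumes "Vector_Spaces.linear fun_scale fun_scale f" "fun_vs.subspace S" "inj_on f S"
  shows "fun_vs.dim (f ` S) = fun_vs.dim S"
proof -
  interpret vp: vector_space_pair "fun_scale :: real \<Rightarrow> ('a \<Rightarrow> real) \<Rightarrow> _"
      "fun_scale :: real \<Rightarrow> ('b \<Rightarrow> real) \<Rightarrow> _"
    by unfold_locales
  obtain B where B: "B \<subseteq> S" "fun_vs.independent B" "S \<subseteq> fun_vs.span B"
      "card B = fun_vs.dim S"
    using fun_vs.basis_exists by blast
  have spB: "fun_vs.span B = S"
    by (simp add: B(1,3) assms(2) fun_vs.span_minimal subset_antisym)
  have "fun_vs.independent (f ` B)"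
    using vp.linear_independent_injective_image[OF assms(1) B(2)] assms(3) spB by simp
  moreover have "fun_vs.span (f ` B) = f ` S"
    using vp.linear_span_image[OF assms(1), of B] spB by simp
  ultimately have "card (f ` B) = fun_vs.dim (f ` S)"
    using fun_vs.dim_eq_card[of "f ` B" "f ` S"] fun_vs.span_span by metis
  moreover have "card (f ` B) = card B"
    using assms(3) B(1) card_image inj_on_subset by metis
  ultimately show ?thesis using B(4) by simp
qed

definition pairing :: "'c set \<Rightarrow> ('c \<Rightarrow> real) \<Rightarrow> ('c \<Rightarrow> real) \<Rightarrow> real" where
  "pairing I u v = (\<Sum>c\<in>I. u c * v c)"

lemma pairing_simps:
  "pairing I (u + u') v = pairing I u v + pairing I u' v"
  "pairing I (u - u') v = pairing I u v - pairing I u' v"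
  "pairing I (fun_scale a u) v = a * pairing I u v"
  "pairing I 0 v = 0"
  by (simp_all add: pairing_def fun_scale_def sum.distrib sum_subtractf algebra_simps sum_distrib_left)

lemma pairing_commute: "pairing I u v = pairing I v u"
  by (simp add: pairing_def mult.commute)

lemma pairing_self_eq_0:
  assumes "finite I" "\<And>c. c \<notin> I \<Longrightarrow> u c = 0" "pairing I u u = 0"
  shows "u = 0"
proof
  fix c
  have "\<forall>c\<in>I. u c * u c = 0"
    using assms(3) sum_nonneg_eq_0_iff[OF assms(1), of "\<lambda>c. u c * u c"] by (simp add: pairing_def)
  then show "u c = 0 c" using assms(2)[of c] by (cases "c \<in> I") auto
qed

text \<open>Gram-Schmidt: the part of a new row that is orthogonal to the earlier rows is used to correct the
  remainder of \<open>x\<close> in the new direction without disturbing the earlier ones.\<close>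

lemma orthogonal_decomposition:
  assumes "finite I" "finite R" "\<And>r c. r \<in> R \<Longrightarrow> c \<notin> I \<Longrightarrow> r c = 0"
  shows "\<exists>u\<in>fun_vs.span R. \<forall>r\<in>R. pairing I r (x - u) = 0"
  using assms(2,3)
proof (induction R arbitrary: x rule: finite_induct)
  case empty
  then show ?case using fun_vs.span_zero by auto
next
  case (insert r R)
  have sub: "fun_vs.span R \<subseteq> fun_vs.span (insert r R)"
    by (simp add: fun_vs.span_mono subset_insertI)
  obtain u where u: "u \<in> fun_vs.span R" "\<forall>r\<in>R. pairing I r (x - u) = 0"
    using insert by (metis insert_iff)
  obtain w where w: "w \<in> fun_vs.span R" "\<forall>s\<in>R. pairing I s (r - w) = 0"
    using insert by (metis insert_iff)
  define r' where "r' = r - w"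
  have r': "r' \<in> fun_vs.span (insert r R)"
    unfolding r'_def using w(1) sub by (intro fun_vs.span_diff) (auto intro: fun_vs.span_base)
  have orth: "pairing I s y = 0" if "s \<in> fun_vs.span R" "\<forall>s\<in>R. pairing I s y = 0" for s y
    using that(1)
  proof (induction rule: fun_vs.span_induct_alt)
    case base then show ?case by (simp add: pairing_def)
  next
    case (step c x z) then show ?case unfolding pairing_simps using that(2) by simp
  qed
  have supp: "t c = 0" if "t \<in> fun_vs.span (insert r R)" "c \<notin> I" for t c
    using that(1)
  proof (induction rule: fun_vs.span_induct_alt)
    case base then show ?case by simp
  next
    case (step a x y) then show ?case using insert.prems that(2) by (auto simp: fun_scale_def)
  qed
  show ?case
  proof (cases "r' = 0")
    case True
    then have "r \<in> fun_vs.span R" using w(1) by (simp add: r'_def)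
    then show ?thesis using u sub orth[OF _ u(2)] by blast
  next
    case False
    then have nz: "pairing I r' r' \<noteq> 0"
      using pairing_self_eq_0[OF assms(1), of r'] supp[OF r'] by blast
    define a where "a = pairing I r' (x - u) / pairing I r' r'"
    define v where "v = u + fun_scale a r'"
    have xv: "x - v = (x - u) - fun_scale a r'" by (simp add: v_def)
    have R0: "pairing I s (x - v) = 0" if "s \<in> R" for s
    proof -
      have "pairing I (x - u) s = 0" "pairing I r' s = 0"
        using that u(2) w(2) unfolding r'_def by (metis pairing_commute)+
      then show ?thesis unfolding xv pairing_commute[of I s "_ - _"] pairing_simps by simp
    qed
    have "pairing I r' (x - v) = 0"
    proof -
      have "pairing I (x - v) r' = pairing I (x - u) r' - a * pairing I r' r'"
        unfolding xv by (simp only: pairing_simps(2)[of I "x - u"] pairing_simps(3))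
      then show ?thesis
        using nz unfolding pairing_commute[of I r' "x - v"] a_def pairing_commute[of I r' "x - u"] by simp
    qed
    moreover have "pairing I w (x - v) = 0"
      by (rule orth[OF w(1)]) (use R0 in blast)
    ultimately have "pairing I r (x - v) = 0" unfolding r'_def pairing_simps by simp
    moreover have "v \<in> fun_vs.span (insert r R)"
      unfolding v_def using u(1) sub r'
      by (intro fun_vs.span_add fun_vs.span_scale) auto
    ultimately show ?thesis using R0 by blast
  qed
qed

definition unit_fun :: "'c \<Rightarrow> 'c \<Rightarrow> real" where
  "unit_fun c = (\<lambda>x. if x = c then 1 else 0)"

lemma sum_fun_eval: "(\<Sum>i\<in>A. f i) x = (\<Sum>i\<in>A. f i x)"
  for f :: "'i \<Rightarrow> 'a \<Rightarrow> real"
  by (induction A rule: infinite_finite_induct) auto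

lemma supported_in_span:
  assumes "finite I"
  shows "{x :: 'c \<Rightarrow> real. \<forall>c. c \<notin> I \<longrightarrow> x c = 0} \<subseteq> fun_vs.span (unit_fun ` I)"
proof clarify
  fix x :: "'c \<Rightarrow> real" assume x: "\<forall>c. c \<notin> I \<longrightarrow> x c = 0"
  have "x = (\<Sum>c\<in>I. fun_scale (x c) (unit_fun c))"
  proof
    fix c
    have "(\<Sum>i\<in>I. fun_scale (x i) (unit_fun i)) c = (\<Sum>i\<in>I. if i = c then x c else 0)"
      unfolding sum_fun_eval by (rule sum.cong) (auto simp: fun_scale_def unit_fun_def)
    also have "\<dots> = x c" using assms x by simp
    finally show "x c = (\<Sum>i\<in>I. fun_scale (x i) (unit_fun i)) c" by simp
  qed
  also have "\<dots> \<in> fun_vs.span (unit_fun ` I)"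
    by (intro fun_vs.span_sum fun_vs.span_scale fun_vs.span_base) auto
  finally show "x \<in> fun_vs.span (unit_fun ` I)" .
qed

lemma dim_supported_functions:
  assumes "finite I"
  shows "fun_vs.dim {x :: 'c \<Rightarrow> real. \<forall>c. c \<notin> I \<longrightarrow> x c = 0} = card I"
proof -
  have inj: "inj unit_fun"
    by (rule injI) (metis unit_fun_def zero_neq_one)
  have "fun_vs.independent (unit_fun ` I :: ('c \<Rightarrow> real) set)"
  proof (rule fun_vs.independent_if_scalars_zero)
    fix f :: "('c \<Rightarrow> real) \<Rightarrow> real" and x :: "'c \<Rightarrow> real"
    assume s: "(\<Sum>x\<in>unit_fun ` I. fun_scale (f x) x) = 0" and "x \<in> unit_fun ` I"
    then obtain c where c: "c \<in> I" "x = unit_fun c" by auto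
    have "0 = (\<Sum>x\<in>unit_fun ` I. fun_scale (f x) x) c" using s by simp
    also have "\<dots> = (\<Sum>i\<in>I. fun_scale (f (unit_fun i)) (unit_fun i) c)"
      unfolding sum_fun_eval by (subst sum.reindex) (auto intro: inj_on_subset[OF inj])
    also have "\<dots> = (\<Sum>i\<in>I. if i = c then f (unit_fun c) else 0)"
      by (rule sum.cong) (auto simp: fun_scale_def unit_fun_def)
    also have "\<dots> = f x" using assms c by simp
    finally show "f x = 0" by simp
  qed (use assms in simp)
  moreover have "{x :: 'c \<Rightarrow> real. \<forall>c. c \<notin> I \<longrightarrow> x c = 0} \<subseteq> fun_vs.span (unit_fun ` I)"
    by (rule supported_in_span[OF assms])
  moreover have "unit_fun ` I \<subseteq> {x :: 'c \<Rightarrow> real. \<forall>c. c \<notin> I \<longrightarrow> x c = 0}"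
    by (auto simp: unit_fun_def)
  ultimately have "card (unit_fun ` I :: ('c \<Rightarrow> real) set) =
      fun_vs.dim {x :: 'c \<Rightarrow> real. \<forall>c. c \<notin> I \<longrightarrow> x c = 0}"
    by (intro fun_vs.basis_card_eq_dim)
  then show ?thesis using inj by (metis card_image inj_on_subset subset_UNIV)
qed

text \<open>Rank-nullity for a homogeneous linear system: the solution space is an orthogonal complement
  of the row space within the finite-dimensional space of functions supported on the columns.\<close>

lemma dim_solutions:
  fixes R :: "('c \<Rightarrow> real) set"
  assumes "finite I" "finite R" "\<And>r c. r \<in> R \<Longrightarrow> c \<notin> I \<Longrightarrow> r c = 0"
  shows "fun_vs.dim {x. (\<forall>c. c \<notin> I \<longrightarrow> x c = 0) \<and> (\<forall>r\<in>R. pairing I r x = 0)} + fun_vs.dim R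
    = card I"
proof -
  let ?V = "{x :: 'c \<Rightarrow> real. \<forall>c. c \<notin> I \<longrightarrow> x c = 0}"
  let ?W = "{x. (\<forall>c. c \<notin> I \<longrightarrow> x c = 0) \<and> (\<forall>r\<in>R. pairing I r x = 0)}"
  have V: "fun_vs.subspace ?V" by (auto simp: fun_vs.subspace_def fun_scale_def)
  have W: "fun_vs.subspace ?W"
    by (auto simp: fun_vs.subspace_def pairing_def fun_scale_def ring_distribs sum.distrib
        mult.left_commute sum_distrib_left[symmetric])
  obtain A where A: "A \<subseteq> R" "fun_vs.independent A" "R \<subseteq> fun_vs.span A" "card A = fun_vs.dim R"
    using fun_vs.basis_exists by blast
  obtain B where B: "B \<subseteq> ?W" "fun_vs.independent B" "?W \<subseteq> fun_vs.span B" "card B = fun_vs.dim ?W"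
    using fun_vs.basis_exists by blast
  have finA: "finite A" using A(1) assms(2) finite_subset by blast
  have "?V \<subseteq> fun_vs.span (unit_fun ` I)"
    by (rule supported_in_span[OF assms(1)])
  moreover have "B \<subseteq> ?V" using B(1) by auto
  ultimately have finB: "finite B"
    using fun_vs.independent_span_bound[of "unit_fun ` I" B] assms(1) B(2) by blast
  have spB: "fun_vs.span B = ?W" using B(1,3) W by (simp add: fun_vs.span_minimal subset_antisym)
  have AW: "x = 0" if "x \<in> fun_vs.span A" "x \<in> ?W" for x
  proof -
    have "x \<in> fun_vs.span R" using that(1) A(1) fun_vs.span_mono by blast
    moreover have "pairing I z x = 0" if "z \<in> fun_vs.span R" for z
      using that
    proof (induction rule: fun_vs.span_induct_alt)
      case base then show ?case by (simp add: pairing_def)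
    next
      case (step c y z)
      then show ?case unfolding pairing_simps using \<open>x \<in> ?W\<close> by simp
    qed
    ultimately show ?thesis using pairing_self_eq_0[OF assms(1), of x] that(2) by auto
  qed
  have ind: "fun_vs.independent (B \<union> S) \<and> B \<inter> S = {}" if "finite S" "S \<subseteq> A" for S
    using that
  proof (induction S rule: finite_induct)
    case empty then show ?case using B(2) by simp
  next
    case (insert a S)
    have "a \<notin> fun_vs.span (B \<union> S)"
    proof
      assume "a \<in> fun_vs.span (B \<union> S)"
      then obtain b s where bs: "b \<in> fun_vs.span B" "s \<in> fun_vs.span S" "a = b + s"
        unfolding fun_vs.span_Un by auto
      have "S \<subseteq> A" "a \<in> A" using insert by auto
      then have "a - s \<in> fun_vs.span A"
        using bs(2) fun_vs.span_mono[of S A] by (intro fun_vs.span_diff) (auto intro: fun_vs.span_base)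
      then have "a - s = 0" using AW bs spB by auto
      then have "a \<in> fun_vs.span S" using bs(2) by simp
      moreover have "S \<subseteq> A - {a}" using insert by auto
      ultimately have "a \<in> fun_vs.span (A - {a})" using fun_vs.span_mono by blast
      then show False using A(2) \<open>a \<in> A\<close> unfolding fun_vs.dependent_def by blast
    qed
    then show ?case using insert fun_vs.independent_insertI[of a "B \<union> S"] fun_vs.span_base[of a "B \<union> S"]
      by auto
  qed
  have BA: "fun_vs.independent (B \<union> A)" "B \<inter> A = {}" using ind[OF finA] by auto
  moreover have "?V \<subseteq> fun_vs.span (B \<union> A)"
  proof
    fix x assume x: "x \<in> ?V"
    obtain u where u: "u \<in> fun_vs.span R" "\<forall>r\<in>R. pairing I r (x - u) = 0"
      using orthogonal_decomposition[where x = x and I = I and R = R] assms by blast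
    have "R \<subseteq> ?V" using assms(3) by auto
    then have "u \<in> ?V" using u(1) V by (meson fun_vs.span_minimal subsetD)
    then have "x - u \<in> ?W" using x u(2) by simp
    then have "x - u \<in> fun_vs.span (B \<union> A)" using B(3) fun_vs.span_mono[of B "B \<union> A"] by blast
    moreover have "u \<in> fun_vs.span (B \<union> A)"
      using u(1) A(3) by (meson Un_upper2 fun_vs.span_minimal fun_vs.span_mono fun_vs.subspace_span subsetD)
    ultimately have "(x - u) + u \<in> fun_vs.span (B \<union> A)" by (rule fun_vs.span_add)
    then show "x \<in> fun_vs.span (B \<union> A)" by simp
  qed
  moreover have "B \<union> A \<subseteq> ?V" using \<open>B \<subseteq> ?V\<close> A(1) assms(3) by blast
  ultimately have "card (B \<union> A) = fun_vs.dim ?V" by (intro fun_vs.basis_card_eq_dim)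
  then show ?thesis
    using dim_supported_functions[OF assms(1)] A(4) B(4) finA finB BA(2)
    by (simp add: card_Un_disjoint)
qed

section \<open>Transposition\<close>

abbreviation flip :: "point set \<Rightarrow> point set" where
  "flip A \<equiv> prod.swap ` A"

lemma flip_flip [simp]: "flip (flip A) = A"
  by (simp add: image_comp)

lemma flip_eq_iff [simp]: "flip A = flip B \<longleftrightarrow> A = B"
  by (metis flip_flip)

lemma flip_subset_iff [simp]: "flip A \<subseteq> flip B \<longleftrightarrow> A \<subseteq> B"
  by (metis flip_flip image_mono)

lemma flip_Times [simp]: "flip (A \<times> B) = B \<times> A"
  by auto

lemma flip_Int: "flip (A \<inter> B) = flip A \<inter> flip B"
  by auto

lemma swap_in_flip [simp]: "prod.swap p \<in> flip A \<longleftrightarrow> p \<in> A"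
  by (metis flip_flip imageI swap_swap)

lemma Pair_in_flip [simp]: "(x, y) \<in> flip A \<longleftrightarrow> (y, x) \<in> A"
  by (metis swap_in_flip swap_simp)

lemma inj_flip: "inj_on ((`) prod.swap) (X :: point set set)"
  by (auto simp: inj_on_def)

lemma linear_swap: "linear (prod.swap :: point \<Rightarrow> point)"
  by (auto intro!: linearI simp: prod_eq_iff)

lemma interior_flip: "interior (flip A) = flip (interior A)"
proof -
  have o: "open (flip B)" if "open B" for B
    using open_bijective_linear_image_eq[OF linear_swap bij_swap] that by blast
  have sub: "flip (interior A) \<subseteq> interior (flip A)" for A
    by (rule interior_maximal[OF image_mono[OF interior_subset] o[OF open_interior]])
  have "flip (interior (flip A)) \<subseteq> interior A" using sub[of "flip A"] unfolding flip_flip .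
  then have "interior (flip A) \<subseteq> flip (interior A)" by (subst flip_subset_iff[symmetric]) simp
  with sub show ?thesis by blast
qed

lemma closure_flip: "closure (flip A) = flip (closure A)"
proof -
  have sub: "flip (closure A) \<subseteq> closure (flip A)" for A
    by (rule closure_bounded_linear_image_subset[OF linear_conv_bounded_linear[THEN iffD1, OF linear_swap]])
  have "flip (closure (flip A)) \<subseteq> closure A" using sub[of "flip A"] unfolding flip_flip .
  then have "closure (flip A) \<subseteq> flip (closure A)" by (subst flip_subset_iff[symmetric]) simp
  with sub show ?thesis by blast
qed

lemma frontier_flip: "frontier (flip A) = flip (frontier A)"
  unfolding frontier_def interior_flip closure_flip
  by (simp add: image_set_diff)

lemma endpoints_flip: "endpoints (flip A) = flip (endpoints A)"
proof -
  have sub: "flip (endpoints A) \<subseteq> endpoints (flip A)" for A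
    unfolding endpoints_def
    by (auto simp del: image_Collect) (metis closed_segment_linear_image linear_swap swap_simp)
  show ?thesis using sub[of A] sub[of "flip A"] by (metis flip_flip flip_subset_iff subset_antisym)
qed

lemma horizontal_flip [simp]: "horizontal (flip l) \<longleftrightarrow> vertical l"
proof -
  have "vertical l \<Longrightarrow> horizontal (flip l)" "horizontal l \<Longrightarrow> vertical (flip l)" for l
    unfolding horizontal_def vertical_def using flip_Times by blast+
  then show ?thesis by (metis flip_flip)
qed

lemma vertical_flip [simp]: "vertical (flip l) \<longleftrightarrow> horizontal l"
  by (metis flip_flip horizontal_flip)

lemma rectangle_flip [simp]: "rectangle (flip f) \<longleftrightarrow> rectangle f"
proof -
  have "rectangle f \<Longrightarrow> rectangle (flip f)" for f
    unfolding rectangle_def using flip_Times by metis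
  then show ?thesis by (metis flip_flip)
qed

lemma connected_flip [simp]: "connected (flip A) \<longleftrightarrow> connected A"
proof -
  have "connected A \<Longrightarrow> connected (flip A)" for A
    by (intro connected_continuous_image continuous_intros)
  then show ?thesis by (metis flip_flip)
qed

lemma collinear_flip [simp]: "collinear (flip A) \<longleftrightarrow> collinear A"
proof -
  have "collinear A \<Longrightarrow> collinear (flip A)" for A
  proof -
    assume "collinear A"
    then obtain u where "\<And>x y. x \<in> A \<Longrightarrow> y \<in> A \<Longrightarrow> \<exists>c. x - y = c *\<^sub>R u"
      unfolding collinear_def by blast
    then have "\<exists>c. prod.swap x - prod.swap y = c *\<^sub>R prod.swap u" if "x \<in> A" "y \<in> A" for x y
      using that by (metis linear_diff linear_scale linear_swap)
    then show ?thesis unfolding collinear_def by blast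
  qed
  then show ?thesis by (metis flip_flip)
qed

lemma simply_connected_flip [simp]: "simply_connected (flip A) \<longleftrightarrow> simply_connected A"
proof -
  have "flip A homeomorphic A"
    unfolding homeomorphic_def homeomorphism_def
    by (intro exI[of _ prod.swap] conjI continuous_intros) (auto simp: image_comp)
  then show ?thesis using homeomorphic_simply_connected_eq by blast
qed

definition transpose_mesh :: "tmesh \<Rightarrow> tmesh" where
  "transpose_mesh M = \<lparr>cells = flip ` cells M, edges = flip ` edges M\<rparr>"

lemma cells_transpose [simp]: "cells (transpose_mesh M) = flip ` cells M"
  and edges_transpose [simp]: "edges (transpose_mesh M) = flip ` edges M"
  by (simp_all add: transpose_mesh_def)

lemma flip_Union: "flip (\<Union>F) = \<Union>(flip ` F)"
  by auto

lemma vertices_transpose [simp]: "vertices (transpose_mesh M) = flip (vertices M)"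
  by (simp add: vertices_def endpoints_flip image_UN)

lemma mesh_domain_transpose [simp]: "mesh_domain (transpose_mesh M) = flip (mesh_domain M)"
  by (simp add: mesh_domain_def flip_Union)

text \<open>The axioms of a mesh treat the two directions alike, so each lemma about horizontal edges yields
  the one about vertical edges when it is applied to the transposed mesh.\<close>

lemma t_mesh_transpose:
  assumes "t_mesh M" shows "t_mesh (transpose_mesh M)"
proof -
  have fr: "(\<Union>f\<in>flip ` cells M. frontier f) = flip (\<Union>f\<in>cells M. frontier f)"
    by (auto simp: frontier_flip)
  have c2: "\<exists>E\<subseteq>flip ` edges M. frontier (flip f) = \<Union>E" if f: "f \<in> cells M" for f
  proof -
    obtain E where E: "E \<subseteq> edges M" "frontier f = \<Union>E"
      using assms f unfolding t_mesh_def by meson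
    then have "frontier (flip f) = \<Union>(flip ` E)" by (simp add: frontier_flip flip_Union)
    then show ?thesis using E(1) by (meson image_mono)
  qed
  have c3: "flip f \<inter> flip f' = frontier (flip f) \<inter> frontier (flip f') \<and>
        (\<exists>V\<subseteq>flip (vertices M). \<exists>E\<subseteq>flip ` edges M. flip f \<inter> flip f' = V \<union> \<Union>E)"
    if f: "f \<in> cells M" "f' \<in> cells M" "f \<noteq> f'" for f f'
  proof -
    have "f \<inter> f' = frontier f \<inter> frontier f' \<and>
        (\<exists>V\<subseteq>vertices M. \<exists>E\<subseteq>edges M. f \<inter> f' = V \<union> \<Union>E)"
      using assms f unfolding t_mesh_def by meson
    then obtain V E where VE: "f \<inter> f' = frontier f \<inter> frontier f'" "V \<subseteq> vertices M" "E \<subseteq> edges M"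
        "f \<inter> f' = V \<union> \<Union>E" by auto
    have "flip f \<inter> flip f' = flip V \<union> \<Union>(flip ` E)"
      unfolding flip_Int[symmetric] VE(4) by (simp add: image_Un flip_Union)
    moreover have "flip f \<inter> flip f' = frontier (flip f) \<inter> frontier (flip f')"
      unfolding flip_Int[symmetric] frontier_flip by (simp add: VE(1))
    ultimately show ?thesis using VE(2,3) by (meson image_mono)
  qed
  have c4: "flip l \<inter> flip l' = endpoints (flip l) \<inter> endpoints (flip l') \<and> flip l \<inter> flip l' \<subseteq> flip (vertices M)"
    if l: "l \<in> edges M" "l' \<in> edges M" "l \<noteq> l'" for l l'
  proof -
    have "l \<inter> l' = endpoints l \<inter> endpoints l' \<and> l \<inter> l' \<subseteq> vertices M"
      using assms l unfolding t_mesh_def by meson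
    then show ?thesis unfolding flip_Int[symmetric] endpoints_flip flip_subset_iff by blast
  qed
  have c5: "\<exists>h\<in>flip ` edges M. \<exists>w\<in>flip ` edges M. horizontal h \<and> vertical w \<and> h \<inter> w = {prod.swap v}"
    if v: "v \<in> vertices M" for v
  proof -
    obtain h w where hw: "h \<in> edges M" "w \<in> edges M" "horizontal h" "vertical w" "h \<inter> w = {v}"
      using assms v unfolding t_mesh_def by meson
    then have "flip w \<inter> flip h = {prod.swap v}"
      unfolding flip_Int[symmetric] by (simp add: Int_commute)
    then show ?thesis using hw by (meson horizontal_flip imageI vertical_flip)
  qed
  have props: "finite (cells M)" "\<forall>f\<in>cells M. rectangle f" "finite (edges M)"
    "\<forall>l\<in>edges M. horizontal l \<or> vertical l" "\<forall>l\<in>edges M. l \<subseteq> (\<Union>f\<in>cells M. frontier f)"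
    "simply_connected (mesh_domain M)" "connected (interior (mesh_domain M))"
    using assms unfolding t_mesh_def by simp_all
  have 1: "finite (flip ` cells M)" "finite (flip ` edges M)"
    using props(1,3) by auto
  have 2: "\<forall>f\<in>flip ` cells M. rectangle f" "\<forall>l\<in>flip ` edges M. horizontal l \<or> vertical l"
    using props(2,4) by auto
  have 3: "\<forall>l\<in>flip ` edges M. l \<subseteq> (\<Union>f\<in>flip ` cells M. frontier f)"
    unfolding fr using props(5) by (metis flip_subset_iff imageE)
  have 4: "\<forall>f\<in>flip ` cells M. \<exists>E\<subseteq>flip ` edges M. frontier f = \<Union>E"
  proof
    fix f assume "f \<in> flip ` cells M"
    then obtain g where "g \<in> cells M" "f = flip g" by blast
    with c2[of g] show "\<exists>E\<subseteq>flip ` edges M. frontier f = \<Union>E" by (simp only:)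
  qed
  have 5: "\<forall>f\<in>flip ` cells M. \<forall>f'\<in>flip ` cells M. f \<noteq> f' \<longrightarrow>
        f \<inter> f' = frontier f \<inter> frontier f' \<and>
        (\<exists>V\<subseteq>flip (vertices M). \<exists>E\<subseteq>flip ` edges M. f \<inter> f' = V \<union> \<Union>E)"
  proof (intro ballI impI)
    fix f f' assume "f \<in> flip ` cells M" "f' \<in> flip ` cells M" and ne: "f \<noteq> f'"
    then obtain g g' where g: "g \<in> cells M" "f = flip g" "g' \<in> cells M" "f' = flip g'" by blast
    with ne have "g \<noteq> g'" by blast
    then show "f \<inter> f' = frontier f \<inter> frontier f' \<and>
        (\<exists>V\<subseteq>flip (vertices M). \<exists>E\<subseteq>flip ` edges M. f \<inter> f' = V \<union> \<Union>E)"
      unfolding g(2,4) by (rule c3[OF g(1,3)])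
  qed
  have 6: "\<forall>l\<in>flip ` edges M. \<forall>l'\<in>flip ` edges M. l \<noteq> l' \<longrightarrow>
        l \<inter> l' = endpoints l \<inter> endpoints l' \<and> l \<inter> l' \<subseteq> flip (vertices M)"
  proof (intro ballI impI)
    fix f f' assume "f \<in> flip ` edges M" "f' \<in> flip ` edges M" and ne: "f \<noteq> f'"
    then obtain g g' where g: "g \<in> edges M" "f = flip g" "g' \<in> edges M" "f' = flip g'" by blast
    with ne have "g \<noteq> g'" by blast
    then show "f \<inter> f' = endpoints f \<inter> endpoints f' \<and> f \<inter> f' \<subseteq> flip (vertices M)"
      unfolding g(2,4) by (rule c4[OF g(1,3)])
  qed
  have 7: "\<forall>v\<in>flip (vertices M). \<exists>h\<in>flip ` edges M. \<exists>w\<in>flip ` edges M.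
      horizontal h \<and> vertical w \<and> h \<inter> w = {v}"
  proof
    fix v assume "v \<in> flip (vertices M)"
    then obtain u where "u \<in> vertices M" "v = prod.swap u" by blast
    with c5[of u] show "\<exists>h\<in>flip ` edges M. \<exists>w\<in>flip ` edges M.
      horizontal h \<and> vertical w \<and> h \<inter> w = {v}" by (simp only:)
  qed
  have 8: "simply_connected (flip (mesh_domain M))" "connected (interior (flip (mesh_domain M)))"
    using props(6,7) by (simp_all add: interior_flip)
  show ?thesis
    unfolding t_mesh_def mesh_domain_transpose vertices_transpose cells_transpose edges_transpose
    by (intro conjI 1 2 3 4 5 6 7 8)
qed

lemma interior_edges_transpose [simp]: "interior_edges (transpose_mesh M) = flip ` interior_edges M"
  by (auto simp: interior_edges_def frontier_flip)

lemma boundary_edges_transpose [simp]: "boundary_edges (transpose_mesh M) = flip ` boundary_edges M"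
  by (auto simp: boundary_edges_def frontier_flip)

lemma segments_flip: "segments (flip ` E) = flip ` segments E"
proof -
  have sub: "flip ` segments E \<subseteq> segments (flip ` E)" for E
  proof clarify
    fix s assume "s \<in> segments E"
    then obtain F where F: "F \<subseteq> E" "F \<noteq> {}" "s = \<Union>F" "connected s" "collinear s"
      unfolding segments_def by blast
    have "flip ` F \<subseteq> flip ` E \<and> flip ` F \<noteq> {} \<and> flip s = \<Union>(flip ` F) \<and> connected (flip s) \<and> collinear (flip s)"
      unfolding flip_Union[symmetric] F(3)[symmetric] using F by (intro conjI) (auto simp del: image_Union)
    then show "flip s \<in> segments (flip ` E)" unfolding segments_def by blast
  qed
  have "flip ` flip ` segments (flip ` E) \<subseteq> flip ` segments (flip ` flip ` E)"
    by (intro image_mono sub)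
  then show ?thesis using sub[of E] by (simp add: image_comp comp_def subset_antisym)
qed

lemma maximal_segments_flip: "maximal_segments (flip ` E) = flip ` maximal_segments E"
  unfolding maximal_segments_def segments_flip by auto

lemma interior_l_edges_transpose [simp]:
  "interior_l_edges (transpose_mesh M) = flip ` interior_l_edges M"
  by (simp add: interior_l_edges_def maximal_segments_flip)

lemma boundary_l_edges_transpose [simp]:
  "boundary_l_edges (transpose_mesh M) = flip ` boundary_l_edges M"
  by (simp add: boundary_l_edges_def maximal_segments_flip)

section \<open>Refining a mesh to a grid\<close>

text \<open>Lines are numbered by all integers and exhaust the real axis on both sides, so that no line of the
  grid is exceptional.\<close>

definition grid_line :: "(int \<Rightarrow> real) \<Rightarrow> bool" where
  "grid_line x \<longleftrightarrow> strict_mono x \<and> (\<forall>t. \<exists>i. x i \<le> t \<and> t < x (i + 1))"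

lemma strict_mono_intI:
  fixes x :: "int \<Rightarrow> real"
  assumes "\<And>i. x i < x (i + 1)" shows "strict_mono x"
proof (rule strict_monoI)
  fix i j :: int assume "i < j"
  then show "x i < x j"
    by (induction j rule: int_gr_induct) (use assms less_trans in blast)+
qed

text \<open>Coordinates are added in increasing order: the lines up to the largest old coordinate are kept,
  the new coordinate is the next line, and unit steps follow.\<close>

lemma grid_line_exists:
  assumes "finite X" shows "\<exists>x. grid_line x \<and> X \<subseteq> range x"
  using assms
proof (induction X rule: finite_linorder_max_induct)
  case empty
  have "grid_line (of_int :: int \<Rightarrow> real)"
    unfolding grid_line_def
    by (auto simp: strict_mono_def) (metis floor_correct of_int_1 of_int_add)
  then show ?case by auto
next
  case (insert b A)
  then obtain x :: "int \<Rightarrow> real" where x: "strict_mono x" "\<And>t. \<exists>i. x i \<le> t \<and> t < x (i + 1)" "A \<subseteq> range x"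
    unfolding grid_line_def by blast
  obtain k0 where k0: "x k0 \<le> b - 1" using x(2) by blast
  obtain I where I: "finite I" "A = x ` I"
    using x(3) insert.hyps(1) by (meson finite_subset_image)
  define k where "k = Max (insert k0 I)"
  have kI: "k = k0 \<or> k \<in> I" using I(1) Max_in[of "insert k0 I"] unfolding k_def by auto
  then have xk: "x k < b" using k0 I(2) insert.hyps(2) by auto
  have le: "i \<le> k" if "i \<in> I" for i
    unfolding k_def using I(1) that by (intro Max_ge) auto
  define x' where "x' = (\<lambda>i. if i \<le> k then x i else b + of_int (i - k - 1))"
  have "strict_mono x'"
  proof (rule strict_mono_intI)
    fix i
    consider "i < k" | "i = k" | "i > k" by linarith
    then show "x' i < x' (i + 1)"
      by cases (use xk x(1) in \<open>auto simp: x'_def strict_mono_def\<close>)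
  qed
  moreover have "\<exists>i. x' i \<le> t \<and> t < x' (i + 1)" for t
  proof -
    consider "t \<ge> b" | "x k \<le> t" "t < b" | "t < x k" by linarith
    then show ?thesis
    proof cases
      case 1
      have f: "of_int \<lfloor>t - b\<rfloor> \<le> t - b" "t - b < of_int \<lfloor>t - b\<rfloor> + 1" by linarith+
      have "\<lfloor>t - b\<rfloor> \<ge> 0" using 1 by simp
      have "x' (k + 1 + \<lfloor>t - b\<rfloor>) = b + of_int \<lfloor>t - b\<rfloor>"
          "x' (k + 1 + \<lfloor>t - b\<rfloor> + 1) = b + of_int \<lfloor>t - b\<rfloor> + 1"
        using \<open>\<lfloor>t - b\<rfloor> \<ge> 0\<close> unfolding x'_def by (smt (verit, best) of_int_add of_int_1)+
      then show ?thesis using f(1,2) by (intro exI[of _ "k + 1 + \<lfloor>t - b\<rfloor>"]) linarith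
    next
      case 2 then show ?thesis by (intro exI[of _ k]) (auto simp: x'_def)
    next
      case 3
      obtain i where i: "x i \<le> t" "t < x (i + 1)" using x(2) by blast
      have "i < k" using i(1) 3 x(1) by (meson linorder_not_le order_le_less_trans strict_mono_less_eq leD)
      then show ?thesis using i by (intro exI[of _ i]) (auto simp: x'_def)
    qed
  qed
  moreover have "insert b A \<subseteq> range x'"
  proof -
    have "b = x' (k + 1)" by (simp add: x'_def)
    moreover have "x i = x' i" if "i \<in> I" for i using le[OF that] by (simp add: x'_def)
    ultimately show ?thesis using I(2) by auto
  qed
  ultimately show ?case unfolding grid_line_def by blast
qed

lemma frontier_rectangle:
  fixes a b c e :: real
  assumes "a < b" "c < e"
  shows "frontier ({a..b} \<times> {c..e}) =
    {(x, y). a \<le> x \<and> x \<le> b \<and> c \<le> y \<and> y \<le> e \<and> (x = a \<or> x = b \<or> y = c \<or> y = e)}"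
  using assms by (auto simp: frontier_def closure_Times interior_Times)

text \<open>All sides of cells lie on grid lines, so that every mesh cell is a block of grid cells.\<close>

locale grid_mesh =
  fixes M :: tmesh and xs ys :: "int \<Rightarrow> real"
  assumes mesh: "t_mesh M"
    and xs: "grid_line xs" and ys: "grid_line ys"
    and cells_on_grid: "f \<in> cells M \<Longrightarrow>
      \<exists>a b c e. a < b \<and> c < e \<and> f = {xs a..xs b} \<times> {ys c..ys e}"
begin

lemma transposed: "grid_mesh (transpose_mesh M) ys xs"
proof
  fix f assume "f \<in> cells (transpose_mesh M)"
  then obtain g where g: "g \<in> cells M" "f = flip g" by auto
  obtain a b c e where "a < b" "c < e" "g = {xs a..xs b} \<times> {ys c..ys e}"
    using cells_on_grid[OF g(1)] by blast
  then show "\<exists>a b c e. a < b \<and> c < e \<and> f = {ys a..ys b} \<times> {xs c..xs e}"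
    using g(2) flip_Times by blast
qed (use t_mesh_transpose[OF mesh] xs ys in auto)

lemma xs_less [simp]: "xs i < xs j \<longleftrightarrow> i < j" and xs_le [simp]: "xs i \<le> xs j \<longleftrightarrow> i \<le> j"
  and xs_eq [simp]: "xs i = xs j \<longleftrightarrow> i = j"
  and ys_less [simp]: "ys i < ys j \<longleftrightarrow> i < j" and ys_le [simp]: "ys i \<le> ys j \<longleftrightarrow> i \<le> j"
  and ys_eq [simp]: "ys i = ys j \<longleftrightarrow> i = j"
  using xs ys by (auto simp: grid_line_def strict_mono_less strict_mono_less_eq strict_mono_eq)

lemma xs_between_iff: "xs i < t \<Longrightarrow> t < xs (i + 1) \<Longrightarrow> xs a \<le> t \<longleftrightarrow> a \<le> i"
    "xs i < t \<Longrightarrow> t < xs (i + 1) \<Longrightarrow> t \<le> xs a \<longleftrightarrow> i + 1 \<le> a"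
    "xs i < t \<Longrightarrow> t < xs (i + 1) \<Longrightarrow> t \<noteq> xs a"
    "xs i < t \<Longrightarrow> t < xs (i + 1) \<Longrightarrow> xs a < t \<longleftrightarrow> a \<le> i"
    "xs i < t \<Longrightarrow> t < xs (i + 1) \<Longrightarrow> t < xs a \<longleftrightarrow> i + 1 \<le> a"
proof -
  assume t: "xs i < t" "t < xs (i + 1)"
  have A: "a \<le> i \<Longrightarrow> xs a < t" "i + 1 \<le> a \<Longrightarrow> t < xs a"
    using t xs_le[of a i] xs_le[of "i + 1" a] by linarith+
  then show "xs a \<le> t \<longleftrightarrow> a \<le> i" "t \<le> xs a \<longleftrightarrow> i + 1 \<le> a" "t \<noteq> xs a" "xs a < t \<longleftrightarrow> a \<le> i"
    "t < xs a \<longleftrightarrow> i + 1 \<le> a"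
    by (smt (verit, best))+
qed

lemma ys_between_iff: "ys i < t \<Longrightarrow> t < ys (i + 1) \<Longrightarrow> ys a \<le> t \<longleftrightarrow> a \<le> i"
    "ys i < t \<Longrightarrow> t < ys (i + 1) \<Longrightarrow> t \<le> ys a \<longleftrightarrow> i + 1 \<le> a"
    "ys i < t \<Longrightarrow> t < ys (i + 1) \<Longrightarrow> t \<noteq> ys a"
    "ys i < t \<Longrightarrow> t < ys (i + 1) \<Longrightarrow> ys a < t \<longleftrightarrow> a \<le> i"
    "ys i < t \<Longrightarrow> t < ys (i + 1) \<Longrightarrow> t < ys a \<longleftrightarrow> i + 1 \<le> a"
proof -
  interpret T: grid_mesh "transpose_mesh M" ys xs by (rule transposed)
  assume "ys i < t" "t < ys (i + 1)"
  then show "ys a \<le> t \<longleftrightarrow> a \<le> i" "t \<le> ys a \<longleftrightarrow> i + 1 \<le> a" "t \<noteq> ys a" "ys a < t \<longleftrightarrow> a \<le> i"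
    "t < ys a \<longleftrightarrow> i + 1 \<le> a"
    by (fact T.xs_between_iff)+
qed

definition gc :: "int \<times> int \<Rightarrow> point set" where
  "gc Q = {xs (fst Q)..xs (fst Q + 1)} \<times> {ys (snd Q)..ys (snd Q + 1)}"

definition inside :: "(int \<times> int) set" where
  "inside = {Q. \<exists>f\<in>cells M. gc Q \<subseteq> f}"

definition own :: "int \<times> int \<Rightarrow> point set" where
  "own Q = (THE f. f \<in> cells M \<and> gc Q \<subseteq> f)"

lemma gc_subset_iff:
  "gc (i, j) \<subseteq> {xs a..xs b} \<times> {ys c..ys e} \<longleftrightarrow> a \<le> i \<and> i < b \<and> c \<le> j \<and> j < e"
  unfolding gc_def times_subset_iff by simp linarith

lemma finite_cells: "finite (cells M)" and finite_edges: "finite (edges M)"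
  using mesh by (auto simp: t_mesh_def)

lemma mid_between: "xs i < (xs i + xs (i + 1)) / 2" "(xs i + xs (i + 1)) / 2 < xs (i + 1)"
  "ys j < (ys j + ys (j + 1)) / 2" "(ys j + ys (j + 1)) / 2 < ys (j + 1)"
  using xs_less[of i "i + 1"] ys_less[of j "j + 1"] by (auto simp: field_simps)

lemma open_gc_cell:
  assumes "f \<in> cells M" "(x, y) \<in> f" "xs i < x" "x < xs (i + 1)" "ys j < y" "y < ys (j + 1)"
  shows "gc (i, j) \<subseteq> f"
proof -
  obtain a b c e where "a < b" "c < e" "f = {xs a..xs b} \<times> {ys c..ys e}"
    using cells_on_grid[OF assms(1)] by blast
  moreover have "xs a \<le> x \<longleftrightarrow> a \<le> i" "x \<le> xs b \<longleftrightarrow> i + 1 \<le> b"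
      "ys c \<le> y \<longleftrightarrow> c \<le> j" "y \<le> ys e \<longleftrightarrow> j + 1 \<le> e"
    by (fact xs_between_iff(1,2)[OF assms(3,4)] ys_between_iff(1,2)[OF assms(5,6)])+
  ultimately show ?thesis using assms(2) gc_subset_iff[of i j a b c e] by auto
qed

text \<open>The centre of a grid cell is not on the frontier of a mesh cell that contains the grid cell, whereas
  distinct mesh cells meet only in their frontiers.\<close>

lemma cell_unique:
  assumes "f \<in> cells M" "f' \<in> cells M" "gc Q \<subseteq> f" "gc Q \<subseteq> f'"
  shows "f = f'"
proof (rule ccontr)
  assume "f \<noteq> f'"
  then have "f \<inter> f' = frontier f \<inter> frontier f'" using mesh assms unfolding t_mesh_def by meson
  obtain a b c e where f: "a < b" "c < e" "f = {xs a..xs b} \<times> {ys c..ys e}"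
    using cells_on_grid[OF assms(1)] by blast
  obtain i j where Q: "Q = (i, j)" by fastforce
  define x where "x = (xs i + xs (i + 1)) / 2"
  define y where "y = (ys j + ys (j + 1)) / 2"
  have x: "xs i < x" "x < xs (i + 1)" and y: "ys j < y" "y < ys (j + 1)"
    unfolding x_def y_def by (fact mid_between)+
  have m: "(x, y) \<in> gc Q" using x y by (simp add: gc_def Q)
  have "xs a < xs b" "ys c < ys e" using f by simp_all
  moreover have "x \<noteq> xs a" "x \<noteq> xs b" "y \<noteq> ys c" "y \<noteq> ys e"
    using xs_between_iff(3)[OF x] ys_between_iff(3)[OF y] by blast+
  ultimately have "(x, y) \<notin> frontier f" unfolding f(3) by (simp add: frontier_rectangle)
  then show False using m assms(3,4) \<open>f \<inter> f' = _\<close> by blast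
qed

lemma own_eqI: "f \<in> cells M \<Longrightarrow> gc Q \<subseteq> f \<Longrightarrow> own Q = f"
  unfolding own_def by (rule the_equality) (blast dest: cell_unique)+

lemma own_cell: "Q \<in> inside \<Longrightarrow> own Q \<in> cells M \<and> gc Q \<subseteq> own Q"
proof -
  assume "Q \<in> inside"
  then obtain f where "f \<in> cells M" "gc Q \<subseteq> f" unfolding inside_def by blast
  with own_eqI[OF this] show ?thesis by simp
qed

lemma insideI: "f \<in> cells M \<Longrightarrow> gc Q \<subseteq> f \<Longrightarrow> Q \<in> inside"
  unfolding inside_def by blast

lemma covers_line:
  obtains i where "xs i \<le> t" "t < xs (i + 1)" "xs a \<le> t \<Longrightarrow> a \<le> i" "t < xs b \<Longrightarrow> i < b"
proof -
  obtain i where i: "xs i \<le> t" "t < xs (i + 1)" using xs by (auto simp: grid_line_def)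
  have "a \<le> i" if "xs a \<le> t" using that i(2) xs_less[of a "i + 1"] by linarith
  moreover have "i < b" if "t < xs b" using that i(1) xs_less[of i b] by linarith
  ultimately show ?thesis using that i by blast
qed

lemma in_interval_unit:
  assumes "a < b" "xs a \<le> t" "t \<le> xs b"
  obtains i where "a \<le> i" "i < b" "xs i \<le> t" "t \<le> xs (i + 1)"
proof (cases "t = xs b")
  case True then show ?thesis using that[of "b - 1"] assms by auto
next
  case False
  then have "t < xs b" using assms by simp
  obtain i where "xs i \<le> t" "t < xs (i + 1)" "xs a \<le> t \<Longrightarrow> a \<le> i" "t < xs b \<Longrightarrow> i < b"
    using covers_line[of t a b] by metis
  with \<open>t < xs b\<close> show ?thesis using that[of i] assms(2) by simp
qed

lemma cell_covered:
  assumes "f \<in> cells M" "p \<in> f"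
  obtains Q where "Q \<in> inside" "own Q = f" "p \<in> gc Q"
proof -
  interpret T: grid_mesh "transpose_mesh M" ys xs by (rule transposed)
  obtain a b c e where f: "a < b" "c < e" "f = {xs a..xs b} \<times> {ys c..ys e}"
    using cells_on_grid[OF assms(1)] by blast
  obtain x y where p: "p = (x, y)" by fastforce
  obtain i where i: "a \<le> i" "i < b" "xs i \<le> x" "x \<le> xs (i + 1)"
    using in_interval_unit[of a b x] f assms p by auto
  obtain j where j: "c \<le> j" "j < e" "ys j \<le> y" "y \<le> ys (j + 1)"
    using T.in_interval_unit[of c e y] f assms p by auto
  have "gc (i, j) \<subseteq> f" using f i j by (simp add: gc_subset_iff)
  then show ?thesis using that[of "(i, j)"] i j p assms(1)
    by (metis (lifting) SigmaI atLeastAtMost_iff fst_conv gc_def insideI own_eqI snd_conv)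
qed

lemma domain_eq: "mesh_domain M = \<Union>(gc ` inside)"
proof
  show "mesh_domain M \<subseteq> \<Union>(gc ` inside)"
  proof
    fix p assume "p \<in> mesh_domain M"
    then obtain f where "f \<in> cells M" "p \<in> f" unfolding mesh_domain_def by blast
    then show "p \<in> \<Union>(gc ` inside)" by (rule cell_covered) blast
  qed
  show "\<Union>(gc ` inside) \<subseteq> mesh_domain M"
    unfolding mesh_domain_def using own_cell by blast
qed

lemma finite_inside: "finite inside"
proof -
  have "inside \<subseteq> (\<Union>f\<in>cells M. {Q. gc Q \<subseteq> f})" by (auto simp: inside_def)
  moreover have "finite {Q. gc Q \<subseteq> f}" if "f \<in> cells M" for f
  proof -
    obtain a b c e where f: "a < b" "c < e" "f = {xs a..xs b} \<times> {ys c..ys e}"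
      using cells_on_grid[OF \<open>f \<in> cells M\<close>] by blast
    have "{Q. gc Q \<subseteq> f} \<subseteq> {a..<b} \<times> {c..<e}"
    proof
      fix Q assume "Q \<in> {Q. gc Q \<subseteq> f}"
      then have "gc (fst Q, snd Q) \<subseteq> f" by simp
      then show "Q \<in> {a..<b} \<times> {c..<e}" unfolding f(3) gc_subset_iff by (simp add: mem_Times_iff)
    qed
    then show "finite {Q. gc Q \<subseteq> f}" by (rule finite_subset) simp
  qed
  ultimately show ?thesis using finite_subset[OF _ finite_UN_I[OF finite_cells]] by blast
qed

lemma gc_subset_domain: "Q \<in> inside \<Longrightarrow> gc Q \<subseteq> mesh_domain M"
  unfolding domain_eq by blast

lemma open_gc_domain:
  assumes "(x, y) \<in> mesh_domain M" "xs i < x" "x < xs (i + 1)" "ys j < y" "y < ys (j + 1)"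
  shows "(i, j) \<in> inside"
proof -
  obtain f where "f \<in> cells M" "(x, y) \<in> f" using assms(1) unfolding mesh_domain_def by blast
  then show ?thesis using insideI open_gc_cell assms(2-5) by blast
qed

lemma unit_neighbourhood:
  obtains u w where "u < t" "t < w"
    "\<And>s. u < s \<Longrightarrow> s < w \<Longrightarrow> \<exists>i. t \<in> {xs i..xs (i + 1)} \<and> s \<in> {xs i..xs (i + 1)}"
proof -
  obtain i where i: "xs i \<le> t" "t < xs (i + 1)" using xs by (auto simp: grid_line_def)
  show ?thesis
  proof (cases "t = xs i")
    case True
    have "\<exists>k. t \<in> {xs k..xs (k + 1)} \<and> s \<in> {xs k..xs (k + 1)}" if "xs (i - 1) < s" "s < xs (i + 1)" for s
    proof (cases "s < t")
      case True then show ?thesis using that \<open>t = xs i\<close> by (intro exI[of _ "i - 1"]) auto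
    next
      case False then show ?thesis using that \<open>t = xs i\<close> by (intro exI[of _ i]) auto
    qed
    then show ?thesis using that[of "xs (i - 1)" "xs (i + 1)"] True by simp
  next
    case False
    have "\<exists>k. t \<in> {xs k..xs (k + 1)} \<and> s \<in> {xs k..xs (k + 1)}" if "xs i < s" "s < xs (i + 1)" for s
      using that i by (intro exI[of _ i]) auto
    then show ?thesis using that[of "xs i" "xs (i + 1)"] i False by simp
  qed
qed

text \<open>The grid cells that contain a point cover a neighbourhood of it; and each of them is the closure
  of its interior, which near an interior point meets the domain and so lies in a cell.\<close>

lemma interior_domain_iff: "p \<in> interior (mesh_domain M) \<longleftrightarrow> (\<forall>Q. p \<in> gc Q \<longrightarrow> Q \<in> inside)"
proof
  assume p: "p \<in> interior (mesh_domain M)"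
  show "\<forall>Q. p \<in> gc Q \<longrightarrow> Q \<in> inside"
  proof clarify
    fix i j assume Q: "p \<in> gc (i, j)"
    have "closure ({xs i<..<xs (i + 1)} \<times> {ys j<..<ys (j + 1)}) = gc (i, j)"
      by (simp add: closure_Times gc_def)
    then have "interior (mesh_domain M) \<inter> ({xs i<..<xs (i + 1)} \<times> {ys j<..<ys (j + 1)}) \<noteq> {}"
      using p Q open_Int_closure_eq_empty[OF open_interior] by blast
    then obtain s t where "(s, t) \<in> mesh_domain M" "xs i < s" "s < xs (i + 1)" "ys j < t" "t < ys (j + 1)"
      using interior_subset by fastforce
    then show "(i, j) \<in> inside" by (rule open_gc_domain)
  qed
next
  interpret T: grid_mesh "transpose_mesh M" ys xs by (rule transposed)
  assume all: "\<forall>Q. p \<in> gc Q \<longrightarrow> Q \<in> inside"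
  obtain x y where p: "p = (x, y)" by fastforce
  obtain u w where u: "u < x" "x < w"
    "\<And>s. u < s \<Longrightarrow> s < w \<Longrightarrow> \<exists>i. x \<in> {xs i..xs (i + 1)} \<and> s \<in> {xs i..xs (i + 1)}"
    using unit_neighbourhood by metis
  obtain u' w' where u': "u' < y" "y < w'"
    "\<And>s. u' < s \<Longrightarrow> s < w' \<Longrightarrow> \<exists>i. y \<in> {ys i..ys (i + 1)} \<and> s \<in> {ys i..ys (i + 1)}"
    using T.unit_neighbourhood by metis
  have "{u<..<w} \<times> {u'<..<w'} \<subseteq> mesh_domain M"
  proof clarify
    fix s t assume "s \<in> {u<..<w}" "t \<in> {u'<..<w'}"
    then obtain i j where "x \<in> {xs i..xs (i + 1)} \<and> s \<in> {xs i..xs (i + 1)}"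
        "y \<in> {ys j..ys (j + 1)} \<and> t \<in> {ys j..ys (j + 1)}"
      using u(3)[of s] u'(3)[of t] by auto
    then have "p \<in> gc (i, j)" "(s, t) \<in> gc (i, j)" by (auto simp: p gc_def)
    then show "(s, t) \<in> mesh_domain M" using all gc_subset_domain by blast
  qed
  then show "p \<in> interior (mesh_domain M)"
    using u(1,2) u'(1,2) by (intro interiorI[of "{u<..<w} \<times> {u'<..<w'}"]) (auto simp: p open_Times)
qed

lemma closed_domain: "closed (mesh_domain M)"
  unfolding domain_eq using finite_inside by (intro closed_Union) (auto simp: gc_def closed_Times)

lemma frontier_domain: "frontier (mesh_domain M) = mesh_domain M - interior (mesh_domain M)"
  using closed_domain by (simp add: frontier_def closure_closed)

lemma interior_horizontal_point:
  assumes "xs i < x" "x < xs (i + 1)"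
  shows "(x, ys j) \<in> interior (mesh_domain M) \<longleftrightarrow> (i, j) \<in> inside \<and> (i, j - 1) \<in> inside"
proof -
  have "(x, ys j) \<in> gc Q \<longleftrightarrow> Q = (i, j) \<or> Q = (i, j - 1)" for Q
    using xs_between_iff[OF assms] by (cases Q) (auto simp: gc_def)
  then show ?thesis unfolding interior_domain_iff by metis
qed

lemma interior_vertex_iff:
  "(xs i, ys j) \<in> interior (mesh_domain M) \<longleftrightarrow>
    (i, j) \<in> inside \<and> (i - 1, j) \<in> inside \<and> (i - 1, j - 1) \<in> inside \<and> (i, j - 1) \<in> inside"
proof -
  have "(xs i, ys j) \<in> gc Q \<longleftrightarrow> Q = (i, j) \<or> Q = (i - 1, j) \<or> Q = (i - 1, j - 1) \<or> Q = (i, j - 1)" for Q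
    by (cases Q) (auto simp: gc_def)
  then show ?thesis unfolding interior_domain_iff by metis
qed

end

lemma grid_mesh_exists:
  assumes "t_mesh M" obtains xs ys where "grid_mesh M xs ys"
proof -
  have rect: "rectangle f" if "f \<in> cells M" for f using assms that by (auto simp: t_mesh_def)
  then have "\<forall>f\<in>cells M. \<exists>q :: real \<times> real \<times> real \<times> real. fst q < fst (snd q) \<and>
      fst (snd (snd q)) < snd (snd (snd q)) \<and>
      f = {fst q..fst (snd q)} \<times> {fst (snd (snd q))..snd (snd (snd q))}"
    unfolding rectangle_def by fastforce
  then obtain q :: "point set \<Rightarrow> real \<times> real \<times> real \<times> real" where q: "\<And>f. f \<in> cells M \<Longrightarrow>
      fst (q f) < fst (snd (q f)) \<and> fst (snd (snd (q f))) < snd (snd (snd (q f))) \<and>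
      f = {fst (q f)..fst (snd (q f))} \<times> {fst (snd (snd (q f)))..snd (snd (snd (q f)))}"
    unfolding bchoice_iff by blast
  define a where "a = (\<lambda>f. fst (q f))"
  define b where "b = (\<lambda>f. fst (snd (q f)))"
  define c where "c = (\<lambda>f. fst (snd (snd (q f))))"
  define e where "e = (\<lambda>f. snd (snd (snd (q f))))"
  have f: "a f < b f \<and> c f < e f \<and> f = {a f..b f} \<times> {c f..e f}" if "f \<in> cells M" for f
    using q[OF that] unfolding a_def b_def c_def e_def .
  have fin: "finite (cells M)" using assms by (simp add: t_mesh_def)
  obtain xs where xs: "grid_line xs" "a ` cells M \<union> b ` cells M \<subseteq> range xs"
    using grid_line_exists[of "a ` cells M \<union> b ` cells M"] fin by auto
  obtain ys where ys: "grid_line ys" "c ` cells M \<union> e ` cells M \<subseteq> range ys"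
    using grid_line_exists[of "c ` cells M \<union> e ` cells M"] fin by auto
  have "grid_mesh M xs ys"
  proof
    fix g assume g: "g \<in> cells M"
    obtain i i' where i: "a g = xs i" "b g = xs i'" using xs(2) g by blast
    obtain j j' where j: "c g = ys j" "e g = ys j'" using ys(2) g by blast
    have "i < i'" "j < j'"
      using f[OF g] i j xs(1) ys(1) by (auto simp: grid_line_def strict_mono_less)
    moreover have "g = {xs i..xs i'} \<times> {ys j..ys j'}" using f[OF g] i j by auto
    ultimately show "\<exists>a b c e. a < b \<and> c < e \<and> g = {xs a..xs b} \<times> {ys c..ys e}" by blast
  qed (use assms xs ys in auto)
  then show ?thesis using that by blast
qed

section \<open>Edges\<close>

lemma horizontal_segment: 
  fixes u w y :: real
  assumes "u \<le> w" shows "{u..w} \<times> {y} = closed_segment (u, y) (w, y)"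
proof -
  have "(t, y') \<in> closed_segment (u, y) (w, y) \<longleftrightarrow> t \<in> closed_segment u w \<and> y' = y" for t y'
    unfolding closed_segment_def by (auto simp: algebra_simps)
  then show ?thesis using assms by (auto simp: closed_segment_eq_real_ivl)
qed

lemma endpoints_horizontal:
  fixes u w y :: real
  assumes "u \<le> w" shows "endpoints ({u..w} \<times> {y}) = {(u, y), (w, y)}"
  unfolding endpoints_def horizontal_segment[OF assms] closed_segment_eq
  by (auto simp: doubleton_eq_iff)

lemma endpoints_vertical:
  fixes u w x :: real
  assumes "u \<le> w" shows "endpoints ({x} \<times> {u..w}) = {(x, u), (x, w)}"
  using endpoints_flip[of "{u..w} \<times> {x}"] unfolding flip_Times endpoints_horizontal[OF assms] by simp

lemma horizontal_not_vertical: "horizontal l \<Longrightarrow> \<not> vertical l"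
proof
  assume "horizontal l" "vertical l"
  then obtain a b y x c e where l: "a < b" "l = {a..b} \<times> {y}" "l = {x} \<times> {c..e}"
    unfolding horizontal_def vertical_def by blast
  then have "(a, y) \<in> {x} \<times> {c..e}" "(b, y) \<in> {x} \<times> {c..e}" by auto
  then show False using l(1) by auto
qed

context grid_mesh
begin

text \<open>The unit segment from \<open>(xs i, ys j)\<close> to \<open>(xs (i + 1), ys j)\<close> lies between the grid cells \<open>(i, j)\<close> and
  \<open>(i, j - 1)\<close>; it is separating if these belong to different mesh cells or only one belongs to a cell.\<close>

definition sep_h :: "int \<Rightarrow> int \<Rightarrow> bool" where
  "sep_h i j \<longleftrightarrow> (\<exists>f\<in>cells M. (gc (i, j) \<subseteq> f) \<noteq> (gc (i, j - 1) \<subseteq> f))"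

definition sep_v :: "int \<Rightarrow> int \<Rightarrow> bool" where
  "sep_v i j \<longleftrightarrow> (\<exists>f\<in>cells M. (gc (i, j) \<subseteq> f) \<noteq> (gc (i - 1, j) \<subseteq> f))"

lemma edge_cases: "l \<in> edges M \<Longrightarrow> horizontal l \<or> vertical l"
proof -
  have "\<forall>l\<in>edges M. horizontal l \<or> vertical l" using mesh unfolding t_mesh_def by simp
  then show "l \<in> edges M \<Longrightarrow> horizontal l \<or> vertical l" by blast
qed

lemma edge_in_frontiers: "l \<in> edges M \<Longrightarrow> p \<in> l \<Longrightarrow> \<exists>f\<in>cells M. p \<in> frontier f"
proof -
  assume "l \<in> edges M" "p \<in> l"
  moreover have "\<forall>l\<in>edges M. l \<subseteq> (\<Union>f\<in>cells M. frontier f)" using mesh unfolding t_mesh_def by simp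
  ultimately show ?thesis by blast
qed

lemma frontier_covered: "f \<in> cells M \<Longrightarrow> p \<in> frontier f \<Longrightarrow> \<exists>l\<in>edges M. p \<in> l \<and> l \<subseteq> frontier f"
proof -
  assume f: "f \<in> cells M" "p \<in> frontier f"
  have "\<forall>f\<in>cells M. \<exists>E\<subseteq>edges M. frontier f = \<Union>E" using mesh unfolding t_mesh_def by (elim conjE)
  from bspec[OF this f(1)] obtain E where E: "E \<subseteq> edges M" "frontier f = \<Union>E" by (elim exE conjE)
  then obtain l where l: "l \<in> E" "p \<in> l" using f(2) by (metis UnionE)
  then have "l \<in> edges M" using E(1) by (rule_tac subsetD)
  moreover have "l \<subseteq> frontier f" unfolding E(2) by (rule Union_upper[OF l(1)])
  ultimately show ?thesis using l(2) by (intro bexI[of _ l] conjI)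
qed

lemma edges_meet_at_endpoints:
  assumes "l \<in> edges M" "l' \<in> edges M" "l \<noteq> l'"
  shows "l \<inter> l' = endpoints l \<inter> endpoints l' \<and> l \<inter> l' \<subseteq> vertices M"
proof -
  have "\<forall>l\<in>edges M. \<forall>l'\<in>edges M. l \<noteq> l' \<longrightarrow>
        l \<inter> l' = endpoints l \<inter> endpoints l' \<and> l \<inter> l' \<subseteq> vertices M"
    using mesh unfolding t_mesh_def by (elim conjE)
  from bspec[OF bspec[OF this assms(1)] assms(2)] assms(3) show ?thesis by (rule mp)
qed

lemma vertex_edges:
  assumes "v \<in> vertices M"
  shows "\<exists>h\<in>edges M. \<exists>w\<in>edges M. horizontal h \<and> vertical w \<and> h \<inter> w = {v}"
proof -
  have "\<forall>v\<in>vertices M. \<exists>h\<in>edges M. \<exists>w\<in>edges M. horizontal h \<and> vertical w \<and> h \<inter> w = {v}"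
    using mesh unfolding t_mesh_def by (elim conjE)
  then show ?thesis using assms by simp
qed

lemma endpoints_vertices: "l \<in> edges M \<Longrightarrow> endpoints l \<subseteq> vertices M"
  unfolding vertices_def by blast

text \<open>An edge has uncountably many points, so one of them avoids all vertical sides of cells and hence lies
  on a horizontal side.\<close>

lemma horizontal_edge_on_line:
  assumes "{u..w} \<times> {y} \<in> edges M" "u < w" shows "y \<in> range ys"
proof -
  have "uncountable {u<..<w}" using assms(2) by (simp add: uncountable_open_interval)
  moreover have "countable (range xs)" by simp
  ultimately have "\<not> {u<..<w} \<subseteq> range xs" using countable_subset by blast
  then obtain t where t: "u < t" "t < w" "t \<notin> range xs"
    by (metis greaterThanLessThan_iff subsetI)
  have "(t, y) \<in> {u..w} \<times> {y}" using t by simp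
  then obtain f where f: "f \<in> cells M" "(t, y) \<in> frontier f" using edge_in_frontiers[OF assms(1)] by blast
  obtain a b c e where abce: "a < b" "c < e" "f = {xs a..xs b} \<times> {ys c..ys e}"
    using cells_on_grid[OF f(1)] by blast
  have "xs a < xs b" "ys c < ys e" using abce by simp_all
  then have "t = xs a \<or> t = xs b \<or> y = ys c \<or> y = ys e"
    using f(2) unfolding abce(3) by (simp add: frontier_rectangle)
  then show ?thesis using t(3) by blast
qed

lemma edge_on_line_transposed:
  assumes "{x} \<times> {u..w} \<in> edges M" "u < w" shows "x \<in> range xs"
proof -
  interpret T: grid_mesh "transpose_mesh M" ys xs by (rule transposed)
  have "{u..w} \<times> {x} \<in> edges (transpose_mesh M)"
    using assms(1) by (metis edges_transpose flip_Times imageI)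
  then show ?thesis using T.horizontal_edge_on_line assms(2) by blast
qed

lemma vertex_on_grid:
  assumes "v \<in> vertices M" obtains i j where "v = (xs i, ys j)"
proof -
  obtain h w where hw: "h \<in> edges M" "w \<in> edges M" "horizontal h" "vertical w" "h \<inter> w = {v}"
    using vertex_edges[OF assms] by blast
  obtain a b y where h: "a < b" "h = {a..b} \<times> {y}" using hw(3) unfolding horizontal_def by blast
  obtain c e x where w: "c < e" "w = {x} \<times> {c..e}" using hw(4) unfolding vertical_def by blast
  have "v \<in> h" "v \<in> w" using hw(5) by blast+
  then have "v = (x, y)" unfolding h w by auto
  moreover have "y \<in> range ys" using horizontal_edge_on_line hw(1) h by blast
  moreover have "x \<in> range xs" using edge_on_line_transposed hw(2) w by blast
  ultimately show ?thesis using that by blast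
qed

lemma horizontal_edge_grid:
  assumes "l \<in> edges M" "horizontal l"
  obtains a b j where "a < b" "l = {xs a..xs b} \<times> {ys j}"
proof -
  obtain u w y where l: "u < w" "l = {u..w} \<times> {y}" using assms(2) unfolding horizontal_def by blast
  have "endpoints l = {(u, y), (w, y)}" unfolding l(2) using l(1) by (intro endpoints_horizontal) simp
  then have "(u, y) \<in> vertices M" "(w, y) \<in> vertices M" using endpoints_vertices[OF assms(1)] by auto
  then obtain a j b k where "(u, y) = (xs a, ys j)" "(w, y) = (xs b, ys k)"
    using vertex_on_grid by metis
  then show ?thesis using that[of a b j] l by simp
qed

lemma unit_h_point:
  assumes "xs i < t" "t < xs (i + 1)" "f \<in> cells M"
  shows "(t, ys j) \<in> frontier f \<longleftrightarrow> (gc (i, j) \<subseteq> f) \<noteq> (gc (i, j - 1) \<subseteq> f)"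
proof -
  obtain a b c e where f: "a < b" "c < e" "f = {xs a..xs b} \<times> {ys c..ys e}"
    using cells_on_grid[OF assms(3)] by blast
  have lt: "xs a < xs b" "ys c < ys e" using f by simp_all
  have "(t, ys j) \<in> frontier f \<longleftrightarrow> a \<le> i \<and> i < b \<and> c \<le> j \<and> j \<le> e \<and> (j = c \<or> j = e)"
    unfolding f(3) frontier_rectangle[OF lt]
    using xs_between_iff[OF assms(1,2), of a] xs_between_iff[OF assms(1,2), of b] by auto
  also have "\<dots> \<longleftrightarrow> (gc (i, j) \<subseteq> f) \<noteq> (gc (i, j - 1) \<subseteq> f)"
    unfolding f(3) gc_subset_iff using f(2) by auto
  finally show ?thesis .
qed

lemma mid_in_unit: obtains t where "xs i < t" "t < xs (i + 1)" using mid_between(1,2) by blast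

text \<open>A separating segment is part of the frontier of a cell, which is a union of edges; the edge through an
  inner point is horizontal and, ending on grid lines, contains the whole unit segment.\<close>

lemma sep_h_edge:
  assumes "sep_h i j"
  obtains a b where "{xs a..xs b} \<times> {ys j} \<in> edges M" "a \<le> i" "i < b"
proof -
  obtain f where f: "f \<in> cells M" "(gc (i, j) \<subseteq> f) \<noteq> (gc (i, j - 1) \<subseteq> f)"
    using assms unfolding sep_h_def by blast
  obtain t where t: "xs i < t" "t < xs (i + 1)" by (rule mid_in_unit)
  have "(t, ys j) \<in> frontier f" using unit_h_point[OF t f(1)] f(2) by blast
  then obtain l where l: "l \<in> edges M" "(t, ys j) \<in> l" "l \<subseteq> frontier f"
    using frontier_covered[OF f(1)] by blast
  have "horizontal l"
  proof (rule ccontr)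
    assume "\<not> horizontal l"
    then obtain x s r where v: "s < r" "l = {x} \<times> {s..r}"
      using edge_cases[OF l(1)] unfolding vertical_def by blast
    have x: "x = t" using l(2) v(2) by simp
    have "x \<in> range xs" using edge_on_line_transposed l(1) v by blast
    then show False using xs_between_iff(3)[OF t] x by blast
  qed
  then obtain a b k where ab: "a < b" "l = {xs a..xs b} \<times> {ys k}"
    using horizontal_edge_grid[OF l(1)] by blast
  have "j = k" "xs a \<le> t" "t \<le> xs b" using l(2) ab(2) by auto
  then show ?thesis using that[of a b] l(1) ab xs_between_iff(1)[OF t, of a] xs_between_iff(2)[OF t, of b] by auto
qed

lemma transposed_gc: "grid_mesh.gc ys xs (j, i) = flip (gc (i, j))"
proof -
  interpret T: grid_mesh "transpose_mesh M" ys xs by (rule transposed)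
  show ?thesis unfolding T.gc_def gc_def flip_Times by simp
qed

lemma transposed_inside: "(j, i) \<in> grid_mesh.inside (transpose_mesh M) ys xs \<longleftrightarrow> (i, j) \<in> inside"
proof -
  interpret T: grid_mesh "transpose_mesh M" ys xs by (rule transposed)
  show ?thesis unfolding T.inside_def inside_def using transposed_gc[of j i] by simp
qed

lemma transposed_sep: "grid_mesh.sep_h (transpose_mesh M) ys xs j i \<longleftrightarrow> sep_v i j"
proof -
  interpret T: grid_mesh "transpose_mesh M" ys xs by (rule transposed)
  show ?thesis unfolding T.sep_h_def sep_v_def
    by (simp add: transposed_gc)
qed

lemma sep_v_edge:
  assumes "sep_v i j"
  obtains a b where "{xs i} \<times> {ys a..ys b} \<in> edges M" "a \<le> j" "j < b"
proof -
  interpret T: grid_mesh "transpose_mesh M" ys xs by (rule transposed)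
  have "T.sep_h j i" using assms transposed_sep by blast
  then obtain a b where ab: "{ys a..ys b} \<times> {xs i} \<in> edges (transpose_mesh M)" "a \<le> j" "j < b"
    by (rule T.sep_h_edge)
  then have "{xs i} \<times> {ys a..ys b} \<in> edges M"
  proof -
    have "flip ({ys a..ys b} \<times> {xs i}) \<in> flip ` edges (transpose_mesh M)" using ab(1) by (rule imageI)
    then show ?thesis unfolding edges_transpose flip_Times by (simp add: image_comp comp_def)
  qed
  then show ?thesis using that ab by blast
qed

text \<open>A corner of a cell is a vertex, and no vertex lies in the relative interior of an edge.
  Hence a cell bordering on part of an edge borders on all of it.\<close>

lemma cell_side_covers_edge:
  assumes l: "{xs a..xs b} \<times> {ys j} \<in> edges M" "a \<le> i" "i < b"
    and f: "f \<in> cells M" "(gc (i, j) \<subseteq> f) \<noteq> (gc (i, j - 1) \<subseteq> f)"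
    and k: "a \<le> k" "k < b"
  shows "gc (k, j) \<subseteq> f \<longleftrightarrow> gc (i, j) \<subseteq> f" "gc (k, j - 1) \<subseteq> f \<longleftrightarrow> gc (i, j - 1) \<subseteq> f"
proof -
  obtain a' b' c e where f': "a' < b'" "c < e" "f = {xs a'..xs b'} \<times> {ys c..ys e}"
    using cells_on_grid[OF f(1)] by blast
  have i: "a' \<le> i" "i < b'" "j = c \<or> j = e"
    using f(2) f'(2) unfolding f'(3) gc_subset_iff by auto
  \<comment> \<open>the row of grid cells of \<open>f\<close> next to the line \<open>ys j\<close>\<close>
  define m where "m = (if j = c then j else j - 1)"
  have m: "c \<le> m" "m < e" "ys m \<le> ys j" "ys j \<le> ys (m + 1)" using i(3) f'(2) by (auto simp: m_def)
  have corner: "x \<le> a \<or> b \<le> x" if "sep_v x m" for x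
  proof (rule ccontr)
    assume x: "\<not> (x \<le> a \<or> b \<le> x)"
    obtain r s where w: "{xs x} \<times> {ys r..ys s} \<in> edges M" "r \<le> m" "m < s"
      using sep_v_edge[OF \<open>sep_v x m\<close>] by metis
    have le: "ys r \<le> ys m" "ys (m + 1) \<le> ys s" using w by simp_all
    have rs: "ys r < ys s" using w by simp
    have ne: "{xs a..xs b} \<times> {ys j} \<noteq> {xs x} \<times> {ys r..ys s}"
    proof
      assume "{xs a..xs b} \<times> {ys j} = {xs x} \<times> {ys r..ys s}"
      then have "horizontal ({xs x} \<times> {ys r..ys s})" unfolding horizontal_def
        using l by (metis le_less_trans xs_less)
      moreover have "vertical ({xs x} \<times> {ys r..ys s})" unfolding vertical_def using rs by blast
      ultimately show False using horizontal_not_vertical by blast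
    qed
    have "(xs x, ys j) \<in> {xs a..xs b} \<times> {ys j} \<inter> {xs x} \<times> {ys r..ys s}"
      using x le m by auto
    then have "(xs x, ys j) \<in> endpoints ({xs a..xs b} \<times> {ys j})"
      using edges_meet_at_endpoints[OF l(1) w(1) ne] by blast
    then have "x = a \<or> x = b" using l by (simp add: endpoints_horizontal)
    then show False using x by auto
  qed
  have "sep_v x m" if "x = a' \<or> x = b'" for x
  proof -
    have "(gc (x, m) \<subseteq> f) \<noteq> (gc (x - 1, m) \<subseteq> f)"
      unfolding f'(3) gc_subset_iff using f'(1) m(1,2) that by auto
    then show ?thesis unfolding sep_v_def using f(1) by blast
  qed
  then have "sep_v a' m" "sep_v b' m" by blast+
  then have "a' \<le> a" "b \<le> b'" using corner[of a'] corner[of b'] i l by auto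
  then show "gc (k, j) \<subseteq> f \<longleftrightarrow> gc (i, j) \<subseteq> f" "gc (k, j - 1) \<subseteq> f \<longleftrightarrow> gc (i, j - 1) \<subseteq> f"
    using i k unfolding f'(3) gc_subset_iff by auto
qed

lemma edge_units_sep:
  assumes "{xs a..xs b} \<times> {ys j} \<in> edges M" "a \<le> i" "i < b"
  shows "sep_h i j"
proof -
  obtain t where t: "xs i < t" "t < xs (i + 1)" by (rule mid_in_unit)
  have "xs a \<le> xs i" "xs (i + 1) \<le> xs b" using assms by simp_all
  then have "xs a \<le> t" "t \<le> xs b" using t by linarith+
  then have "(t, ys j) \<in> {xs a..xs b} \<times> {ys j}" by simp
  then obtain f where "f \<in> cells M" "(t, ys j) \<in> frontier f" using edge_in_frontiers[OF assms(1)] by blast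
  then show ?thesis using unit_h_point[OF t] unfolding sep_h_def by blast
qed

text \<open>An edge is interior or in the boundary along its whole length, because each of the cells next to it
  borders on all of it.\<close>

lemma inside_along_edge:
  assumes l: "{xs a..xs b} \<times> {ys j} \<in> edges M" "a \<le> i" "i < b" and k: "a \<le> k" "k < b"
    and both: "(i, j) \<in> inside" "(i, j - 1) \<in> inside"
  shows "(k, j) \<in> inside \<and> (k, j - 1) \<in> inside"
proof -
  obtain f where f: "f \<in> cells M" "(gc (i, j) \<subseteq> f) \<noteq> (gc (i, j - 1) \<subseteq> f)"
    using edge_units_sep[OF l] unfolding sep_h_def by blast
  obtain g where g: "g \<in> cells M" "gc (i, j) \<subseteq> g" using both(1) unfolding inside_def by blast
  obtain h where h: "h \<in> cells M" "gc (i, j - 1) \<subseteq> h" using both(2) unfolding inside_def by blast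
  have "\<not> gc (i, j - 1) \<subseteq> g" "\<not> gc (i, j) \<subseteq> h"
    using f cell_unique[OF f(1) g(1)] cell_unique[OF f(1) h(1)] cell_unique[OF g(1) h(1)] g(2) h(2) by metis+
  then have "gc (k, j) \<subseteq> g" "gc (k, j - 1) \<subseteq> h"
    using cell_side_covers_edge[OF l g(1) _ k] cell_side_covers_edge[OF l h(1) _ k] g(2) h(2) by blast+
  then show ?thesis using g(1) h(1) insideI by blast
qed

text \<open>The unit segments of interior edges. Only there can the polynomial pieces of a spline differ.\<close>

definition act_h :: "int \<Rightarrow> int \<Rightarrow> bool" where
  "act_h i j \<longleftrightarrow> (i, j) \<in> inside \<and> (i, j - 1) \<in> inside \<and> own (i, j) \<noteq> own (i, j - 1)"

definition act_v :: "int \<Rightarrow> int \<Rightarrow> bool" where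
  "act_v i j \<longleftrightarrow> (i, j) \<in> inside \<and> (i - 1, j) \<in> inside \<and> own (i, j) \<noteq> own (i - 1, j)"

lemma own_eq_iff:
  assumes "Q \<in> inside" "Q' \<in> inside"
  shows "own Q \<noteq> own Q' \<longleftrightarrow> (\<exists>f\<in>cells M. (gc Q \<subseteq> f) \<noteq> (gc Q' \<subseteq> f))"
  using own_cell[OF assms(1)] own_cell[OF assms(2)] own_eqI by metis

lemma act_h_iff: "act_h i j \<longleftrightarrow> (i, j) \<in> inside \<and> (i, j - 1) \<in> inside \<and> sep_h i j"
  unfolding act_h_def sep_h_def using own_eq_iff[of "(i, j)" "(i, j - 1)"] by blast

lemma act_v_iff: "act_v i j \<longleftrightarrow> (i, j) \<in> inside \<and> (i - 1, j) \<in> inside \<and> sep_v i j"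
  unfolding act_v_def sep_v_def using own_eq_iff[of "(i, j)" "(i - 1, j)"] by blast

lemma transposed_act: "grid_mesh.act_h (transpose_mesh M) ys xs j i \<longleftrightarrow> act_v i j"
    "grid_mesh.act_v (transpose_mesh M) ys xs j i \<longleftrightarrow> act_h i j"
proof -
  interpret T: grid_mesh "transpose_mesh M" ys xs by (rule transposed)
  show "T.act_h j i \<longleftrightarrow> act_v i j" unfolding T.act_h_iff act_v_iff transposed_inside transposed_sep ..
  have "T.sep_v j i \<longleftrightarrow> sep_h i j" unfolding T.sep_v_def sep_h_def by (simp add: transposed_gc)
  then show "T.act_v j i \<longleftrightarrow> act_h i j" unfolding T.act_v_iff act_h_iff transposed_inside by blast
qed

lemma interior_edge_iff:
  assumes "{xs a..xs b} \<times> {ys j} \<in> edges M" "a \<le> i" "i < b"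
  shows "{xs a..xs b} \<times> {ys j} \<in> interior_edges M \<longleftrightarrow> act_h i j"
proof
  have ab: "a < b" using assms by simp
  let ?l = "{xs a..xs b} \<times> {ys j}"
  assume "?l \<in> interior_edges M"
  then obtain p where p: "p \<in> ?l" "p \<notin> frontier (mesh_domain M)" unfolding interior_edges_def by blast
  then obtain t where t: "p = (t, ys j)" "xs a \<le> t" "t \<le> xs b" by auto
  obtain f where f: "f \<in> cells M" "p \<in> frontier f" using edge_in_frontiers[OF assms(1) p(1)] by blast
  obtain a' b' c' e' where f': "f = {xs a'..xs b'} \<times> {ys c'..ys e'}" using cells_on_grid[OF f(1)] by blast
  have "closed f" unfolding f' by (intro closed_Times) auto
  then have "p \<in> mesh_domain M" unfolding mesh_domain_def using f frontier_subset_closed by blast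
  then have int: "p \<in> interior (mesh_domain M)" using p(2) frontier_domain by blast
  obtain k where k: "a \<le> k" "k < b" "xs k \<le> t" "t \<le> xs (k + 1)"
    using in_interval_unit[OF ab t(2,3)] .
  have "p \<in> gc (k, j)" "p \<in> gc (k, j - 1)" using k t by (auto simp: gc_def)
  then have "(k, j) \<in> inside" "(k, j - 1) \<in> inside" using int unfolding interior_domain_iff by blast+
  then show "act_h i j" unfolding act_h_iff
    using inside_along_edge[OF assms(1) k(1,2) assms(2,3)] edge_units_sep[OF assms] by blast
next
  assume act: "act_h i j"
  obtain t where t: "xs i < t" "t < xs (i + 1)" by (rule mid_in_unit)
  have "xs a \<le> xs i" "xs (i + 1) \<le> xs b" using assms by simp_all
  then have "xs a \<le> t" "t \<le> xs b" using t by linarith+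
  then have "(t, ys j) \<in> {xs a..xs b} \<times> {ys j}" by simp
  moreover have "(t, ys j) \<in> interior (mesh_domain M)"
    using act unfolding interior_horizontal_point[OF t] act_h_iff by blast
  ultimately show "{xs a..xs b} \<times> {ys j} \<in> interior_edges M"
    using assms(1) frontier_domain unfolding interior_edges_def by blast
qed

lemma act_h_edge:
  assumes "act_h i j"
  obtains a b where "{xs a..xs b} \<times> {ys j} \<in> interior_edges M" "a \<le> i" "i < b"
proof -
  have "sep_h i j" using assms unfolding act_h_iff by blast
  then obtain a b where "{xs a..xs b} \<times> {ys j} \<in> edges M" "a \<le> i" "i < b"
    by (rule sep_h_edge)
  then show ?thesis using that interior_edge_iff assms by blast
qed

end

section \<open>Maximal segments\<close>

lemma collinear_on_horizontal_line:
  fixes S :: "point set"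
  assumes "\<And>p. p \<in> S \<Longrightarrow> snd p = y" shows "collinear S"
  unfolding collinear_def
proof (intro exI ballI)
  fix p q assume "p \<in> S" "q \<in> S"
  then show "p - q = (fst p - fst q) *\<^sub>R (1, 0)" using assms by (simp add: prod_eq_iff)
qed

lemma collinear_horizontal:
  fixes S :: "point set"
  assumes "collinear S" "(a, y) \<in> S" "(b, y) \<in> S" "a \<noteq> b" "p \<in> S"
  shows "snd p = y"
proof -
  obtain u where u: "\<And>x y. x \<in> S \<Longrightarrow> y \<in> S \<Longrightarrow> \<exists>c. x - y = c *\<^sub>R u"
    using assms(1) unfolding collinear_def by metis
  obtain c where c: "(b, y) - (a, y) = c *\<^sub>R u" using u[OF assms(3,2)] by metis
  have "fst ((b, y) - (a, y)) = c * fst u" "snd ((b, y) - (a, y)) = c * snd u" unfolding c by simp_all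
  then have "c \<noteq> 0" "c * snd u = 0" using assms(4) by auto
  then have "snd u = 0" by simp
  obtain e where e: "p - (a, y) = e *\<^sub>R u" using u[OF assms(5,2)] by metis
  have "snd (p - (a, y)) = e * snd u" unfolding e by simp
  then show ?thesis using \<open>snd u = 0\<close> by simp
qed

lemma horizontal_Union:
  assumes "finite F" "\<And>m. m \<in> F \<Longrightarrow> horizontal m \<or> vertical m" "m0 \<in> F" "horizontal m0"
    and "connected (\<Union>F)" "collinear (\<Union>F)"
  shows "horizontal (\<Union>F)"
proof -
  obtain a b y where m0: "a < b" "m0 = {a..b} \<times> {y}"
    using assms(4) unfolding horizontal_def by (elim exE conjE)
  have "(a, y) \<in> m0" "(b, y) \<in> m0" unfolding m0(2) using m0(1) by simp_all
  then have ab: "(a, y) \<in> \<Union>F" "(b, y) \<in> \<Union>F" using UnionI[OF assms(3)] by simp_all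
  have line: "snd p = y" if "p \<in> \<Union>F" for p
    using collinear_horizontal[OF assms(6) ab _ that] m0(1) by simp
  have "compact m" if "m \<in> F" for m
    using assms(2)[OF that] unfolding horizontal_def vertical_def by (auto intro!: compact_Times)
  then have "compact (\<Union>F)" using assms(1) by (intro compact_Union) auto
  then have "compact (fst ` \<Union>F)" by (intro compact_continuous_image continuous_intros)
  moreover have "connected (fst ` \<Union>F)" by (intro connected_continuous_image continuous_intros assms(5))
  ultimately obtain u w where uw: "fst ` \<Union>F = {u..w}" using connected_compact_interval_1 by metis
  have "\<Union>F = {u..w} \<times> {y}"
  proof (rule set_eqI)
    fix p
    show "p \<in> \<Union>F \<longleftrightarrow> p \<in> {u..w} \<times> {y}"
    proof
      assume p: "p \<in> \<Union>F"
      then have "fst p \<in> {u..w}" unfolding uw[symmetric] by (rule imageI)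
      then show "p \<in> {u..w} \<times> {y}" using line[OF p] by (simp add: mem_Times_iff)
    next
      assume p: "p \<in> {u..w} \<times> {y}"
      then have "fst p \<in> fst ` \<Union>F" unfolding uw by (simp add: mem_Times_iff)
      then obtain q where q: "q \<in> \<Union>F" "fst p = fst q" by (rule imageE)
      then have "p = q" using line[OF q(1)] p by (simp add: mem_Times_iff prod_eq_iff)
      then show "p \<in> \<Union>F" using q(1) by simp
    qed
  qed
  moreover have "u < w"
  proof -
    have "a \<in> {u..w}" "b \<in> {u..w}" unfolding uw[symmetric] using ab by force+
    then show ?thesis using m0(1) by simp
  qed
  ultimately show ?thesis unfolding horizontal_def by metis
qed

lemma segment_horizontal_or_vertical:
  assumes "finite E" "\<And>m. m \<in> E \<Longrightarrow> horizontal m \<or> vertical m" "s \<in> segments E"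
  shows "horizontal s \<or> vertical s"
proof -
  obtain F where F: "F \<subseteq> E" "F \<noteq> {}" "s = \<Union>F" "connected s" "collinear s"
    using assms(3) unfolding segments_def by auto
  obtain m where m: "m \<in> F" using F(2) by auto
  have fin: "finite F" using F(1) assms(1) by (rule finite_subset)
  have FE: "horizontal m \<or> vertical m" if "m \<in> F" for m using assms(2) F(1) that by (meson subsetD)
  show ?thesis
  proof (cases "horizontal m")
    case True
    then show ?thesis using horizontal_Union[OF fin FE m True] F by simp
  next
    case False
    have "horizontal (\<Union>(flip ` F))"
    proof (rule horizontal_Union)
      show "flip m \<in> flip ` F" using m by (rule imageI)
      show "horizontal (flip m)" using False FE[OF m] by simp
      show "finite (flip ` F)" using fin by simp
      show "connected (\<Union>(flip ` F))" "collinear (\<Union>(flip ` F))"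
        unfolding flip_Union[symmetric] using F by simp_all
    next
      fix m assume "m \<in> flip ` F"
      then obtain k where "k \<in> F" "m = flip k" by (rule imageE)
      then show "horizontal m \<or> vertical m" using FE[of k] by auto
    qed
    then have "vertical s" unfolding flip_Union[symmetric] F(3) by simp
    then show ?thesis ..
  qed
qed

lemma segment_in_maximal:
  assumes "finite E" "s \<in> segments E"
  obtains s' where "s' \<in> maximal_segments E" "s \<subseteq> s'"
proof -
  have "segments E \<subseteq> Union ` Pow E" unfolding segments_def by auto
  then have "finite (segments E)" using assms(1) by (meson finite_Pow_iff finite_imageI finite_subset)
  then obtain m where m: "m \<in> segments E" "s \<subseteq> m" "\<forall>b\<in>segments E. m \<subseteq> b \<longrightarrow> m = b"
    using finite_has_maximal2[of "segments E" s] assms(2) by metis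
  then have "m \<in> maximal_segments E" unfolding maximal_segments_def by auto
  then show ?thesis using that m(2) by metis
qed

lemma edge_segment:
  assumes "m \<in> E" "horizontal m \<or> vertical m" shows "m \<in> segments E"
proof -
  have h: "connected l \<and> collinear l" if "horizontal l" for l
  proof -
    obtain a b y where l: "l = {a..b} \<times> {y}" using \<open>horizontal l\<close> unfolding horizontal_def by (elim exE conjE)
    then show ?thesis using collinear_on_horizontal_line[of l y] by (auto intro!: connected_Times)
  qed
  have "connected m \<and> collinear m"
  proof (cases "horizontal m")
    case False
    then have "horizontal (flip m)" using assms(2) by simp
    from h[OF this] show ?thesis by simp
  qed (rule h)
  then show ?thesis unfolding segments_def using assms(1) by (auto intro!: exI[of _ "{m}"])
qed

context grid_mesh
begin

definition run_h :: "int \<Rightarrow> int \<Rightarrow> int \<Rightarrow> bool" where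
  "run_h a b j \<longleftrightarrow> a < b \<and> (\<forall>i. a \<le> i \<and> i < b \<longrightarrow> act_h i j) \<and> \<not> act_h (a - 1) j \<and> \<not> act_h b j"

definition seg_h :: "int \<Rightarrow> int \<Rightarrow> int \<Rightarrow> point set" where
  "seg_h a b j = {xs a..xs b} \<times> {ys j}"

definition run_v :: "int \<Rightarrow> int \<Rightarrow> int \<Rightarrow> bool" where
  "run_v a b i \<longleftrightarrow> a < b \<and> (\<forall>j. a \<le> j \<and> j < b \<longrightarrow> act_v i j) \<and> \<not> act_v i (a - 1) \<and> \<not> act_v i b"

definition seg_v :: "int \<Rightarrow> int \<Rightarrow> int \<Rightarrow> point set" where
  "seg_v a b i = {xs i} \<times> {ys a..ys b}"

lemma run_h_unique:
  assumes "run_h a b j" "run_h a' b' j" "a \<le> i" "i < b" "a' \<le> i" "i < b'"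
  shows "a = a'" "b = b'"
proof -
  have act: "a \<le> i \<Longrightarrow> i < b \<Longrightarrow> act_h i j" "a' \<le> i \<Longrightarrow> i < b' \<Longrightarrow> act_h i j" for i
    using assms(1,2) unfolding run_h_def by auto
  have n: "\<not> act_h (a - 1) j" "\<not> act_h (a' - 1) j" "\<not> act_h b j" "\<not> act_h b' j"
    using assms(1,2) unfolding run_h_def by auto
  have "\<not> a < a'" "\<not> a' < a" "\<not> b < b'" "\<not> b' < b"
    using act(1)[of "a' - 1"] act(2)[of "a - 1"] act(1)[of b'] act(2)[of b] n assms(3-6) by linarith+
  then show "a = a'" "b = b'" by linarith+
qed

lemma in_seg_h [simp]: "(x, y) \<in> seg_h a b j \<longleftrightarrow> xs a \<le> x \<and> x \<le> xs b \<and> y = ys j"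
  unfolding seg_h_def by auto

lemma in_seg_v [simp]: "(x, y) \<in> seg_v a b i \<longleftrightarrow> x = xs i \<and> ys a \<le> y \<and> y \<le> ys b"
  unfolding seg_v_def by auto

lemma transposed_run: "grid_mesh.run_h (transpose_mesh M) ys xs a b i \<longleftrightarrow> run_v a b i"
proof -
  interpret T: grid_mesh "transpose_mesh M" ys xs by (rule transposed)
  show ?thesis unfolding T.run_h_def run_v_def transposed_act ..
qed

lemma transposed_seg: "grid_mesh.seg_h ys xs a b i = flip (seg_v a b i)"
proof -
  interpret T: grid_mesh "transpose_mesh M" ys xs by (rule transposed)
  show ?thesis unfolding T.seg_h_def seg_v_def flip_Times ..
qed

lemma interior_edges_finite: "finite (interior_edges M)" "finite (boundary_edges M)"
  using finite_edges unfolding interior_edges_def boundary_edges_def by auto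

lemma interior_edge_cases:
  "m \<in> interior_edges M \<Longrightarrow> horizontal m \<or> vertical m"
  "m \<in> boundary_edges M \<Longrightarrow> horizontal m \<or> vertical m"
  using edge_cases unfolding interior_edges_def boundary_edges_def by auto

lemma interior_l_edge_cases: "l \<in> interior_l_edges M \<Longrightarrow> horizontal l \<or> vertical l"
  using segment_horizontal_or_vertical[OF interior_edges_finite(1) interior_edge_cases(1)]
  unfolding interior_l_edges_def maximal_segments_def by simp

lemma boundary_l_edge_cases: "l \<in> boundary_l_edges M \<Longrightarrow> horizontal l \<or> vertical l"
  using segment_horizontal_or_vertical[OF interior_edges_finite(2) interior_edge_cases(2)]
  unfolding boundary_l_edges_def maximal_segments_def by simp

lemma horizontal_in_horizontal:
  assumes "m \<subseteq> {u..w} \<times> {y :: real}" "horizontal m \<or> vertical m" shows "horizontal m"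
proof (rule ccontr)
  assume "\<not> horizontal m"
  then obtain x a b where m: "a < b" "m = {x} \<times> {a..b}" using assms(2) unfolding vertical_def by auto
  then have "(x, a) \<in> m" "(x, b) \<in> m" by auto
  then have "a = y" "b = y" using assms(1) by auto
  then show False using m(1) by simp
qed

text \<open>Beyond an end of an interior l-edge there is no active unit segment, for the mesh edge containing it
  would extend the l-edge. So interior l-edges are the maximal runs of active segments.\<close>

lemma horizontal_l_edge_run:
  assumes l: "l \<in> interior_l_edges M" "horizontal l"
  obtains a b j where "run_h a b j" "l = seg_h a b j"
proof -
  have max: "l \<in> segments (interior_edges M)" "\<And>s'. s' \<in> segments (interior_edges M) \<Longrightarrow> l \<subseteq> s' \<Longrightarrow> s' = l"
    using l(1) unfolding interior_l_edges_def maximal_segments_def by auto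
  obtain F where F: "F \<subseteq> interior_edges M" "F \<noteq> {}" "l = \<Union>F" "connected l" "collinear l"
    using max(1) unfolding segments_def by auto
  obtain u w y where uw: "u < w" "l = {u..w} \<times> {y}" using l(2) unfolding horizontal_def by metis
  have m: "\<exists>a b j. a < b \<and> m = seg_h a b j \<and> ys j = y \<and> u \<le> xs a \<and> xs b \<le> w \<and> m \<in> interior_edges M"
    if "m \<in> F" for m
  proof -
    have ml: "m \<subseteq> {u..w} \<times> {y}" using that F(3) uw(2) by auto
    have mi: "m \<in> interior_edges M" using that F(1) by (rule_tac subsetD)
    then have me: "m \<in> edges M" unfolding interior_edges_def by simp
    obtain a b j where ab: "a < b" "m = {xs a..xs b} \<times> {ys j}"
      using horizontal_edge_grid[OF me horizontal_in_horizontal[OF ml interior_edge_cases(1)[OF mi]]] by metis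
    have "xs a \<le> xs b" using ab(1) by simp
    then have p: "(xs a, ys j) \<in> m" "(xs b, ys j) \<in> m" unfolding ab(2) by simp_all
    have "ys j = y" "u \<le> xs a" "xs b \<le> w" using subsetD[OF ml p(1)] subsetD[OF ml p(2)] by simp_all
    then show ?thesis using ab mi unfolding seg_h_def by metis
  qed
  have inl: "\<exists>m\<in>F. p \<in> m" if "p \<in> l" for p using that F(3) by simp
  have ul: "(u, y) \<in> l" and wl: "(w, y) \<in> l" using uw by auto
  obtain m1 where m1: "m1 \<in> F" "(u, y) \<in> m1" using inl[OF ul] by metis
  obtain a b1 j where a: "m1 = seg_h a b1 j" "ys j = y" "u \<le> xs a" using m[OF m1(1)] by metis
  have ua: "u = xs a" using m1(2) a by simp
  obtain m2 where m2: "m2 \<in> F" "(w, y) \<in> m2" using inl[OF wl] by metis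
  obtain a2 b j2 where b: "m2 = seg_h a2 b j2" "ys j2 = y" "xs b \<le> w" using m[OF m2(1)] by metis
  have wb: "w = xs b" using m2(2) b by simp
  have lseg: "l = seg_h a b j" using uw(2) ua wb a(2) unfolding seg_h_def by simp
  have ab: "a < b" using uw(1) ua wb by simp
  have act: "act_h i j" if i: "a \<le> i" "i < b" for i
  proof -
    obtain t where t: "xs i < t" "t < xs (i + 1)" by (rule mid_in_unit)
    have "xs a \<le> t" "t \<le> xs b" using xs_between_iff(1,2)[OF t] i by simp_all
    then have "(t, y) \<in> l" using lseg a(2) by simp
    then obtain m3 where m3: "m3 \<in> F" "(t, y) \<in> m3" using inl by metis
    obtain a3 b3 j3 where c: "m3 = seg_h a3 b3 j3" "ys j3 = y" "m3 \<in> interior_edges M" using m[OF m3(1)] by metis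
    have j3: "j3 = j" using c(2) a(2) ys_eq by metis
    have "a3 \<le> i" "i < b3" using m3(2) c(1) xs_between_iff(1,2)[OF t] by simp_all
    moreover have "{xs a3..xs b3} \<times> {ys j} \<in> interior_edges M" using c j3 unfolding seg_h_def by simp
    moreover from this have "{xs a3..xs b3} \<times> {ys j} \<in> edges M" unfolding interior_edges_def by simp
    ultimately show ?thesis using interior_edge_iff by simp
  qed
  have ext: "l' \<subseteq> l" if l': "l' = {xs c..xs e} \<times> {ys j}" "l' \<in> interior_edges M" "p \<in> l" "p \<in> l'" for l' c e p
  proof -
    have cl': "connected l'" unfolding l'(1) by (intro connected_Times) auto
    have "connected (l \<union> l')" using F(4) cl' that(3,4) by (intro connected_Un) auto
    moreover have "collinear (l \<union> l')"
      by (rule collinear_on_horizontal_line[of _ "ys j"]) (use uw(2) a(2) l'(1) in auto)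
    moreover have "l \<union> l' = \<Union>(insert l' F)" using F(3) by auto
    moreover have "insert l' F \<subseteq> interior_edges M" "insert l' F \<noteq> {}" using F(1) l'(2) by auto
    ultimately have "l \<union> l' \<in> segments (interior_edges M)" unfolding segments_def by (simp, metis)
    then have "l \<union> l' = l" using max(2) by simp
    then show ?thesis by auto
  qed
  have "\<not> act_h (a - 1) j"
  proof
    assume "act_h (a - 1) j"
    then obtain c e where ce: "{xs c..xs e} \<times> {ys j} \<in> interior_edges M" "c \<le> a - 1" "a - 1 < e"
      by (rule act_h_edge)
    have "(xs a, ys j) \<in> l" "(xs a, ys j) \<in> {xs c..xs e} \<times> {ys j}" using lseg ab ce by auto
    then have "{xs c..xs e} \<times> {ys j} \<subseteq> l" using ext[OF refl ce(1)] by simp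
    moreover have "(xs (a - 1), ys j) \<in> {xs c..xs e} \<times> {ys j}" using ce by simp
    ultimately have "(xs (a - 1), ys j) \<in> l" by (rule subsetD)
    then show False using lseg by simp
  qed
  moreover have "\<not> act_h b j"
  proof
    assume "act_h b j"
    then obtain c e where ce: "{xs c..xs e} \<times> {ys j} \<in> interior_edges M" "c \<le> b" "b < e"
      by (rule act_h_edge)
    have "(xs b, ys j) \<in> l" "(xs b, ys j) \<in> {xs c..xs e} \<times> {ys j}" using lseg ab ce by auto
    then have "{xs c..xs e} \<times> {ys j} \<subseteq> l" using ext[OF refl ce(1)] by simp
    moreover have "(xs (b + 1), ys j) \<in> {xs c..xs e} \<times> {ys j}" using ce by simp
    ultimately have "(xs (b + 1), ys j) \<in> l" by (rule subsetD)
    then show False using lseg by simp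
  qed
  ultimately have "run_h a b j" using ab act unfolding run_h_def by simp
  then show ?thesis using that lseg by metis
qed

lemma seg_h_horizontal: "a < b \<Longrightarrow> horizontal (seg_h a b j)"
  unfolding seg_h_def horizontal_def using xs_less by metis

lemma act_h_in_run:
  assumes act: "act_h i j"
  obtains a b where "run_h a b j" "a \<le> i" "i < b" "seg_h a b j \<in> interior_l_edges M"
proof -
  obtain c e where ce: "{xs c..xs e} \<times> {ys j} \<in> interior_edges M" "c \<le> i" "i < e"
    using act_h_edge[OF act] by metis
  have "{xs c..xs e} \<times> {ys j} \<in> segments (interior_edges M)"
    using ce(1) interior_edge_cases(1)[OF ce(1)] by (rule edge_segment)
  then obtain l where l: "l \<in> interior_l_edges M" "{xs c..xs e} \<times> {ys j} \<subseteq> l"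
    unfolding interior_l_edges_def by (rule segment_in_maximal[OF interior_edges_finite(1)])
  have p: "(xs i, ys j) \<in> l" "(xs (i + 1), ys j) \<in> l" using l(2) ce by auto
  have "horizontal l"
  proof (rule ccontr)
    assume "\<not> horizontal l"
    then obtain x r s where "l = {x} \<times> {r..s}" using interior_l_edge_cases[OF l(1)] unfolding vertical_def by metis
    then have "xs i = x" "xs (i + 1) = x" using p by auto
    then have "xs i = xs (i + 1)" by simp
    then show False by simp
  qed
  then obtain a b j' where r: "run_h a b j'" "l = seg_h a b j'" using horizontal_l_edge_run[OF l(1)] by metis
  have "j' = j" "a \<le> i" "i < b" using p r(2) by auto
  then show ?thesis using that r l(1) by metis
qed

lemma run_l_edge:
  assumes "run_h a b j" shows "seg_h a b j \<in> interior_l_edges M"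
proof -
  have ab: "a < b" and act: "act_h a j" using assms unfolding run_h_def by auto
  obtain a' b' where r: "run_h a' b' j" "a' \<le> a" "a < b'" "seg_h a' b' j \<in> interior_l_edges M"
    using act_h_in_run[OF act] by metis
  then show ?thesis using run_h_unique[OF assms r(1), of a] ab by simp
qed

lemma flip_interior_l_edges: "flip l \<in> interior_l_edges (transpose_mesh M) \<longleftrightarrow> l \<in> interior_l_edges M"
  using inj_flip[of UNIV] by (simp add: inj_image_mem_iff)

lemma vertical_l_edge_run:
  assumes l: "l \<in> interior_l_edges M" "vertical l"
  obtains a b i where "run_v a b i" "l = seg_v a b i"
proof -
  interpret T: grid_mesh "transpose_mesh M" ys xs by (rule transposed)
  have "flip l \<in> interior_l_edges (transpose_mesh M)" "horizontal (flip l)"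
    using l flip_interior_l_edges by simp_all
  then obtain a b i where "T.run_h a b i" "flip l = T.seg_h a b i" by (rule T.horizontal_l_edge_run)
  then show ?thesis using that unfolding transposed_run transposed_seg flip_eq_iff by simp
qed

lemma run_v_l_edge:
  assumes "run_v a b i" shows "seg_v a b i \<in> interior_l_edges M"
proof -
  interpret T: grid_mesh "transpose_mesh M" ys xs by (rule transposed)
  have "T.seg_h a b i \<in> interior_l_edges (transpose_mesh M)"
    using T.run_l_edge[of a b i] assms unfolding transposed_run by simp
  then show ?thesis unfolding transposed_seg flip_interior_l_edges .
qed

text \<open>The mesh edge covering the first unit segment of a run cannot start earlier, as all its unit
  segments are active.\<close>

lemma run_h_endpoints:
  assumes "run_h a b j" shows "(xs a, ys j) \<in> vertices M" "(xs b, ys j) \<in> vertices M"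
proof -
  have ab: "a < b" and act: "act_h a j" "act_h (b - 1) j" and n: "\<not> act_h (a - 1) j" "\<not> act_h b j"
    using assms unfolding run_h_def by auto
  have sub: "act_h i j" if "{xs c..xs e} \<times> {ys j} \<in> interior_edges M" "c \<le> i" "i < e" for c e i
  proof -
    have "{xs c..xs e} \<times> {ys j} \<in> edges M" using that(1) unfolding interior_edges_def by simp
    then show ?thesis using interior_edge_iff that by simp
  qed
  have ends: "(xs c, ys j) \<in> vertices M \<and> (xs e, ys j) \<in> vertices M"
    if "{xs c..xs e} \<times> {ys j} \<in> interior_edges M" "c < e" for c e
  proof -
    have "{xs c..xs e} \<times> {ys j} \<in> edges M" using that(1) unfolding interior_edges_def by simp
    from endpoints_vertices[OF this] show ?thesis using that(2) by (simp add: endpoints_horizontal)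
  qed
  obtain c e where ce: "{xs c..xs e} \<times> {ys j} \<in> interior_edges M" "c \<le> a" "a < e"
    using act_h_edge[OF act(1)] by metis
  have "c = a" using sub[OF ce(1), of "a - 1"] n(1) ce(2,3) by fastforce
  then show "(xs a, ys j) \<in> vertices M" using ends[OF ce(1)] ce by simp
  obtain c e where ce: "{xs c..xs e} \<times> {ys j} \<in> interior_edges M" "c \<le> b - 1" "b - 1 < e"
    using act_h_edge[OF act(2)] by metis
  have "e = b" using sub[OF ce(1), of b] n(2) ce(2,3) by fastforce
  then show "(xs b, ys j) \<in> vertices M" using ends[OF ce(1)] ce by simp
qed

lemma interior_vertices_iff:
  "(xs i, ys j) \<in> interior_vertices M \<longleftrightarrow> (xs i, ys j) \<in> interior (mesh_domain M) \<and>
    (act_h (i - 1) j \<or> act_h i j) \<and> (act_v i (j - 1) \<or> act_v i j)"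
proof -
  interpret T: grid_mesh "transpose_mesh M" ys xs by (rule transposed)
  let ?p = "(xs i, ys j)"
  show ?thesis
  proof (intro iffI conjI)
    assume "?p \<in> interior_vertices M"
    then have p: "?p \<in> vertices M" and int: "?p \<in> interior (mesh_domain M)" unfolding interior_vertices_def by auto
    show "?p \<in> interior (mesh_domain M)" by (rule int)
    obtain h w where hw: "h \<in> edges M" "w \<in> edges M" "horizontal h" "vertical w" "h \<inter> w = {?p}"
      using vertex_edges[OF p] by metis
    have ph: "?p \<in> h" "?p \<in> w" using hw(5) by auto
    have nfr: "?p \<notin> frontier (mesh_domain M)" using int unfolding frontier_def by simp
    have hi: "h \<in> interior_edges M" and "w \<in> interior_edges M"
      using hw(1,2) ph nfr unfolding interior_edges_def by auto
    then have wi: "flip w \<in> interior_edges (transpose_mesh M)" by simp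
    obtain a b k where h: "a < b" "h = {xs a..xs b} \<times> {ys k}" using horizontal_edge_grid[OF hw(1,3)] by metis
    have "k = j" "a \<le> i" "i \<le> b" using ph(1) h(2) by auto
    then have "act_h (if i < b then i else i - 1) j"
      using interior_edge_iff[of a b j "if i < b then i else i - 1"] hw(1) hi h by auto
    then show "act_h (i - 1) j \<or> act_h i j" by (auto split: if_splits)
    have w1: "flip w \<in> edges (transpose_mesh M)" "horizontal (flip w)" using hw by simp_all
    obtain a b k where w: "a < b" "flip w = {ys a..ys b} \<times> {xs k}" using T.horizontal_edge_grid[OF w1] by metis
    have "(ys j, xs i) \<in> flip w" using ph(2) by simp
    then have "k = i" "a \<le> j" "j \<le> b" unfolding w(2) by auto
    then have "T.act_h (if j < b then j else j - 1) i"
      using T.interior_edge_iff[of a b i "if j < b then j else j - 1"] w1(1) wi w by auto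
    then show "act_v i (j - 1) \<or> act_v i j" unfolding transposed_act by (auto split: if_splits)
  next
    assume r: "?p \<in> interior (mesh_domain M) \<and> (act_h (i - 1) j \<or> act_h i j) \<and> (act_v i (j - 1) \<or> act_v i j)"
    obtain k where k: "act_h k j" "k = i \<or> k = i - 1" using r by auto
    obtain a b where h: "{xs a..xs b} \<times> {ys j} \<in> interior_edges M" "a \<le> k" "k < b"
      using act_h_edge[OF k(1)] by metis
    obtain m where m: "act_v i m" "m = j \<or> m = j - 1" using r by auto
    obtain c e where w: "{ys c..ys e} \<times> {xs i} \<in> interior_edges (transpose_mesh M)" "c \<le> m" "m < e"
      using T.act_h_edge[of m i] m(1) unfolding transposed_act by metis
    have h1: "{xs a..xs b} \<times> {ys j} \<in> edges M" using h(1) unfolding interior_edges_def by simp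
    have "{ys c..ys e} \<times> {xs i} \<in> edges (transpose_mesh M)"
      using w(1) unfolding interior_edges_def by simp
    then obtain k where "k \<in> edges M" "{ys c..ys e} \<times> {xs i} = flip k" unfolding edges_transpose by auto
    then have w1: "{xs i} \<times> {ys c..ys e} \<in> edges M" by (metis flip_Times flip_flip)
    have ne: "{xs a..xs b} \<times> {ys j} \<noteq> {xs i} \<times> {ys c..ys e}"
    proof
      assume eq: "{xs a..xs b} \<times> {ys j} = {xs i} \<times> {ys c..ys e}"
      have "xs a \<le> xs b" "a < b" using h by simp_all
      then have "(xs a, ys j) \<in> {xs a..xs b} \<times> {ys j}" "(xs b, ys j) \<in> {xs a..xs b} \<times> {ys j}" by auto
      then have "xs a = xs i" "xs b = xs i" unfolding eq by auto
      then show False using \<open>a < b\<close> by simp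
    qed
    have "?p \<in> {xs a..xs b} \<times> {ys j} \<inter> {xs i} \<times> {ys c..ys e}" using h w k(2) m(2) by auto
    then have "?p \<in> vertices M" using edges_meet_at_endpoints[OF h1 w1 ne] by auto
    then show "?p \<in> interior_vertices M" using r unfolding interior_vertices_def by simp
  qed
qed

lemma boundary_l_edge_exists:
  assumes "sep_h i j" "\<not> ((i, j) \<in> inside \<and> (i, j - 1) \<in> inside)"
  obtains l where "l \<in> boundary_l_edges M" "{xs i..xs (i + 1)} \<times> {ys j} \<subseteq> l"
proof -
  obtain a b where ab: "{xs a..xs b} \<times> {ys j} \<in> edges M" "a \<le> i" "i < b" using sep_h_edge[OF assms(1)] by metis
  have "{xs a..xs b} \<times> {ys j} \<notin> interior_edges M"
    using interior_edge_iff[OF ab] assms(2) act_h_iff[of i j] by metis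
  then have b: "{xs a..xs b} \<times> {ys j} \<in> boundary_edges M"
    using ab(1) unfolding interior_edges_def boundary_edges_def by simp
  have "{xs a..xs b} \<times> {ys j} \<in> segments (boundary_edges M)"
    using b interior_edge_cases(2)[OF b] by (rule edge_segment)
  then obtain l where l: "l \<in> boundary_l_edges M" "{xs a..xs b} \<times> {ys j} \<subseteq> l"
    unfolding boundary_l_edges_def by (rule segment_in_maximal[OF interior_edges_finite(2)])
  have "xs a \<le> xs i" "xs (i + 1) \<le> xs b" using ab by simp_all
  then have "{xs i..xs (i + 1)} \<times> {ys j} \<subseteq> {xs a..xs b} \<times> {ys j}" by (intro Sigma_mono) auto
  then show ?thesis using that l by (meson subset_trans)
qed

lemma boundary_l_edge_exists_v:
  assumes "sep_v i j" "\<not> ((i, j) \<in> inside \<and> (i - 1, j) \<in> inside)"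
  obtains l where "l \<in> boundary_l_edges M" "{xs i} \<times> {ys j..ys (j + 1)} \<subseteq> l"
proof -
  interpret T: grid_mesh "transpose_mesh M" ys xs by (rule transposed)
  have "T.sep_h j i" "\<not> ((j, i) \<in> T.inside \<and> (j, i - 1) \<in> T.inside)"
    using assms unfolding transposed_sep transposed_inside by simp_all
  then obtain l where l: "l \<in> boundary_l_edges (transpose_mesh M)" "{ys j..ys (j + 1)} \<times> {xs i} \<subseteq> l"
    by (rule T.boundary_l_edge_exists)
  then obtain k where k: "k \<in> boundary_l_edges M" "l = flip k" unfolding boundary_l_edges_transpose by auto
  have "flip ({ys j..ys (j + 1)} \<times> {xs i}) \<subseteq> flip l" using l(2) by (rule image_mono)
  then have "{xs i} \<times> {ys j..ys (j + 1)} \<subseteq> k" unfolding flip_Times k(2) flip_flip .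
  then show ?thesis using that k(1) by metis
qed

text \<open>Some but not all of the four grid cells around the point belong to the domain, so one of the four
  unit segments at the point has the domain on exactly one side.\<close>

lemma boundary_point_l_edge:
  assumes "(xs i, ys j) \<in> mesh_domain M" "(xs i, ys j) \<notin> interior (mesh_domain M)"
  obtains l where "l \<in> boundary_l_edges M" "(xs i, ys j) \<in> l"
proof -
  have sh: "sep_h k m" if "((k, m) \<in> inside) \<noteq> ((k, m - 1) \<in> inside)" for k m
    using that unfolding sep_h_def inside_def mem_Collect_eq by metis
  have sv: "sep_v k m" if "((k, m) \<in> inside) \<noteq> ((k - 1, m) \<in> inside)" for k m
    using that unfolding sep_v_def inside_def mem_Collect_eq by metis
  obtain Q where Q: "Q \<in> inside" "(xs i, ys j) \<in> gc Q" using assms(1) unfolding domain_eq by auto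
  then have "(i, j) \<in> inside \<or> (i - 1, j) \<in> inside \<or> (i - 1, j - 1) \<in> inside \<or> (i, j - 1) \<in> inside"
    by (cases Q) (auto simp: gc_def; smt (verit, best))
  then consider "((i, j) \<in> inside) \<noteq> ((i, j - 1) \<in> inside)" | "((i - 1, j) \<in> inside) \<noteq> ((i - 1, j - 1) \<in> inside)"
    | "((i, j) \<in> inside) \<noteq> ((i - 1, j) \<in> inside)"
    using assms(2) unfolding interior_vertex_iff by auto
  then show ?thesis
  proof cases
    case 1
    then obtain l where "l \<in> boundary_l_edges M" "{xs i..xs (i + 1)} \<times> {ys j} \<subseteq> l"
      using boundary_l_edge_exists[OF sh[OF 1]] by auto
    moreover have "(xs i, ys j) \<in> {xs i..xs (i + 1)} \<times> {ys j}" by simp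
    ultimately show ?thesis using that[of l] subsetD by metis
  next
    case 2
    then obtain l where "l \<in> boundary_l_edges M" "{xs (i - 1)..xs (i - 1 + 1)} \<times> {ys j} \<subseteq> l"
      using boundary_l_edge_exists[OF sh[OF 2]] by auto
    moreover have "(xs i, ys j) \<in> {xs (i - 1)..xs (i - 1 + 1)} \<times> {ys j}" by simp
    ultimately show ?thesis using that[of l] subsetD by metis
  next
    case 3
    then obtain l where "l \<in> boundary_l_edges M" "{xs i} \<times> {ys j..ys (j + 1)} \<subseteq> l"
      using boundary_l_edge_exists_v[OF sv[OF 3]] by auto
    moreover have "(xs i, ys j) \<in> {xs i} \<times> {ys j..ys (j + 1)}" by simp
    ultimately show ?thesis using that[of l] subsetD by metis
  qed
qed

lemma boundary_l_edges_nonempty: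
  assumes "cells M \<noteq> {}" shows "boundary_l_edges M \<noteq> {}"
proof -
  obtain f where f: "f \<in> cells M" using assms by auto
  obtain a b c e where abce: "a < b" "c < e" "f = {xs a..xs b} \<times> {ys c..ys e}" using cells_on_grid[OF f] by auto
  have "gc (a, c) \<subseteq> f" unfolding abce(3) gc_subset_iff using abce by simp
  then have ne: "fst ` inside \<noteq> {}" using insideI[OF f] by auto
  define m where "m = Max (fst ` inside)"
  have "m \<in> fst ` inside" unfolding m_def using finite_inside ne by (intro Max_in) auto
  then obtain j where j: "(m, j) \<in> inside" by auto
  have n: "(m + 1, j) \<notin> inside"
  proof
    assume "(m + 1, j) \<in> inside"
    then have "m + 1 \<in> fst ` inside" by force
    then have "m + 1 \<le> m" unfolding m_def using finite_inside by (intro Max_ge) auto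
    then show False by simp
  qed
  have "sep_v (m + 1) j" using j n unfolding sep_v_def inside_def by auto
  then show ?thesis using boundary_l_edge_exists_v[of "m + 1" j] n by auto
qed

end

section \<open>Local potentials glue on a simply connected domain\<close>

lemma common_denominator:
  fixes A :: "rat set"
  assumes "finite A"
  shows "\<exists>D :: int. D > 0 \<and> (\<forall>q\<in>A. \<exists>m. of_int D * q = of_int m)"
  using assms
proof (induction A rule: finite_induct)
  case empty
  show ?case by (intro exI[of _ 1]) simp
next
  case (insert q A)
  then obtain D :: int where D: "D > 0" "\<And>q. q \<in> A \<Longrightarrow> \<exists>m. of_int D * q = of_int m" by auto
  obtain p r where pr: "quotient_of q = (p, r)" by fastforce
  have r: "r > 0" "q = of_int p / of_int r" using quotient_of_denom_pos[OF pr] quotient_of_div[OF pr] by simp_all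
  have "of_int (D * r) * q = of_int (D * p)" using r by simp
  moreover have "\<exists>m. of_int (D * r) * s = of_int m" if s: "s \<in> A" for s
  proof -
    obtain m where "of_int D * s = of_int m" using D(2)[OF s] by auto
    then have "of_int (D * r) * s = of_int (m * r)" by (simp add: mult.commute mult.left_commute)
    then show ?thesis by (rule exI)
  qed
  moreover have "D * r > 0" using D(1) r(1) by simp
  ultimately show ?case by (intro exI[of _ "D * r"]) (metis insert_iff)
qed

definition corner :: "int \<times> int \<Rightarrow> int \<times> int \<Rightarrow> bool" where
  "corner v Q \<longleftrightarrow> (fst v = fst Q \<or> fst v = fst Q + 1) \<and> (snd v = snd Q \<or> snd v = snd Q + 1)"

context grid_mesh
begin

text \<open>A finite union of closed convex sets is an absolute neighbourhood retract.\<close>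

lemma domain_locally_path_connected: "locally path_connected (mesh_domain M)"
proof -
  have "ANR (\<Union>(gc ` inside))"
    using finite_inside
    by (intro ANR_finite_Union_convex_closed) (auto simp: gc_def intro!: closed_Times convex_Times)
  then show ?thesis unfolding domain_eq by (rule ANR_imp_locally_path_connected)
qed

text \<open>Bilinear interpolation of values given at the four corners of a grid cell.\<close>

definition interpolate :: "(int \<times> int \<Rightarrow> real) \<Rightarrow> int \<times> int \<Rightarrow> point \<Rightarrow> real" where
  "interpolate c Q p = (let i = fst Q; j = snd Q;
      t = (fst p - xs i) / (xs (i + 1) - xs i); u = (snd p - ys j) / (ys (j + 1) - ys j)
    in (1 - u) * ((1 - t) * c (i, j) + t * c (i + 1, j)) +
       u * ((1 - t) * c (i, j + 1) + t * c (i + 1, j + 1)))"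

lemma steps_nonzero [simp]: "xs (i + 1) - xs i \<noteq> 0" "ys (j + 1) - ys j \<noteq> 0"
  using xs_eq[of "i + 1" i] ys_eq[of "j + 1" j] by simp_all

lemma continuous_interpolate: "continuous_on A (interpolate c Q)"
  unfolding interpolate_def Let_def by (intro continuous_intros) simp_all

lemma interpolate_corner:
  assumes "corner v Q" shows "interpolate c Q (xs (fst v), ys (snd v)) = c v"
proof -
  obtain a b where v: "v = (a, b)" by fastforce
  obtain i j where Q: "Q = (i, j)" by fastforce
  have "a = i \<or> a = i + 1" "b = j \<or> b = j + 1" using assms unfolding corner_def v Q by simp_all
  moreover have "(xs (i + 1) - xs i) / (xs (i + 1) - xs i) = 1" "(ys (j + 1) - ys j) / (ys (j + 1) - ys j) = 1"
    by simp_all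
  ultimately show ?thesis unfolding interpolate_def Let_def v Q by (elim disjE) simp_all
qed

lemma interpolate_bottom: "interpolate c (i, j) (x, ys j) =
    (1 - (x - xs i) / (xs (i + 1) - xs i)) * c (i, j) + (x - xs i) / (xs (i + 1) - xs i) * c (i + 1, j)"
  unfolding interpolate_def Let_def by simp

lemma interpolate_top: "interpolate c (i, j - 1) (x, ys j) =
    (1 - (x - xs i) / (xs (i + 1) - xs i)) * c (i, j) + (x - xs i) / (xs (i + 1) - xs i) * c (i + 1, j)"
  using steps_nonzero(2)[of "j - 1"] unfolding interpolate_def Let_def by simp

lemma interpolate_left: "interpolate c (i, j) (xs i, y) =
    (1 - (y - ys j) / (ys (j + 1) - ys j)) * c (i, j) + (y - ys j) / (ys (j + 1) - ys j) * c (i, j + 1)"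
  unfolding interpolate_def Let_def by simp

lemma interpolate_right: "interpolate c (i - 1, j) (xs i, y) =
    (1 - (y - ys j) / (ys (j + 1) - ys j)) * c (i, j) + (y - ys j) / (ys (j + 1) - ys j) * c (i, j + 1)"
  using steps_nonzero(1)[of "i - 1"] unfolding interpolate_def Let_def by simp

lemma touching_cells:
  assumes "(x, y) \<in> gc (i, j)" "(x, y) \<in> gc (i', j')"
  shows "(i' = i \<and> j' = j) \<or> (i' = i \<and> j' = j - 1 \<and> y = ys j) \<or> (i' = i \<and> j' = j + 1 \<and> y = ys j') \<or>
    (i' = i - 1 \<and> j' = j \<and> x = xs i) \<or> (i' = i + 1 \<and> j' = j \<and> x = xs i') \<or>
    (\<exists>v. corner v (i, j) \<and> corner v (i', j') \<and> x = xs (fst v) \<and> y = ys (snd v))"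
proof -
  have b: "xs i \<le> x" "x \<le> xs (i + 1)" "xs i' \<le> x" "x \<le> xs (i' + 1)"
    "ys j \<le> y" "y \<le> ys (j + 1)" "ys j' \<le> y" "y \<le> ys (j' + 1)"
    using assms by (simp_all add: gc_def)
  have "xs i' \<le> xs (i + 1)" "xs i \<le> xs (i' + 1)" "ys j' \<le> ys (j + 1)" "ys j \<le> ys (j' + 1)"
    using b by linarith+
  then have ij: "i' = i - 1 \<or> i' = i \<or> i' = i + 1" "j' = j - 1 \<or> j' = j \<or> j' = j + 1" by auto
  have X: "i' = i - 1 \<Longrightarrow> x = xs i" "i' = i + 1 \<Longrightarrow> x = xs i'" "j' = j - 1 \<Longrightarrow> y = ys j" "j' = j + 1 \<Longrightarrow> y = ys j'"
    using b by simp_all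
  have C: "\<exists>v. corner v (i, j) \<and> corner v (i', j') \<and> x = xs (fst v) \<and> y = ys (snd v)"
    if "i' = i - 1 \<or> i' = i + 1" "j' = j - 1 \<or> j' = j + 1"
  proof (intro exI[of _ "(if i' = i - 1 then i else i', if j' = j - 1 then j else j')"] conjI)
  qed (use that X in \<open>auto simp: corner_def\<close>)
  show ?thesis using ij X C by metis
qed

text \<open>On a common edge two interpolants differ by the constant integer by which their corner values
  differ, and in a common corner they take their corner values.\<close>

lemma interpolate_diff_Ints:
  fixes n :: "int \<times> int \<Rightarrow> int \<times> int \<Rightarrow> int"
  assumes h: "\<And>i j. (i, j) \<in> inside \<Longrightarrow> (i, j - 1) \<in> inside \<Longrightarrow>
      n (i, j) (i, j) - n (i, j) (i, j - 1) = n (i + 1, j) (i, j) - n (i + 1, j) (i, j - 1)"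
    and v: "\<And>i j. (i, j) \<in> inside \<Longrightarrow> (i - 1, j) \<in> inside \<Longrightarrow>
      n (i, j) (i, j) - n (i, j) (i - 1, j) = n (i, j + 1) (i, j) - n (i, j + 1) (i - 1, j)"
    and Q: "Q \<in> inside" "Q' \<in> inside" "p \<in> gc Q" "p \<in> gc Q'"
  shows "interpolate (\<lambda>v. n v Q) Q p - interpolate (\<lambda>v. n v Q') Q' p \<in> \<int>"
proof -
  let ?h = "\<lambda>Q. interpolate (\<lambda>v. of_int (n v Q)) Q"
  have lin: "((1 - t) * of_int a + t * of_int b) - ((1 - t) * of_int a' + t * of_int b') = (of_int (a - a') :: real)"
    if "a - a' = b - b'" for t :: real and a b a' b' :: int
  proof -
    have "((1 - t) * of_int a + t * of_int b) - ((1 - t) * of_int a' + t * of_int b') =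
        (1 - t) * (of_int (a - a') :: real) + t * of_int (b - b')"
      by (simp add: algebra_simps)
    then show ?thesis unfolding that[symmetric] by (simp add: algebra_simps)
  qed
  have H: "?h (i, j) (x, ys j) - ?h (i, j - 1) (x, ys j) = of_int (n (i, j) (i, j) - n (i, j) (i, j - 1))"
    if "(i, j) \<in> inside" "(i, j - 1) \<in> inside" for i j x
    unfolding interpolate_bottom interpolate_top by (rule lin[OF h[OF that]])
  have V: "?h (i, j) (xs i, y) - ?h (i - 1, j) (xs i, y) = of_int (n (i, j) (i, j) - n (i, j) (i - 1, j))"
    if "(i, j) \<in> inside" "(i - 1, j) \<in> inside" for i j y
    unfolding interpolate_left interpolate_right by (rule lin[OF v[OF that]])
  have neg: "a - b \<in> \<int>" if "b - a = of_int m" for a b :: real and m :: int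
  proof -
    have "a - b = of_int (- m)" using that by simp
    then show ?thesis by (metis Ints_of_int)
  qed
  obtain i j where ij: "Q = (i, j)" by fastforce
  obtain i' j' where ij': "Q' = (i', j')" by fastforce
  obtain x y where p: "p = (x, y)" by fastforce
  consider "i' = i" "j' = j" | "i' = i" "j' = j - 1" "y = ys j" | "i' = i" "j' = j + 1" "y = ys j'"
    | "i' = i - 1" "j' = j" "x = xs i" | "i' = i + 1" "j' = j" "x = xs i'"
    | w where "corner w (i, j)" "corner w (i', j')" "x = xs (fst w)" "y = ys (snd w)"
    using touching_cells[of x y i j i' j'] Q(3,4) unfolding ij ij' p by metis
  then show ?thesis
  proof cases
    case 1 then show ?thesis unfolding ij ij' by simp
  next
    case 2 then show ?thesis unfolding ij ij' p using H[of i j x] Q(1,2) by (simp add: ij ij')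
  next
    case 3
    have "?h (i', j') (x, ys j') - ?h (i', j' - 1) (x, ys j') = of_int (n (i', j') (i', j') - n (i', j') (i', j' - 1))"
      using H[of i' j' x] Q(1,2) 3 unfolding ij ij' by simp
    from neg[OF this] show ?thesis unfolding ij ij' p using 3 by simp
  next
    case 4 then show ?thesis unfolding ij ij' p using V[of i j y] Q(1,2) by (simp add: ij ij')
  next
    case 5
    have "?h (i', j') (xs i', y) - ?h (i' - 1, j') (xs i', y) = of_int (n (i', j') (i', j') - n (i', j') (i' - 1, j'))"
      using V[of i' j' y] Q(1,2) 5 unfolding ij ij' by simp
    from neg[OF this] show ?thesis unfolding ij ij' p using 5 by simp
  next
    case 6
    then show ?thesis unfolding ij ij' p 6(3,4) interpolate_corner[OF 6(1)] interpolate_corner[OF 6(2)]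
      by simp
  qed
qed

text \<open>Local potentials around the grid vertices that have consistent jumps across the edges define
  a function into the unit circle; its logarithm on the simply connected domain turns them into a
  global potential.\<close>

lemma integer_potential:
  fixes n :: "int \<times> int \<Rightarrow> int \<times> int \<Rightarrow> int"
  assumes h: "\<And>i j. (i, j) \<in> inside \<Longrightarrow> (i, j - 1) \<in> inside \<Longrightarrow>
      n (i, j) (i, j) - n (i, j) (i, j - 1) = n (i + 1, j) (i, j) - n (i + 1, j) (i, j - 1)"
    and v: "\<And>i j. (i, j) \<in> inside \<Longrightarrow> (i - 1, j) \<in> inside \<Longrightarrow>
      n (i, j) (i, j) - n (i, j) (i - 1, j) = n (i, j + 1) (i, j) - n (i, j + 1) (i - 1, j)"
  shows "\<exists>k :: int \<times> int \<Rightarrow> int. \<forall>v Q Q'. Q \<in> inside \<longrightarrow> Q' \<in> inside \<longrightarrow> corner v Q \<longrightarrow> corner v Q' \<longrightarrow>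
      k Q - k Q' = n v Q - n v Q'"
proof -
  define hh where "hh = (\<lambda>Q. interpolate (\<lambda>v. of_int (n v Q)) Q)"
  \<comment> \<open>the choice of the grid cell does not matter, as the interpolants differ by integers\<close>
  define f where "f = (\<lambda>p. exp (2 * of_real pi * \<i> * of_real (hh (SOME Q. Q \<in> inside \<and> p \<in> gc Q) p)))"
  have diff: "hh Q p - hh Q' p \<in> \<int>" if "Q \<in> inside" "Q' \<in> inside" "p \<in> gc Q" "p \<in> gc Q'" for Q Q' p
    unfolding hh_def using interpolate_diff_Ints[of n, OF h v that] by simp
  have feq: "f p = exp (2 * of_real pi * \<i> * of_real (hh Q p))" if Q: "Q \<in> inside" "p \<in> gc Q" for Q p
  proof -
    define R where "R = (SOME Q. Q \<in> inside \<and> p \<in> gc Q)"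
    have "\<exists>Q. Q \<in> inside \<and> p \<in> gc Q" using Q by metis
    then have R: "R \<in> inside \<and> p \<in> gc R" unfolding R_def by (rule someI_ex)
    then have "hh R p - hh Q p \<in> \<int>" using diff[of R Q p] Q by simp
    then obtain m where m: "hh R p - hh Q p = of_int m" by (rule Ints_cases)
    then have "hh R p = hh Q p + of_int m" by simp
    then have "2 * of_real pi * \<i> * of_real (hh R p) =
        2 * of_real pi * \<i> * of_real (hh Q p) + (of_int (2 * m) * of_real pi) * \<i>"
      by (simp add: algebra_simps)
    then show ?thesis unfolding f_def R_def[symmetric] exp_eq by auto
  qed
  have "continuous_on (gc Q) f" if Q: "Q \<in> inside" for Q
  proof -
    have "continuous_on (gc Q) (\<lambda>p. exp (2 * of_real pi * \<i> * of_real (hh Q p)))"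
      unfolding hh_def by (intro continuous_intros continuous_interpolate)
    then show ?thesis using feq[OF Q] by (simp cong: continuous_on_cong)
  qed
  then have "continuous_on (\<Union>Q\<in>inside. gc Q) f"
    using finite_inside by (intro continuous_on_closed_Union) (auto simp: gc_def intro!: closed_Times)
  then have "continuous_on (mesh_domain M) f" unfolding domain_eq .
  moreover have "simply_connected (mesh_domain M)" using mesh unfolding t_mesh_def by simp
  moreover have "f p \<noteq> 0" for p unfolding f_def by simp
  ultimately obtain g where g: "continuous_on (mesh_domain M) g" "\<And>x. x \<in> mesh_domain M \<Longrightarrow> f x = exp (g x)"
    using continuous_logarithm_on_simply_connected[OF _ _ domain_locally_path_connected] by metis
  \<comment> \<open>on each grid cell the logarithm differs from the interpolant by a constant integer\<close>
  define \<phi> where "\<phi> = (\<lambda>Q p. g p / (2 * of_real pi * \<i>) - of_real (hh Q p))"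
  have int: "\<phi> Q p \<in> \<int>" if Q: "Q \<in> inside" "p \<in> gc Q" for Q p
  proof -
    have "p \<in> mesh_domain M" using Q(2) gc_subset_domain[OF Q(1)] by (rule_tac subsetD)
    then have "exp (g p) = exp (2 * of_real pi * \<i> * of_real (hh Q p))" using g(2) feq[OF Q] by simp
    then obtain m :: int where "g p = 2 * of_real pi * \<i> * of_real (hh Q p) + (of_int (2 * m) * of_real pi) * \<i>"
      unfolding exp_eq by auto
    then have "g p = (2 * of_real pi * \<i>) * (of_real (hh Q p) + of_int m)" by (simp add: algebra_simps)
    then have "\<phi> Q p = of_int m" unfolding \<phi>_def by simp
    then show ?thesis by simp
  qed
  have "\<exists>m :: int. \<forall>p\<in>gc Q. \<phi> Q p = of_int m" if Q: "Q \<in> inside" for Q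
  proof -
    have "continuous_on (gc Q) (\<phi> Q)"
      unfolding \<phi>_def hh_def
      by (intro continuous_intros continuous_interpolate continuous_on_subset[OF g(1) gc_subset_domain[OF Q]]) simp
    moreover have "connected (gc Q)" unfolding gc_def by (intro connected_Times) auto
    moreover have "\<exists>e>0. \<forall>y. y \<in> gc Q \<and> \<phi> Q y \<noteq> \<phi> Q x \<longrightarrow> e \<le> norm (\<phi> Q y - \<phi> Q x)" if x: "x \<in> gc Q" for x
    proof (intro exI[of _ 1] conjI allI impI)
      fix y assume y: "y \<in> gc Q \<and> \<phi> Q y \<noteq> \<phi> Q x"
      obtain a b :: int where "\<phi> Q y = of_int a" "\<phi> Q x = of_int b"
        using int[OF Q, of y] int[OF Q, of x] x y by (auto elim!: Ints_cases)
      then have "\<phi> Q y - \<phi> Q x = of_int (a - b)" "a - b \<noteq> 0" using y by auto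
      then show "1 \<le> norm (\<phi> Q y - \<phi> Q x)" by (simp only: norm_of_int)
    qed simp
    ultimately have "\<phi> Q constant_on gc Q" using continuous_discrete_range_constant by metis
    then obtain z where z: "\<And>p. p \<in> gc Q \<Longrightarrow> \<phi> Q p = z" unfolding constant_on_def by metis
    have p0: "(xs (fst Q), ys (snd Q)) \<in> gc Q" by (simp add: gc_def)
    then obtain m :: int where "z = of_int m" using int[OF Q p0] z[OF p0] by (auto elim!: Ints_cases)
    then show ?thesis using z by auto
  qed
  then obtain m :: "int \<times> int \<Rightarrow> int" where m: "\<And>Q p. Q \<in> inside \<Longrightarrow> p \<in> gc Q \<Longrightarrow> \<phi> Q p = of_int (m Q)"
    by metis
  have "- m Q - - m Q' = n v Q - n v Q'" if "Q \<in> inside" "Q' \<in> inside" "corner v Q" "corner v Q'" for v Q Q'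
  proof -
    let ?p = "(xs (fst v), ys (snd v))"
    have pQ: "?p \<in> gc R" if "corner v R" for R using that unfolding corner_def by (auto simp: gc_def)
    have "g ?p / (2 * of_real pi * \<i>) = of_int (m R + n v R)" if R: "R \<in> inside" "corner v R" for R
    proof -
      have "\<phi> R ?p = of_int (m R)" using m R pQ by simp
      then show ?thesis unfolding \<phi>_def hh_def interpolate_corner[OF R(2)] by (simp add: algebra_simps)
    qed
    from this[of Q] this[of Q'] that have "(of_int (m Q + n v Q) :: complex) = of_int (m Q' + n v Q')" by simp
    then have "m Q + n v Q = m Q' + n v Q'" by (simp only: of_int_eq_iff)
    then show ?thesis by simp
  qed
  then show ?thesis by (intro exI[of _ "\<lambda>Q. - m Q"]) simp
qed

text \<open>Real potentials reduce to integer ones by expanding the finitely many values in a basis over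
  the rational numbers.\<close>

lemma real_potential:
  fixes n :: "int \<times> int \<Rightarrow> int \<times> int \<Rightarrow> real"
  assumes h: "\<And>i j. (i, j) \<in> inside \<Longrightarrow> (i, j - 1) \<in> inside \<Longrightarrow>
      n (i, j) (i, j) - n (i, j) (i, j - 1) = n (i + 1, j) (i, j) - n (i + 1, j) (i, j - 1)"
    and v: "\<And>i j. (i, j) \<in> inside \<Longrightarrow> (i - 1, j) \<in> inside \<Longrightarrow>
      n (i, j) (i, j) - n (i, j) (i - 1, j) = n (i, j + 1) (i, j) - n (i, j + 1) (i - 1, j)"
  shows "\<exists>k :: int \<times> int \<Rightarrow> real. \<forall>v Q Q'. Q \<in> inside \<longrightarrow> Q' \<in> inside \<longrightarrow> corner v Q \<longrightarrow> corner v Q' \<longrightarrow>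
      k Q - k Q' = n v Q - n v Q'"
proof -
  interpret q: vector_space "\<lambda>(r :: rat) (x :: real). of_rat r * x"
    by unfold_locales (simp_all add: algebra_simps of_rat_add of_rat_mult)
  define S where "S = (\<lambda>(Q, a, b). n (fst Q + a, snd Q + b) Q) ` (inside \<times> {0, 1} \<times> {0, 1})"
  have finS: "finite S" unfolding S_def using finite_inside by simp
  have inS: "n w Q \<in> S" if "Q \<in> inside" "corner w Q" for w Q
  proof -
    have "(Q, fst w - fst Q, snd w - snd Q) \<in> inside \<times> {0, 1} \<times> {0, 1}"
      using that unfolding corner_def by auto
    then have "(\<lambda>(Q, a, b). n (fst Q + a, snd Q + b) Q) (Q, fst w - fst Q, snd w - snd Q) \<in> S"
      unfolding S_def by (rule imageI)
    then show ?thesis by simp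
  qed
  \<comment> \<open>a basis of the rational span, hence finite\<close>
  obtain B where B: "B \<subseteq> S" "q.independent B" "S \<subseteq> q.span B" using q.basis_exists by metis
  have finB: "finite B" using B(1) finS by (rule finite_subset)
  define r where "r = (\<lambda>b w Q. q.representation B (n w Q) b)"
  have expand: "n w Q = (\<Sum>b\<in>B. of_rat (r b w Q) * b)" if "Q \<in> inside" "corner w Q" for w Q
    unfolding r_def using q.sum_representation_eq[OF B(2) _ finB subset_refl, of "n w Q"] inS[OF that] B(3) by auto
  have rdiff: "r b w Q - r b w Q' = r b w' Q - r b w' Q'"
    if "n w Q - n w Q' = n w' Q - n w' Q'" "Q \<in> inside" "Q' \<in> inside" "corner w Q" "corner w Q'"
      "corner w' Q" "corner w' Q'" for b w w' Q Q'
  proof -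
    have "q.representation B (n u Q - n u Q') b = r b u Q - r b u Q'" if "corner u Q" "corner u Q'" for u
    proof -
      have "n u Q \<in> q.span B" "n u Q' \<in> q.span B"
        using subsetD[OF B(3)] inS[OF \<open>Q \<in> inside\<close> that(1)] inS[OF \<open>Q' \<in> inside\<close> that(2)] by simp_all
      then show ?thesis unfolding r_def using q.representation_diff[OF B(2)] by metis
    qed
    from this[of w] this[of w'] that show ?thesis by simp
  qed
  have "\<exists>k :: int \<times> int \<Rightarrow> real. \<forall>v Q Q'. Q \<in> inside \<longrightarrow> Q' \<in> inside \<longrightarrow> corner v Q \<longrightarrow> corner v Q' \<longrightarrow>
      k Q - k Q' = of_rat (r b v Q) - of_rat (r b v Q')" for b
  proof -
    define A where "A = (\<lambda>(Q, c, e). r b (fst Q + c, snd Q + e) Q) ` (inside \<times> {0, 1} \<times> {0, 1})"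
    have "finite A" unfolding A_def using finite_inside by simp
    then obtain D :: int where D: "D > 0" "\<And>q. q \<in> A \<Longrightarrow> \<exists>m. of_int D * q = of_int m"
      using common_denominator by metis
    have inA: "r b w Q \<in> A" if "Q \<in> inside" "corner w Q" for w Q
    proof -
      have "(Q, fst w - fst Q, snd w - snd Q) \<in> inside \<times> {0, 1} \<times> {0, 1}"
        using that unfolding corner_def by auto
      then have "(\<lambda>(Q, c, e). r b (fst Q + c, snd Q + e) Q) (Q, fst w - fst Q, snd w - snd Q) \<in> A"
        unfolding A_def by (rule imageI)
      then show ?thesis by simp
    qed
    \<comment> \<open>these numbers are integers, so the floor only changes the type\<close>
    define N where "N = (\<lambda>w Q. \<lfloor>of_int D * r b w Q\<rfloor>)"
    have N: "of_int (N w Q) = of_int D * r b w Q" if "Q \<in> inside" "corner w Q" for w Q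
    proof -
      obtain m where "of_int D * r b w Q = of_int m"
        using D(2)[OF inA[OF \<open>Q \<in> inside\<close> \<open>corner w Q\<close>]] by metis
      then show ?thesis unfolding N_def by simp
    qed
    have Neq: "N w Q - N w Q' = N w' Q - N w' Q'"
      if "n w Q - n w Q' = n w' Q - n w' Q'" "Q \<in> inside" "Q' \<in> inside" "corner w Q" "corner w Q'"
      "corner w' Q" "corner w' Q'" for w w' Q Q'
    proof -
      have "(of_int (N w Q - N w Q') :: rat) = of_int D * (r b w Q - r b w Q')"
        using N that by (simp add: algebra_simps)
      also have "\<dots> = of_int D * (r b w' Q - r b w' Q')" using rdiff[OF that] by simp
      also have "\<dots> = of_int (N w' Q - N w' Q')" using N that by (simp add: algebra_simps)
      finally show ?thesis by (simp only: of_int_eq_iff)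
    qed
    have "\<exists>k :: int \<times> int \<Rightarrow> int. \<forall>v Q Q'. Q \<in> inside \<longrightarrow> Q' \<in> inside \<longrightarrow> corner v Q \<longrightarrow> corner v Q' \<longrightarrow>
      k Q - k Q' = N v Q - N v Q'"
      by (rule integer_potential) (rule Neq, auto simp: h v corner_def)+
    then obtain k :: "int \<times> int \<Rightarrow> int" where
      k: "\<And>v Q Q'. Q \<in> inside \<Longrightarrow> Q' \<in> inside \<Longrightarrow> corner v Q \<Longrightarrow> corner v Q' \<Longrightarrow> k Q - k Q' = N v Q - N v Q'"
      by metis
    show ?thesis
    proof (intro exI[of _ "\<lambda>Q. of_int (k Q) / of_int D"] allI impI)
      fix v Q Q' assume a: "Q \<in> inside" "Q' \<in> inside" "corner v Q" "corner v Q'"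
      have N': "of_int (N v R) = (of_int D * of_rat (r b v R) :: real)" if "R \<in> inside" "corner v R" for R
        using arg_cong[OF N[OF that], of "of_rat :: rat \<Rightarrow> real"] by (simp add: of_rat_mult)
      have "(of_int (k Q - k Q') :: real) = of_int (N v Q - N v Q')" using k[OF a] by simp
      also have "\<dots> = of_int D * (of_rat (r b v Q) - of_rat (r b v Q'))" using N' a by (simp add: algebra_simps)
      finally show "of_int (k Q) / of_int D - of_int (k Q') / of_int D = (of_rat (r b v Q) - of_rat (r b v Q') :: real)"
        using D(1) by (simp add: field_simps)
    qed
  qed
  then obtain k :: "real \<Rightarrow> int \<times> int \<Rightarrow> real" where
    k: "\<And>b v Q Q'. Q \<in> inside \<Longrightarrow> Q' \<in> inside \<Longrightarrow> corner v Q \<Longrightarrow> corner v Q' \<Longrightarrow>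
      k b Q - k b Q' = of_rat (r b v Q) - of_rat (r b v Q')"
    by metis
  show ?thesis
  proof (intro exI[of _ "\<lambda>Q. \<Sum>b\<in>B. k b Q * b"] allI impI)
    fix v Q Q' assume a: "Q \<in> inside" "Q' \<in> inside" "corner v Q" "corner v Q'"
    have "(\<Sum>b\<in>B. k b Q * b) - (\<Sum>b\<in>B. k b Q' * b) = (\<Sum>b\<in>B. (k b Q - k b Q') * b)"
      by (simp add: sum_subtractf algebra_simps)
    also have "\<dots> = (\<Sum>b\<in>B. (of_rat (r b v Q) - of_rat (r b v Q')) * b)"
      using k[OF a] by simp
    also have "\<dots> = n v Q - n v Q'" unfolding expand[OF a(1,3)] expand[OF a(2,4)]
      by (simp add: sum_subtractf algebra_simps)
    finally show "(\<Sum>b\<in>B. k b Q * b) - (\<Sum>b\<in>B. k b Q' * b) = n v Q - n v Q'" .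
  qed
qed

end

section \<open>Polynomial pieces and their jumps\<close>

text \<open>The coefficient of \<open>t ^ k\<close> in \<open>(t - x) ^ d\<close>.\<close>

definition shifted_power :: "nat \<Rightarrow> real \<Rightarrow> nat \<Rightarrow> real" where
  "shifted_power d x k = of_nat (d choose k) * (- x) ^ (d - k)"

lemma shifted_power_top [simp]: "shifted_power d x d = 1"
  and shifted_power_beyond: "k > d \<Longrightarrow> shifted_power d x k = 0"
  unfolding shifted_power_def by simp_all

lemma coeff_shifted_power: "coeff ([:- x, 1:] ^ d) k = shifted_power d x k"
proof (cases "k \<le> d")
  case True
  then show ?thesis unfolding shifted_power_def by (simp add: coeff_linear_poly_power)
next
  case False
  then have "degree ([:- x, 1:] ^ d) < k" by (simp add: degree_linear_power)
  then show ?thesis using False by (simp add: coeff_eq_0 shifted_power_beyond)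
qed

definition poly_of :: "nat \<Rightarrow> (nat \<Rightarrow> real) \<Rightarrow> real poly" where
  "poly_of d e = (\<Sum>i\<le>d. monom (e i) i)"

lemma coeff_poly_of: "coeff (poly_of d e) i = (if i \<le> d then e i else 0)"
  unfolding poly_of_def coeff_sum by (simp add: sum.delta if_distrib cong: if_cong)

lemma poly_poly_of: "poly (poly_of d e) x = (\<Sum>i\<le>d. e i * x ^ i)"
  unfolding poly_of_def poly_sum by (simp add: poly_monom)

lemma degree_poly_of: "degree (poly_of d e) \<le> d"
  by (rule degree_le) (simp add: coeff_poly_of)

lemma poly_of_shifted_power: "poly_of d (shifted_power d x) = [:- x, 1:] ^ d"
  by (rule poly_eqI) (simp add: coeff_poly_of coeff_shifted_power shifted_power_beyond)

lemma sum_shifted_power: "(\<Sum>k\<le>d. shifted_power d x k * t ^ k) = (t - x) ^ d"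
  unfolding poly_poly_of[symmetric] poly_of_shifted_power by simp

lemma coeffs_zero:
  fixes e :: "nat \<Rightarrow> real"
  assumes "infinite Y" "\<And>y. y \<in> Y \<Longrightarrow> (\<Sum>j\<le>d. e j * y ^ j) = 0" "j \<le> d"
  shows "e j = 0"
proof -
  have "Y \<subseteq> {y. poly (poly_of d e) y = 0}" using assms(2) unfolding poly_poly_of by auto
  then have "poly_of d e = 0" using poly_roots_finite assms(1) finite_subset by metis
  then have "coeff (poly_of d e) j = 0" by simp
  then show ?thesis using assms(3) by (simp add: coeff_poly_of)
qed

text \<open>Each derivative lowers the order of a root by exactly one.\<close>

lemma power_dvd_of_higher_pderiv_zero:
  fixes p :: "real poly"
  assumes "\<And>i. i < d \<Longrightarrow> poly ((pderiv ^^ i) p) a = 0"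
  shows "[:- a, 1:] ^ d dvd p"
  using assms
proof (induction d arbitrary: p)
  case 0 then show ?case by simp
next
  case (Suc d)
  show ?case
  proof (cases "p = 0")
    case False
    have pa: "poly p a = 0" using Suc.prems[of 0] by simp
    have "[:- a, 1:] ^ d dvd pderiv p"
    proof (rule Suc.IH)
      fix i assume "i < d"
      then show "poly ((pderiv ^^ i) (pderiv p)) a = 0"
        using Suc.prems[of "Suc i"] by (simp add: funpow_swap1)
    qed
    then have "pderiv p = 0 \<or> d \<le> order a (pderiv p)" unfolding order_divides .
    moreover have "pderiv p \<noteq> 0"
    proof
      assume "pderiv p = 0"
      then obtain c where "p = [:c:]" unfolding pderiv_eq_0_iff using degree_eq_zeroE by metis
      then show False using pa False by simp
    qed
    ultimately have "Suc d \<le> order a p" using order_pderiv[OF False pa] by simp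
    then show ?thesis unfolding order_divides by simp
  qed simp
qed

lemma higher_pderiv_zero_at_root:
  fixes a :: real
  assumes "m < d" shows "poly ((pderiv ^^ m) ([:- a, 1:] ^ d)) a = 0"
  using assms
proof (induction m arbitrary: d)
  case 0 then show ?case by simp
next
  case (Suc m)
  obtain d' where d: "d = Suc d'" using Suc.prems by (cases d) auto
  have "pderiv ([:- a, 1:] ^ d) = smult (of_nat (Suc d')) ([:- a, 1:] ^ d')"
    unfolding d pderiv_power_Suc by (simp add: pderiv_pCons)
  then have "(pderiv ^^ Suc m) ([:- a, 1:] ^ d) = smult (of_nat (Suc d')) ((pderiv ^^ m) ([:- a, 1:] ^ d'))"
    by (simp only: funpow_Suc_right comp_apply higher_pderiv_smult)
  then show ?case using Suc d by simp
qed

lemma coeff_of_power_multiple: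
  fixes p :: "real poly"
  assumes "degree p \<le> d" "[:- a, 1:] ^ d dvd p"
  shows "coeff p k = shifted_power d a k * coeff p d"
proof -
  obtain q where q: "p = [:- a, 1:] ^ d * q" using assms(2) unfolding dvd_def by auto
  show ?thesis
  proof (cases "p = 0")
    case False
    then have "q \<noteq> 0" using q by auto
    then have "degree p = d + degree q" unfolding q by (simp add: degree_mult_eq degree_power_eq)
    then have "degree q = 0" using assms(1) by simp
    then obtain c where "q = [:c:]" using degree_eq_zeroE by metis
    then have "p = smult c ([:- a, 1:] ^ d)" unfolding q by simp
    then show ?thesis by (simp add: coeff_shifted_power)
  qed simp
qed

definition eval_coeffs :: "nat \<Rightarrow> (nat \<Rightarrow> nat \<Rightarrow> real) \<Rightarrow> point \<Rightarrow> real" where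
  "eval_coeffs d c p = (\<Sum>i\<le>d. \<Sum>j\<le>d. c i j * fst p ^ i * snd p ^ j)"

lemma eval_coeffs_poly: "eval_coeffs d c (x, y) = poly (poly_of d (\<lambda>i. \<Sum>j\<le>d. c i j * y ^ j)) x"
  unfolding eval_coeffs_def poly_poly_of fst_conv snd_conv sum_distrib_right
  by (intro sum.cong refl) (simp add: mult.commute mult.left_commute)

lemma eval_coeffs_unique:
  assumes "x1 < x2" "y1 < y2"
    and "\<And>x y. x1 < x \<Longrightarrow> x < x2 \<Longrightarrow> y1 < y \<Longrightarrow> y < y2 \<Longrightarrow> eval_coeffs d c (x, y) = eval_coeffs d c' (x, y)"
    and "k \<le> d" "l \<le> d"
  shows "c k l = c' k l"
proof -
  have inf: "infinite {x1<..<x2}" "infinite {y1<..<y2}" using assms(1,2) by (simp_all add: infinite_Ioo)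
  have "(\<Sum>j\<le>d. (c k j - c' k j) * y ^ j) = 0" if y: "y \<in> {y1<..<y2}" for y
  proof -
    have "(\<Sum>i\<le>d. (\<Sum>j\<le>d. (c i j - c' i j) * y ^ j) * x ^ i) = 0" if "x \<in> {x1<..<x2}" for x
      using assms(3)[of x y] that y unfolding eval_coeffs_poly poly_poly_of
      by (simp add: sum_subtractf algebra_simps sum_distrib_right)
    from coeffs_zero[OF inf(1) this assms(4)] show ?thesis .
  qed
  from coeffs_zero[OF inf(2) this assms(5)] show ?thesis by simp
qed

text \<open>Derivatives are compared within \<open>S\<close>, which may be a half-open interval; this gives the values
  of the derivatives at the common end point of two adjacent pieces.\<close>

lemma derivatives_agree_with_poly:
  fixes g :: "nat \<Rightarrow> real \<Rightarrow> real"
  assumes "connected S" "\<And>a. S \<noteq> {a}"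
    and "\<And>t. t \<in> S \<Longrightarrow> g 0 t = poly p t"
    and "\<And>i t. i < m \<Longrightarrow> t \<in> S \<Longrightarrow> (g i has_real_derivative g (Suc i) t) (at t)"
  shows "i \<le> m \<Longrightarrow> t \<in> S \<Longrightarrow> g i t = poly ((pderiv ^^ i) p) t"
proof (induction i arbitrary: t)
  case 0 then show ?case using assms(3) by simp
next
  case (Suc i)
  have lim: "at t within S \<noteq> bot"
    using connected_imp_perfect[OF assms(1) Suc.prems(2) assms(2)] by (simp add: trivial_limit_within)
  have "(g i has_real_derivative g (Suc i) t) (at t)" using assms(4) Suc.prems by simp
  then have 1: "(g i has_vector_derivative g (Suc i) t) (at t within S)"
    by (simp add: has_real_derivative_iff_has_vector_derivative has_vector_derivative_at_within)
  have "(poly ((pderiv ^^ i) p) has_real_derivative poly (pderiv ((pderiv ^^ i) p)) t) (at t within S)"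
    by (rule has_field_derivative_at_within[OF poly_DERIV])
  then have "(poly ((pderiv ^^ i) p) has_vector_derivative poly ((pderiv ^^ Suc i) p) t) (at t within S)"
    by (simp add: has_real_derivative_iff_has_vector_derivative)
  then have 2: "(g i has_vector_derivative poly ((pderiv ^^ Suc i) p) t) (at t within S)"
  proof (rule has_vector_derivative_transform[rotated 2])
    show "g i s = poly ((pderiv ^^ i) p) s" if "s \<in> S" for s using Suc.IH[of s] Suc.prems that by simp
  qed (rule Suc.prems)
  show ?case by (rule vector_derivative_unique_within[OF lim 1 2])
qed

text \<open>On each horizontal line the derivatives of the difference up to order \<open>d - 1\<close> vanish at \<open>x0\<close>, so
  that it is divisible by \<open>(x - x0) ^ d\<close>; the quotient is its coefficient of \<open>x ^ d\<close>.\<close>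

lemma smooth_x_jump:
  assumes d: "d \<ge> 1" and s: "smooth_x (d - 1) D s"
    and x: "x1 < x0" "x0 < x2" and y: "y1 < y2"
    and D: "{x1..x2} \<times> {y1..y2} \<subseteq> D"
    and left: "\<And>x y. x1 \<le> x \<Longrightarrow> x \<le> x0 \<Longrightarrow> y1 \<le> y \<Longrightarrow> y \<le> y2 \<Longrightarrow> s (x, y) = eval_coeffs d c (x, y)"
    and right: "\<And>x y. x0 \<le> x \<Longrightarrow> x \<le> x2 \<Longrightarrow> y1 \<le> y \<Longrightarrow> y \<le> y2 \<Longrightarrow> s (x, y) = eval_coeffs d c' (x, y)"
    and k: "k \<le> d" "l \<le> d"
  shows "c' k l - c k l = shifted_power d x0 k * (c' d l - c d l)"
proof -
  obtain g where g: "g 0 = s" "\<And>i x y. i < d - 1 \<Longrightarrow> (x, y) \<in> interior D \<Longrightarrow>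
      ((\<lambda>t. g i (t, y)) has_real_derivative g (Suc i) (x, y)) (at x)"
    using s unfolding smooth_x_def by metis
  have int: "(x, y) \<in> interior D" if "x1 < x" "x < x2" "y1 < y" "y < y2" for x y
  proof (rule interiorI)
    show "open ({x1<..<x2} \<times> {y1<..<y2})" by (intro open_Times) auto
    have "{x1<..<x2} \<times> {y1<..<y2} \<subseteq> {x1..x2} \<times> {y1..y2}" by auto
    then show "{x1<..<x2} \<times> {y1<..<y2} \<subseteq> D" using D by (rule subset_trans)
  qed (use that in auto)
  have "(\<Sum>j\<le>d. (c' k j - c k j - shifted_power d x0 k * (c' d j - c d j)) * y ^ j) = 0" if y: "y \<in> {y1<..<y2}" for y
  proof -
    define L where "L = poly_of d (\<lambda>i. \<Sum>j\<le>d. c i j * y ^ j)"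
    define R where "R = poly_of d (\<lambda>i. \<Sum>j\<le>d. c' i j * y ^ j)"
    have dL: "g i (x0, y) = poly ((pderiv ^^ i) L) x0" if "i \<le> d - 1" for i
    proof (rule derivatives_agree_with_poly[of "{x1<..x0}" "\<lambda>i t. g i (t, y)" L "d - 1"])
      show "{x1<..x0} \<noteq> {a}" for a using infinite_Ioc[OF x(1)] by (metis finite.simps)
      show "g 0 (t, y) = poly L t" if "t \<in> {x1<..x0}" for t
        unfolding L_def eval_coeffs_poly[symmetric] g(1) using left that y by simp
      show "((\<lambda>t. g i (t, y)) has_real_derivative g (Suc i) (t, y)) (at t)"
        if "i < d - 1" "t \<in> {x1<..x0}" for i t using g(2) int that x y by simp
    qed (use x that in auto)
    have dR: "g i (x0, y) = poly ((pderiv ^^ i) R) x0" if "i \<le> d - 1" for i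
    proof (rule derivatives_agree_with_poly[of "{x0..<x2}" "\<lambda>i t. g i (t, y)" R "d - 1"])
      show "{x0..<x2} \<noteq> {a}" for a using infinite_Ico[OF x(2)] by (metis finite.simps)
      show "g 0 (t, y) = poly R t" if "t \<in> {x0..<x2}" for t
        unfolding R_def eval_coeffs_poly[symmetric] g(1) using right that y by simp
      show "((\<lambda>t. g i (t, y)) has_real_derivative g (Suc i) (t, y)) (at t)"
        if "i < d - 1" "t \<in> {x0..<x2}" for i t using g(2) int that x y by simp
    qed (use x that in auto)
    have sub: "R - L = R + smult (-1) L" by simp
    have "[:- x0, 1:] ^ d dvd R - L"
    proof (rule power_dvd_of_higher_pderiv_zero)
      fix i assume "i < d"
      then have "i \<le> d - 1" using d by simp
      then show "poly ((pderiv ^^ i) (R - L)) x0 = 0"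
        using dL[of i] dR[of i] unfolding sub higher_pderiv_add higher_pderiv_smult by simp
    qed
    moreover have "degree (R - L) \<le> d"
      by (rule degree_diff_le) (simp_all add: L_def R_def degree_poly_of)
    ultimately have "coeff (R - L) k = shifted_power d x0 k * coeff (R - L) d"
      by (intro coeff_of_power_multiple)
    then have e: "(\<Sum>j\<le>d. c' k j * y ^ j) - (\<Sum>j\<le>d. c k j * y ^ j) =
        shifted_power d x0 k * ((\<Sum>j\<le>d. c' d j * y ^ j) - (\<Sum>j\<le>d. c d j * y ^ j))"
      using k(1) unfolding L_def R_def coeff_diff by (simp add: coeff_poly_of)
    have "(\<Sum>j\<le>d. (c' k j - c k j - shifted_power d x0 k * (c' d j - c d j)) * y ^ j) =
      ((\<Sum>j\<le>d. c' k j * y ^ j) - (\<Sum>j\<le>d. c k j * y ^ j)) -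
      shifted_power d x0 k * ((\<Sum>j\<le>d. c' d j * y ^ j) - (\<Sum>j\<le>d. c d j * y ^ j))"
      by (simp add: sum_subtractf[symmetric] sum_distrib_left algebra_simps)
    then show ?thesis using e by simp
  qed
  from coeffs_zero[of "{y1<..<y2}", OF _ this k(2)] show ?thesis using infinite_Ioo[OF y] by simp
qed

text \<open>The \<open>m\<close>-th partial derivative in the first variable.\<close>

definition eval_dx :: "nat \<Rightarrow> nat \<Rightarrow> (nat \<Rightarrow> nat \<Rightarrow> real) \<Rightarrow> point \<Rightarrow> real" where
  "eval_dx d m c p = poly ((pderiv ^^ m) (poly_of d (\<lambda>i. \<Sum>j\<le>d. c i j * snd p ^ j))) (fst p)"

lemma higher_pderiv_poly_of:
  "poly ((pderiv ^^ m) (poly_of d e)) x = (\<Sum>i\<le>d. e i * poly ((pderiv ^^ m) (monom 1 i)) x)"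
proof -
  have "monom (e i) i = smult (e i) (monom 1 i)" for i by (simp add: smult_monom)
  then show ?thesis unfolding poly_of_def higher_pderiv_sum poly_sum
    by (simp add: higher_pderiv_smult)
qed

lemma eval_dx_0: "eval_dx d 0 c p = eval_coeffs d c p"
  unfolding eval_dx_def by (metis eval_coeffs_poly funpow_0 prod.collapse)

lemma continuous_eval_dx: "continuous_on A (eval_dx d m c)"
  unfolding eval_dx_def higher_pderiv_poly_of by (intro continuous_intros)

lemma eval_dx_derivative:
  "((\<lambda>t. eval_dx d m c (t, y)) has_real_derivative eval_dx d (Suc m) c (x, y)) (at x within S)"
  unfolding eval_dx_def fst_conv snd_conv funpow.simps comp_apply
  by (rule has_field_derivative_at_within[OF poly_DERIV])

lemma eval_dx_jump:
  assumes "m < d" "\<And>k l. k \<le> d \<Longrightarrow> l \<le> d \<Longrightarrow>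
    c k l - c' k l = shifted_power d x k * q l + q' k * shifted_power d y l"
  shows "eval_dx d m c (x, y) = eval_dx d m c' (x, y)"
proof -
  let ?D = "\<lambda>i. poly ((pderiv ^^ m) (monom 1 i)) x"
  have X: "(\<Sum>i\<le>d. shifted_power d x i * ?D i) = 0"
    unfolding higher_pderiv_poly_of[symmetric] poly_of_shifted_power
    by (rule higher_pderiv_zero_at_root[OF assms(1)])
  have Y: "(\<Sum>j\<le>d. shifted_power d y j * y ^ j) = 0" using assms(1) by (simp add: sum_shifted_power)
  have "eval_dx d m c (x, y) - eval_dx d m c' (x, y) =
      (\<Sum>i\<le>d. (\<Sum>j\<le>d. (c i j - c' i j) * y ^ j) * ?D i)"
    unfolding eval_dx_def higher_pderiv_poly_of fst_conv snd_conv
    by (simp add: sum_subtractf algebra_simps)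
  also have "\<dots> = (\<Sum>i\<le>d. (shifted_power d x i * (\<Sum>j\<le>d. q j * y ^ j) +
      q' i * (\<Sum>j\<le>d. shifted_power d y j * y ^ j)) * ?D i)"
  proof (rule sum.cong[OF refl])
    fix i assume i: "i \<in> {..d}"
    have "(\<Sum>j\<le>d. (c i j - c' i j) * y ^ j) =
      (\<Sum>j\<le>d. (shifted_power d x i * q j + q' i * shifted_power d y j) * y ^ j)"
      using assms(2) i by simp
    also have "\<dots> = shifted_power d x i * (\<Sum>j\<le>d. q j * y ^ j) +
      q' i * (\<Sum>j\<le>d. shifted_power d y j * y ^ j)"
      by (simp add: sum.distrib sum_distrib_left algebra_simps)
    finally show "(\<Sum>j\<le>d. (c i j - c' i j) * y ^ j) * ?D i = (shifted_power d x i * (\<Sum>j\<le>d. q j * y ^ j) +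
      q' i * (\<Sum>j\<le>d. shifted_power d y j * y ^ j)) * ?D i" by simp
  qed
  also have "\<dots> = (\<Sum>j\<le>d. q j * y ^ j) * (\<Sum>i\<le>d. shifted_power d x i * ?D i)"
    unfolding Y by (simp add: sum_distrib_left algebra_simps)
  finally show ?thesis unfolding X by simp
qed

lemma smooth_y_iff: "smooth_y k D s \<longleftrightarrow> smooth_x k (flip D) (s \<circ> prod.swap)"
proof -
  have sw: "continuous_on (flip A) (h \<circ> prod.swap)" if "continuous_on A h" for A :: "point set" and h :: "point \<Rightarrow> real"
    using that by (intro continuous_on_compose continuous_intros) simp
  show ?thesis
  proof
    assume "smooth_y k D s"
    then obtain g where g: "g 0 = s" "\<And>i. i \<le> k \<Longrightarrow> continuous_on D (g i)"
      "\<And>i x y. i < k \<Longrightarrow> (x, y) \<in> interior D \<Longrightarrow> ((\<lambda>t. g i (x, t)) has_real_derivative g (Suc i) (x, y)) (at y)"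
      unfolding smooth_y_def by metis
    show "smooth_x k (flip D) (s \<circ> prod.swap)" unfolding smooth_x_def
      by (intro exI[of _ "\<lambda>i. g i \<circ> prod.swap"] conjI allI impI sw)
        (use g in \<open>simp_all add: interior_flip\<close>)
  next
    assume "smooth_x k (flip D) (s \<circ> prod.swap)"
    then obtain g where g: "g 0 = s \<circ> prod.swap" "\<And>i. i \<le> k \<Longrightarrow> continuous_on (flip D) (g i)"
      "\<And>i x y. i < k \<Longrightarrow> (x, y) \<in> interior (flip D) \<Longrightarrow> ((\<lambda>t. g i (t, y)) has_real_derivative g (Suc i) (x, y)) (at x)"
      unfolding smooth_x_def by metis
    have c: "continuous_on D (g i \<circ> prod.swap)" if "i \<le> k" for i using sw[OF g(2)[OF that]] by simp
    show "smooth_y k D s" unfolding smooth_y_def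
      by (intro exI[of _ "\<lambda>i. g i \<circ> prod.swap"] conjI allI impI c)
        (use g in \<open>simp_all add: interior_flip comp_assoc fun_eq_iff\<close>)
  qed
qed

lemma eval_coeffs_swap: "eval_coeffs d (\<lambda>k l. c l k) (y, x) = eval_coeffs d c (x, y)"
  unfolding eval_coeffs_def by (subst sum.swap) (simp add: mult.commute mult.left_commute)

lemma smooth_y_jump:
  assumes d: "d \<ge> 1" and s: "smooth_y (d - 1) D s"
    and x: "x1 < x2" and y: "y1 < y0" "y0 < y2"
    and D: "{x1..x2} \<times> {y1..y2} \<subseteq> D"
    and lower: "\<And>x y. x1 \<le> x \<Longrightarrow> x \<le> x2 \<Longrightarrow> y1 \<le> y \<Longrightarrow> y \<le> y0 \<Longrightarrow> s (x, y) = eval_coeffs d c (x, y)"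
    and upper: "\<And>x y. x1 \<le> x \<Longrightarrow> x \<le> x2 \<Longrightarrow> y0 \<le> y \<Longrightarrow> y \<le> y2 \<Longrightarrow> s (x, y) = eval_coeffs d c' (x, y)"
    and k: "k \<le> d" "l \<le> d"
  shows "c' k l - c k l = (c' k d - c k d) * shifted_power d y0 l"
proof -
  have "flip ({x1..x2} \<times> {y1..y2}) \<subseteq> flip D" using D by (rule image_mono)
  then have D': "{y1..y2} \<times> {x1..x2} \<subseteq> flip D" unfolding flip_Times .
  have L: "(s \<circ> prod.swap) (x, y) = eval_coeffs d (\<lambda>k l. c l k) (x, y)"
    if "y1 \<le> x" "x \<le> y0" "x1 \<le> y" "y \<le> x2" for x y
    unfolding eval_coeffs_swap[of d c x y] comp_apply swap_simp by (rule lower[OF that(3,4,1,2)])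
  have R: "(s \<circ> prod.swap) (x, y) = eval_coeffs d (\<lambda>k l. c' l k) (x, y)"
    if "y0 \<le> x" "x \<le> y2" "x1 \<le> y" "y \<le> x2" for x y
    unfolding eval_coeffs_swap[of d c' x y] comp_apply swap_simp by (rule upper[OF that(3,4,1,2)])
  have "c' k l - c k l = shifted_power d y0 l * (c' k d - c k d)"
    by (rule smooth_x_jump[where c = "\<lambda>k l. c l k" and c' = "\<lambda>k l. c' l k",
        OF d s[unfolded smooth_y_iff] y x D' L R k(2) k(1)])
  then show ?thesis by (simp add: mult.commute)
qed

context grid_mesh
begin

text \<open>Terms \<open>(x - x0) ^ d q(y)\<close> and \<open>q'(x) (y - y0) ^ d\<close> have vanishing derivatives of order less than
  \<open>d\<close> in the direction of \<open>x\<close> at \<open>(x0, y0)\<close>. So the derivatives of the pieces fit together, and at an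
  interior point the one-sided derivatives from both sides agree.\<close>

lemma smooth_x_glue:
  assumes d: "d \<ge> 1"
    and s: "\<And>f p. f \<in> cells M \<Longrightarrow> p \<in> f \<Longrightarrow> s p = eval_coeffs d (c f) p"
    and out: "\<And>p. p \<notin> mesh_domain M \<Longrightarrow> s p = 0"
    and jump: "\<And>f f' p. f \<in> cells M \<Longrightarrow> f' \<in> cells M \<Longrightarrow> p \<in> f \<Longrightarrow> p \<in> f' \<Longrightarrow>
      \<exists>q q'. \<forall>k\<le>d. \<forall>l\<le>d. c f k l - c f' k l =
        shifted_power d (fst p) k * q l + q' k * shifted_power d (snd p) l"
  shows "smooth_x (d - 1) (mesh_domain M) s"
proof -
  define G where "G = (\<lambda>m p. if p \<in> mesh_domain M then eval_dx d m (c (SOME f. f \<in> cells M \<and> p \<in> f)) p else 0)"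
  have G: "G m p = eval_dx d m (c f) p" if f: "f \<in> cells M" "p \<in> f" and m: "m < d" for m f p
  proof -
    define h where "h = (SOME f. f \<in> cells M \<and> p \<in> f)"
    have "\<exists>f. f \<in> cells M \<and> p \<in> f" using f by metis
    then have h: "h \<in> cells M \<and> p \<in> h" unfolding h_def by (rule someI_ex)
    have "p \<in> mesh_domain M" using f unfolding mesh_domain_def by auto
    then have "G m p = eval_dx d m (c h) p" unfolding G_def h_def by simp
    also have "\<dots> = eval_dx d m (c f) p"
    proof -
      obtain q q' where "\<forall>k\<le>d. \<forall>l\<le>d. c h k l - c f k l =
        shifted_power d (fst p) k * q l + q' k * shifted_power d (snd p) l"
        using jump[of h f p] h f by metis
      then have "eval_dx d m (c h) (fst p, snd p) = eval_dx d m (c f) (fst p, snd p)"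
        using eval_dx_jump[OF m, of "c h" "c f" "fst p" q q' "snd p"] by simp
      then show ?thesis by simp
    qed
    finally show ?thesis .
  qed
  have G0: "G 0 = s"
  proof
    fix p
    show "G 0 p = s p"
    proof (cases "p \<in> mesh_domain M")
      case True
      then obtain f where f: "f \<in> cells M" "p \<in> f" unfolding mesh_domain_def by auto
      then show ?thesis using G[OF f] d s[OF f] by (simp add: eval_dx_0)
    qed (simp add: G_def out)
  qed
  have cont: "continuous_on (mesh_domain M) (G m)" if m: "m < d" for m
  proof -
    have "continuous_on (\<Union>f\<in>cells M. f) (G m)"
    proof (rule continuous_on_closed_Union[OF finite_cells])
      fix f assume f: "f \<in> cells M"
      obtain a b e h where "f = {xs a..xs b} \<times> {ys e..ys h}" using cells_on_grid[OF f] by auto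
      then show "closed f" by (auto intro!: closed_Times)
      show "continuous_on f (G m)"
        using continuous_eval_dx[of f d m "c f"] G[OF f _ m] by (simp cong: continuous_on_cong)
    qed
    then show ?thesis unfolding mesh_domain_def by simp
  qed
  have unit: "((\<lambda>t. G m (t, y)) has_real_derivative G (Suc m) (x, y)) (at x within {xs i..xs (i + 1)})"
    if xy: "(x, y) \<in> interior (mesh_domain M)" and i: "xs i \<le> x" "x \<le> xs (i + 1)" and m: "Suc m < d" for m x y i
  proof -
    interpret T: grid_mesh "transpose_mesh M" ys xs by (rule transposed)
    obtain j where j: "ys j \<le> y" "y < ys (j + 1)" using ys by (auto simp: grid_line_def)
    have "(x, y) \<in> gc (i, j)" using i j by (simp add: gc_def)
    then have ins: "(i, j) \<in> inside" using xy unfolding interior_domain_iff by simp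
    define f where "f = own (i, j)"
    have f: "f \<in> cells M" "gc (i, j) \<subseteq> f" unfolding f_def using own_cell[OF ins] by simp_all
    have tf: "(t, y) \<in> f" if "t \<in> {xs i..xs (i + 1)}" for t
    proof -
      have "(t, y) \<in> gc (i, j)" using that j by (simp add: gc_def)
      then show ?thesis by (rule subsetD[OF f(2)])
    qed
    have "((\<lambda>t. eval_dx d m (c f) (t, y)) has_real_derivative eval_dx d (Suc m) (c f) (x, y))
        (at x within {xs i..xs (i + 1)})"
      by (rule eval_dx_derivative)
    moreover have "G (Suc m) (x, y) = eval_dx d (Suc m) (c f) (x, y)" using G[OF f(1) tf] i m by simp
    moreover have "G m (t, y) = eval_dx d m (c f) (t, y)" if "t \<in> {xs i..xs (i + 1)}" for t
      using G[OF f(1) tf[OF that]] m by simp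
    ultimately show ?thesis
      using has_vector_derivative_transform[of x "{xs i..xs (i + 1)}" "\<lambda>t. G m (t, y)"
          "\<lambda>t. eval_dx d m (c f) (t, y)" "G (Suc m) (x, y)"] i
      by (simp add: has_real_derivative_iff_has_vector_derivative)
  qed
  have deriv: "((\<lambda>t. G m (t, y)) has_real_derivative G (Suc m) (x, y)) (at x)"
    if m: "m < d - 1" and xy: "(x, y) \<in> interior (mesh_domain M)" for m x y
  proof -
    have m': "Suc m < d" using m by simp
    obtain i where i: "xs i \<le> x" "x < xs (i + 1)" using xs by (auto simp: grid_line_def)
    show ?thesis
    proof (cases "x = xs i")
      case False
      have "x \<in> interior {xs i..xs (i + 1)}" using i False by simp
      then have "at x within {xs i..xs (i + 1)} = at x" by (rule at_within_interior)
      then show ?thesis using unit[OF xy _ _ m', of i] i by simp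
    next
      case True
      have "((\<lambda>t. G m (t, y)) has_real_derivative G (Suc m) (x, y)) (at x within {xs (i - 1)..xs (i - 1 + 1)})"
        using unit[OF xy _ _ m', of "i - 1"] True by simp
      moreover have "((\<lambda>t. G m (t, y)) has_real_derivative G (Suc m) (x, y)) (at x within {xs i..xs (i + 1)})"
        using unit[OF xy _ _ m', of i] i by simp
      ultimately have "((\<lambda>t. G m (t, y)) has_real_derivative G (Suc m) (x, y))
          (at x within {xs (i - 1)..xs (i - 1 + 1)} \<union> {xs i..xs (i + 1)})"
        unfolding has_field_derivative_iff by (rule Lim_Un)
      moreover have "{xs (i - 1)..xs (i - 1 + 1)} \<union> {xs i..xs (i + 1)} = {xs (i - 1)..xs (i + 1)}"
        by (simp add: ivl_disj_un_two_touch(4))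
      moreover have "x \<in> interior {xs (i - 1)..xs (i + 1)}" using True by simp
      then have "at x within {xs (i - 1)..xs (i + 1)} = at x" by (rule at_within_interior)
      ultimately show ?thesis by simp
    qed
  qed
  show ?thesis unfolding smooth_x_def
    using G0 cont deriv d by (intro exI[of _ G]) (auto simp: less_eq_Suc_le)
qed


section \<open>Connectedness of the grid cells\<close>

lemma mid_in_interior:
  assumes "Q \<in> inside"
  obtains p where "p \<in> gc Q" "p \<in> interior (mesh_domain M)"
proof -
  interpret T: grid_mesh "transpose_mesh M" ys xs by (rule transposed)
  obtain i j where Q: "Q = (i, j)" by fastforce
  obtain x where x: "xs i < x" "x < xs (i + 1)" by (rule mid_in_unit)
  obtain y where y: "ys j < y" "y < ys (j + 1)" by (rule T.mid_in_unit)
  let ?U = "{xs i<..<xs (i + 1)} \<times> {ys j<..<ys (j + 1)}"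
  have "?U \<subseteq> gc Q" unfolding Q gc_def by auto
  then have "?U \<subseteq> mesh_domain M" using gc_subset_domain[OF assms] by (rule subset_trans)
  moreover have "open ?U" by (intro open_Times) auto
  moreover have "(x, y) \<in> ?U" using x y by simp
  ultimately have "(x, y) \<in> interior (mesh_domain M)" by (metis interiorI)
  moreover have "(x, y) \<in> gc Q" using x y unfolding Q gc_def by simp
  ultimately show ?thesis using that by metis
qed

text \<open>The cells with the same value of \<open>\<phi>\<close> as \<open>Q\<close> and the other ones would split the interior of the
  domain into two relatively closed sets: an interior point common to two grid cells lies on a common
  edge, or all four cells around it belong to the domain and are linked through edges.\<close>

lemma edge_connected:
  assumes v: "\<And>i j. (i, j) \<in> inside \<Longrightarrow> (i - 1, j) \<in> inside \<Longrightarrow> \<phi> (i, j) = \<phi> (i - 1, j)"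
    and h: "\<And>i j. (i, j) \<in> inside \<Longrightarrow> (i, j - 1) \<in> inside \<Longrightarrow> \<phi> (i, j) = \<phi> (i, j - 1)"
    and Q: "Q \<in> inside" "Q' \<in> inside"
  shows "\<phi> Q = \<phi> Q'"
proof (rule ccontr)
  assume ne: "\<phi> Q \<noteq> \<phi> Q'"
  define U where "U = {R \<in> inside. \<phi> R = \<phi> Q}"
  define W where "W = {R \<in> inside. \<phi> R \<noteq> \<phi> Q}"
  let ?S = "interior (mesh_domain M)"
  have fin: "finite U" "finite W" using finite_inside unfolding U_def W_def by simp_all
  have "closed (\<Union>(gc ` U))" "closed (\<Union>(gc ` W))"
    using fin by (intro closed_Union; auto simp: gc_def intro!: closed_Times)+
  moreover have "?S \<subseteq> \<Union>(gc ` U) \<union> \<Union>(gc ` W)"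
  proof
    fix p assume "p \<in> ?S"
    then have "p \<in> mesh_domain M" using interior_subset by (rule_tac subsetD)
    then have "p \<in> \<Union>(gc ` inside)" unfolding domain_eq .
    then show "p \<in> \<Union>(gc ` U) \<union> \<Union>(gc ` W)" unfolding U_def W_def by auto
  qed
  moreover have "\<Union>(gc ` U) \<inter> \<Union>(gc ` W) \<inter> ?S = {}"
  proof (rule ccontr)
    assume "\<Union>(gc ` U) \<inter> \<Union>(gc ` W) \<inter> ?S \<noteq> {}"
    then obtain p R R' where p: "R \<in> U" "R' \<in> W" "p \<in> gc R" "p \<in> gc R'" "p \<in> ?S" by auto
    have ins: "R \<in> inside" "R' \<in> inside" and ne: "\<phi> R \<noteq> \<phi> R'" using p unfolding U_def W_def by auto
    obtain i j where R: "R = (i, j)" by fastforce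
    obtain i' j' where R': "R' = (i', j')" by fastforce
    obtain x y where xy: "p = (x, y)" by fastforce
    consider "i' = i" "j' = j" | "i' = i" "j' = j - 1" | "i' = i" "j = j' - 1"
      | "i' = i - 1" "j' = j" | "i = i' - 1" "j' = j"
      | w where "corner w (i, j)" "corner w (i', j')" "x = xs (fst w)" "y = ys (snd w)"
      using touching_cells[of x y i j i' j'] p(3,4) unfolding R R' xy by fastforce
    then show False
    proof cases
      case 6
      obtain a b where w: "w = (a, b)" by fastforce
      have "(xs a, ys b) \<in> ?S" using p(5) 6(3,4) unfolding xy w by simp
      then have four: "(a, b) \<in> inside" "(a - 1, b) \<in> inside" "(a - 1, b - 1) \<in> inside" "(a, b - 1) \<in> inside"
        unfolding interior_vertex_iff by simp_all
      have eq: "\<phi> (a - 1, b) = \<phi> (a, b)" "\<phi> (a, b - 1) = \<phi> (a, b)" "\<phi> (a - 1, b - 1) = \<phi> (a, b)"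
        using v[OF four(1,2)] h[OF four(1,4)] h[OF four(2,3)] by simp_all
      have "\<phi> S = \<phi> (a, b)" if "corner w S" for S
      proof -
        have "S = (a, b) \<or> S = (a - 1, b) \<or> S = (a - 1, b - 1) \<or> S = (a, b - 1)"
          using that unfolding corner_def w by (cases S) auto
        then show ?thesis using eq by auto
      qed
      then show False using 6(1,2) ne unfolding R R' by metis
    qed (use v h ins ne in \<open>auto simp: R R'\<close>)
  qed
  moreover have "\<Union>(gc ` U) \<inter> ?S \<noteq> {}"
  proof -
    have "Q \<in> U" using Q(1) unfolding U_def by simp
    then show ?thesis using mid_in_interior[OF Q(1)] by auto
  qed
  moreover have "\<Union>(gc ` W) \<inter> ?S \<noteq> {}"
  proof -
    have "Q' \<in> W" using Q(2) ne unfolding W_def by simp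
    then show ?thesis using mid_in_interior[OF Q(2)] by auto
  qed
  moreover have "connected ?S" using mesh unfolding t_mesh_def by simp
  ultimately show False unfolding connected_closed by metis
qed

text \<open>If no edge at the corner \<open>w\<close> linked \<open>Q\<close> to other cells, the local potential that is 1 on \<open>Q\<close> at
  \<open>w\<close> and 0 otherwise would have no jump across edges. Its global potential would be constant by
  connectedness, contrary to the jump from \<open>Q\<close> to \<open>Q'\<close> at \<open>w\<close>.\<close>

lemma not_isolated_at_corner:
  assumes Q: "Q \<in> inside" "Q' \<in> inside" "Q \<noteq> Q'" "corner w Q" "corner w Q'"
    and h: "\<And>i j. (i, j) \<in> inside \<Longrightarrow> (i, j - 1) \<in> inside \<Longrightarrow> w = (i, j) \<or> w = (i + 1, j) \<Longrightarrow>
      Q \<noteq> (i, j) \<and> Q \<noteq> (i, j - 1)"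
    and v: "\<And>i j. (i, j) \<in> inside \<Longrightarrow> (i - 1, j) \<in> inside \<Longrightarrow> w = (i, j) \<or> w = (i, j + 1) \<Longrightarrow>
      Q \<noteq> (i, j) \<and> Q \<noteq> (i - 1, j)"
  shows False
proof -
  define n :: "int \<times> int \<Rightarrow> int \<times> int \<Rightarrow> int" where "n = (\<lambda>u R. if u = w \<and> R = Q then 1 else 0)"
  have nh: "n (i, j) (i, j) = 0" "n (i, j) (i, j - 1) = 0" "n (i + 1, j) (i, j) = 0" "n (i + 1, j) (i, j - 1) = 0"
    if "(i, j) \<in> inside" "(i, j - 1) \<in> inside" for i j
    using h[OF that] unfolding n_def by auto
  have nv: "n (i, j) (i, j) = 0" "n (i, j) (i - 1, j) = 0" "n (i, j + 1) (i, j) = 0" "n (i, j + 1) (i - 1, j) = 0"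
    if "(i, j) \<in> inside" "(i - 1, j) \<in> inside" for i j
    using v[OF that] unfolding n_def by auto
  obtain k :: "int \<times> int \<Rightarrow> int" where k: "\<And>u R R'. R \<in> inside \<Longrightarrow> R' \<in> inside \<Longrightarrow> corner u R \<Longrightarrow>
      corner u R' \<Longrightarrow> k R - k R' = n u R - n u R'"
  proof -
    have "\<exists>k :: int \<times> int \<Rightarrow> int. \<forall>v Q Q'. Q \<in> inside \<longrightarrow> Q' \<in> inside \<longrightarrow> corner v Q \<longrightarrow> corner v Q' \<longrightarrow>
        k Q - k Q' = n v Q - n v Q'"
      by (rule integer_potential) (simp_all add: nh nv)
    then show ?thesis using that by metis
  qed
  have "k Q = k Q'"
  proof (rule edge_connected[OF _ _ Q(1,2)])
    fix i j assume a: "(i, j) \<in> inside" "(i - 1, j) \<in> inside"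
    show "k (i, j) = k (i - 1, j)" using k[OF a, of "(i, j)"] nv[OF a] by (simp add: corner_def)
  next
    fix i j assume a: "(i, j) \<in> inside" "(i, j - 1) \<in> inside"
    show "k (i, j) = k (i, j - 1)" using k[OF a, of "(i, j)"] nh[OF a] by (simp add: corner_def)
  qed
  moreover have "k Q - k Q' = 1" using k[OF Q(1,2,4,5)] Q(3) unfolding n_def by simp
  ultimately show False by simp
qed

text \<open>The domain has no pinch points.\<close>

lemma diagonal_neighbours:
  shows "(i, j) \<in> inside \<Longrightarrow> (i - 1, j - 1) \<in> inside \<Longrightarrow> (i - 1, j) \<in> inside \<or> (i, j - 1) \<in> inside"
    and "(i - 1, j) \<in> inside \<Longrightarrow> (i, j - 1) \<in> inside \<Longrightarrow> (i, j) \<in> inside \<or> (i - 1, j - 1) \<in> inside"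
proof -
  assume a: "(i, j) \<in> inside" "(i - 1, j - 1) \<in> inside"
  show "(i - 1, j) \<in> inside \<or> (i, j - 1) \<in> inside"
  proof (rule ccontr)
    assume n: "\<not> ((i - 1, j) \<in> inside \<or> (i, j - 1) \<in> inside)"
    have h: "(i, j) \<noteq> (x, y) \<and> (i, j) \<noteq> (x, y - 1)"
      if "(x, y) \<in> inside" "(x, y - 1) \<in> inside" "(i, j) = (x, y) \<or> (i, j) = (x + 1, y)" for x y
      using that n by auto
    have v: "(i, j) \<noteq> (x, y) \<and> (i, j) \<noteq> (x - 1, y)"
      if "(x, y) \<in> inside" "(x - 1, y) \<in> inside" "(i, j) = (x, y) \<or> (i, j) = (x, y + 1)" for x y
      using that n by auto
    show False by (rule not_isolated_at_corner[OF a, of "(i, j)"]) (use h v in \<open>simp_all add: corner_def\<close>)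
  qed
next
  assume a: "(i - 1, j) \<in> inside" "(i, j - 1) \<in> inside"
  show "(i, j) \<in> inside \<or> (i - 1, j - 1) \<in> inside"
  proof (rule ccontr)
    assume n: "\<not> ((i, j) \<in> inside \<or> (i - 1, j - 1) \<in> inside)"
    have h: "(i - 1, j) \<noteq> (x, y) \<and> (i - 1, j) \<noteq> (x, y - 1)"
      if "(x, y) \<in> inside" "(x, y - 1) \<in> inside" "(i, j) = (x, y) \<or> (i, j) = (x + 1, y)" for x y
      using that n by auto
    have v: "(i - 1, j) \<noteq> (x, y) \<and> (i - 1, j) \<noteq> (x - 1, y)"
      if "(x, y) \<in> inside" "(x - 1, y) \<in> inside" "(i, j) = (x, y) \<or> (i, j) = (x, y + 1)" for x y
      using that n by auto
    show False by (rule not_isolated_at_corner[OF a, of "(i, j)"]) (use h v in \<open>simp_all add: corner_def\<close>)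
  qed
qed

section \<open>Splines as families of coefficients\<close>

text \<open>The cofactor of an edge need not be mentioned: the factor \<open>(x - xs i) ^ d\<close> is monic, so the
  coefficients of the jump at the power \<open>d\<close> of \<open>x\<close> are those of the cofactor.\<close>

definition coeff_space :: "nat \<Rightarrow> (point set \<times> nat \<times> nat \<Rightarrow> real) set" where
  "coeff_space d = {c. (\<forall>f k l. f \<notin> cells M \<or> k > d \<or> l > d \<longrightarrow> c (f, k, l) = 0) \<and>
    (\<forall>i j k l. (i, j) \<in> inside \<longrightarrow> (i - 1, j) \<in> inside \<longrightarrow>
      c (own (i, j), k, l) - c (own (i - 1, j), k, l) =
      shifted_power d (xs i) k * (c (own (i, j), d, l) - c (own (i - 1, j), d, l))) \<and>
    (\<forall>i j k l. (i, j) \<in> inside \<longrightarrow> (i, j - 1) \<in> inside \<longrightarrow>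
      c (own (i, j), k, l) - c (own (i, j - 1), k, l) =
      (c (own (i, j), k, d) - c (own (i, j - 1), k, d)) * shifted_power d (ys j) l)}"

lemma coeff_space_zero: "c \<in> coeff_space d \<Longrightarrow> f \<notin> cells M \<or> k > d \<or> l > d \<Longrightarrow> c (f, k, l) = 0"
  unfolding coeff_space_def by blast

lemma coeff_space_v: "c \<in> coeff_space d \<Longrightarrow> (i, j) \<in> inside \<Longrightarrow> (i - 1, j) \<in> inside \<Longrightarrow>
      c (own (i, j), k, l) - c (own (i - 1, j), k, l) =
      shifted_power d (xs i) k * (c (own (i, j), d, l) - c (own (i - 1, j), d, l))"
  unfolding coeff_space_def by blast

lemma coeff_space_h: "c \<in> coeff_space d \<Longrightarrow> (i, j) \<in> inside \<Longrightarrow> (i, j - 1) \<in> inside \<Longrightarrow>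
      c (own (i, j), k, l) - c (own (i, j - 1), k, l) =
      (c (own (i, j), k, d) - c (own (i, j - 1), k, d)) * shifted_power d (ys j) l"
  unfolding coeff_space_def by blast

lemma subspace_coeff_space: "fun_vs.subspace (coeff_space d)"
proof (rule fun_vs.subspaceI)
  show "0 \<in> coeff_space d" unfolding coeff_space_def by simp
next
  fix a b assume ab: "a \<in> coeff_space d" "b \<in> coeff_space d"
  have v: "(a + b) (own (i, j), k, l) - (a + b) (own (i - 1, j), k, l) =
      shifted_power d (xs i) k * ((a + b) (own (i, j), d, l) - (a + b) (own (i - 1, j), d, l))"
    if "(i, j) \<in> inside" "(i - 1, j) \<in> inside" for i j k l
    using coeff_space_v[OF ab(1) that, of k l] coeff_space_v[OF ab(2) that, of k l]
    by (simp add: ring_distribs)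
  have h: "(a + b) (own (i, j), k, l) - (a + b) (own (i, j - 1), k, l) =
      ((a + b) (own (i, j), k, d) - (a + b) (own (i, j - 1), k, d)) * shifted_power d (ys j) l"
    if "(i, j) \<in> inside" "(i, j - 1) \<in> inside" for i j k l
    using coeff_space_h[OF ab(1) that, of k l] coeff_space_h[OF ab(2) that, of k l]
    by (simp add: ring_distribs)
  have "(a + b) (f, k, l) = 0" if "f \<notin> cells M \<or> k > d \<or> l > d" for f k l
    using coeff_space_zero[OF ab(1) that] coeff_space_zero[OF ab(2) that] by simp
  then show "a + b \<in> coeff_space d" unfolding coeff_space_def using v h by blast
next
  fix r a assume a: "a \<in> coeff_space d"
  have v: "fun_scale r a (own (i, j), k, l) - fun_scale r a (own (i - 1, j), k, l) =
      shifted_power d (xs i) k * (fun_scale r a (own (i, j), d, l) - fun_scale r a (own (i - 1, j), d, l))"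
    if "(i, j) \<in> inside" "(i - 1, j) \<in> inside" for i j k l
    using arg_cong[OF coeff_space_v[OF a that, of k l], of "\<lambda>t. r * t"] unfolding fun_scale_def
    by (simp add: algebra_simps)
  have h: "fun_scale r a (own (i, j), k, l) - fun_scale r a (own (i, j - 1), k, l) =
      (fun_scale r a (own (i, j), k, d) - fun_scale r a (own (i, j - 1), k, d)) * shifted_power d (ys j) l"
    if "(i, j) \<in> inside" "(i, j - 1) \<in> inside" for i j k l
    using arg_cong[OF coeff_space_h[OF a that, of k l], of "\<lambda>t. r * t"] unfolding fun_scale_def
    by (simp add: algebra_simps)
  have "fun_scale r a (f, k, l) = 0" if "f \<notin> cells M \<or> k > d \<or> l > d" for f k l
    using coeff_space_zero[OF a that] unfolding fun_scale_def by simp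
  then show "fun_scale r a \<in> coeff_space d" unfolding coeff_space_def using v h by blast
qed

text \<open>Cells that meet in a point are linked by edges through this point, as there are no pinch points; the
  jumps across these edges add up.\<close>

lemma jump_form:
  assumes c: "c \<in> coeff_space d" and f: "f \<in> cells M" "f' \<in> cells M" "p \<in> f" "p \<in> f'"
  shows "\<exists>q q'. \<forall>k\<le>d. \<forall>l\<le>d. c (f, k, l) - c (f', k, l) =
        shifted_power d (fst p) k * q l + q' k * shifted_power d (snd p) l"
proof -
  obtain Q where Q: "Q \<in> inside" "own Q = f" "p \<in> gc Q" using cell_covered[OF f(1,3)] by metis
  obtain Q' where Q': "Q' \<in> inside" "own Q' = f'" "p \<in> gc Q'" using cell_covered[OF f(2,4)] by metis
  obtain i j where R: "Q = (i, j)" by fastforce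
  obtain i' j' where R': "Q' = (i', j')" by fastforce
  obtain x y where xy: "p = (x, y)" by fastforce
  define F where "F = (\<lambda>A B. \<exists>q q'. \<forall>k l. c (own A, k, l) - c (own B, k, l) =
        shifted_power d x k * q l + q' k * shifted_power d y l)"
  have F_refl: "F A A" for A
    unfolding F_def by (intro exI[of _ "\<lambda>_. 0"]) simp
  have F_sym: "F B A" if AB: "F A B" for A B
  proof -
    obtain q q' where q: "\<And>k l. c (own A, k, l) - c (own B, k, l) =
        shifted_power d x k * q l + q' k * shifted_power d y l" using AB unfolding F_def by metis
    have "c (own B, k, l) - c (own A, k, l) =
        shifted_power d x k * (- q l) + (- q' k) * shifted_power d y l" for k l
      using q[of k l] by simp
    then show ?thesis unfolding F_def by (intro exI[of _ "\<lambda>l. - q l"] exI[of _ "\<lambda>k. - q' k"] allI)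
  qed
  have F_trans: "F A B" if AC: "F A C" and CB: "F C B" for A B C
  proof -
    obtain q q' where q: "\<And>k l. c (own A, k, l) - c (own C, k, l) =
        shifted_power d x k * q l + q' k * shifted_power d y l" using AC unfolding F_def by metis
    obtain r r' where r: "\<And>k l. c (own C, k, l) - c (own B, k, l) =
        shifted_power d x k * r l + r' k * shifted_power d y l" using CB unfolding F_def by metis
    have "c (own A, k, l) - c (own B, k, l) =
        shifted_power d x k * (q l + r l) + (q' k + r' k) * shifted_power d y l" for k l
      using q[of k l] r[of k l] by (simp add: ring_distribs)
    then show ?thesis unfolding F_def by (intro exI[of _ "\<lambda>l. q l + r l"] exI[of _ "\<lambda>k. q' k + r' k"] allI)
  qed
  have Fv: "F (a, b) (a - 1, b)" if "(a, b) \<in> inside" "(a - 1, b) \<in> inside" "x = xs a" for a b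
  proof -
    have "c (own (a, b), k, l) - c (own (a - 1, b), k, l) = shifted_power d x k *
        (c (own (a, b), d, l) - c (own (a - 1, b), d, l)) + 0 * shifted_power d y l" for k l
      using coeff_space_v[OF c that(1,2), of k l] unfolding that(3) by simp
    then show ?thesis unfolding F_def
      by (intro exI[of _ "\<lambda>l. c (own (a, b), d, l) - c (own (a - 1, b), d, l)"] exI[of _ "\<lambda>_. 0"] allI)
  qed
  have Fh: "F (a, b) (a, b - 1)" if "(a, b) \<in> inside" "(a, b - 1) \<in> inside" "y = ys b" for a b
  proof -
    have "c (own (a, b), k, l) - c (own (a, b - 1), k, l) = shifted_power d x k * 0 +
        (c (own (a, b), k, d) - c (own (a, b - 1), k, d)) * shifted_power d y l" for k l
      using coeff_space_h[OF c that(1,2), of k l] unfolding that(3) by simp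
    then show ?thesis unfolding F_def
      by (intro exI[of _ "\<lambda>_. 0"] exI[of _ "\<lambda>k. c (own (a, b), k, d) - c (own (a, b - 1), k, d)"] allI)
  qed
  consider "i' = i" "j' = j" | "i' = i" "j' = j - 1" "y = ys j" | "i' = i" "j' = j + 1" "y = ys j'"
    | "i' = i - 1" "j' = j" "x = xs i" | "i' = i + 1" "j' = j" "x = xs i'"
    | w where "corner w (i, j)" "corner w (i', j')" "x = xs (fst w)" "y = ys (snd w)"
    using touching_cells[of x y i j i' j'] Q(3) Q'(3) unfolding R R' xy by metis
  then have "F Q Q'"
  proof cases
    case 1 then show ?thesis using F_refl R R' by simp
  next
    case 2 then show ?thesis using Fh[of i j] Q(1) Q'(1) unfolding R R' by simp
  next
    case 3 then show ?thesis using F_sym[OF Fh[of i' j']] Q(1) Q'(1) unfolding R R' by simp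
  next
    case 4 then show ?thesis using Fv[of i j] Q(1) Q'(1) unfolding R R' by simp
  next
    case 5 then show ?thesis using F_sym[OF Fv[of i' j']] Q(1) Q'(1) unfolding R R' by simp
  next
    case 6
    obtain a b where w: "w = (a, b)" by fastforce
    have four: "S = (a, b) \<or> S = (a - 1, b) \<or> S = (a - 1, b - 1) \<or> S = (a, b - 1)" if "corner w S" for S
      using that unfolding corner_def w by (cases S) auto
    have xa: "x = xs a" "y = ys b" using 6 w by simp_all
    have e: "(a, b) \<in> inside \<Longrightarrow> (a - 1, b) \<in> inside \<Longrightarrow> F (a, b) (a - 1, b)"
      "(a, b - 1) \<in> inside \<Longrightarrow> (a - 1, b - 1) \<in> inside \<Longrightarrow> F (a, b - 1) (a - 1, b - 1)"
      "(a, b) \<in> inside \<Longrightarrow> (a, b - 1) \<in> inside \<Longrightarrow> F (a, b) (a, b - 1)"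
      "(a - 1, b) \<in> inside \<Longrightarrow> (a - 1, b - 1) \<in> inside \<Longrightarrow> F (a - 1, b) (a - 1, b - 1)"
      using Fv Fh xa by simp_all
    have g1: "F (a, b) (a - 1, b - 1)" if "(a, b) \<in> inside" "(a - 1, b - 1) \<in> inside"
      using diagonal_neighbours(1)[OF that]
    proof
      assume "(a - 1, b) \<in> inside"
      with that show ?thesis using F_trans[OF e(1) e(4)] by simp
    next
      assume "(a, b - 1) \<in> inside"
      with that show ?thesis using F_trans[OF e(3) e(2)] by simp
    qed
    have g2: "F (a - 1, b) (a, b - 1)" if "(a - 1, b) \<in> inside" "(a, b - 1) \<in> inside"
      using diagonal_neighbours(2)[OF that]
    proof
      assume "(a, b) \<in> inside"
      with that show ?thesis using F_trans[OF F_sym[OF e(1)] e(3)] by simp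
    next
      assume "(a - 1, b - 1) \<in> inside"
      with that show ?thesis using F_trans[OF e(4) F_sym[OF e(2)]] by simp
    qed
    have one: "F S S' \<or> F S' S" if "S \<in> inside" "S' \<in> inside" "corner w S" "corner w S'" for S S'
      using four[OF that(3)] four[OF that(4)] that(1,2) e g1 g2 F_refl by (elim disjE) simp_all
    show ?thesis using one[of Q Q'] Q(1) Q'(1) 6(1,2) F_sym unfolding R R' by blast
  qed
  then show ?thesis unfolding F_def Q(2) Q'(2) xy fst_conv snd_conv by metis
qed

definition spline_of :: "nat \<Rightarrow> (point set \<times> nat \<times> nat \<Rightarrow> real) \<Rightarrow> point \<Rightarrow> real" where
  "spline_of d c p = (if p \<in> mesh_domain M
    then eval_coeffs d (\<lambda>k l. c (SOME f. f \<in> cells M \<and> p \<in> f, k, l)) p else 0)"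

lemma linear_spline_of: "Vector_Spaces.linear fun_scale fun_scale (spline_of d)"
  by unfold_locales
    (auto simp: fun_eq_iff spline_of_def eval_coeffs_def fun_scale_def sum.distrib ring_distribs
      sum_distrib_left mult.assoc)

lemma spline_of_eval:
  assumes d: "d \<ge> 1" and c: "c \<in> coeff_space d" and f: "f \<in> cells M" "p \<in> f"
  shows "spline_of d c p = eval_coeffs d (\<lambda>k l. c (f, k, l)) p"
proof -
  define h where "h = (SOME f. f \<in> cells M \<and> p \<in> f)"
  have "\<exists>f. f \<in> cells M \<and> p \<in> f" using f by metis
  then have h: "h \<in> cells M \<and> p \<in> h" unfolding h_def by (rule someI_ex)
  have "p \<in> mesh_domain M" using f unfolding mesh_domain_def by auto
  then have "spline_of d c p = eval_coeffs d (\<lambda>k l. c (h, k, l)) p" unfolding spline_of_def h_def by simp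
  also have "\<dots> = eval_coeffs d (\<lambda>k l. c (f, k, l)) p"
  proof -
    obtain q q' where "\<forall>k\<le>d. \<forall>l\<le>d. c (h, k, l) - c (f, k, l) =
        shifted_power d (fst p) k * q l + q' k * shifted_power d (snd p) l"
      using jump_form[OF c, of h f p] h f by metis
    then have "eval_dx d 0 (\<lambda>k l. c (h, k, l)) (fst p, snd p) = eval_dx d 0 (\<lambda>k l. c (f, k, l)) (fst p, snd p)"
      using eval_dx_jump[of 0 d "\<lambda>k l. c (h, k, l)" "\<lambda>k l. c (f, k, l)" "fst p" q q' "snd p"] d by simp
    then show ?thesis by (simp add: eval_dx_0)
  qed
  finally show ?thesis .
qed

lemma spline_of_in_spline_space:
  assumes d: "d \<ge> 1" and c: "c \<in> coeff_space d"
  shows "spline_of d c \<in> spline_space d M"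
proof -
  interpret T: grid_mesh "transpose_mesh M" ys xs by (rule transposed)
  have out: "\<forall>p. p \<notin> mesh_domain M \<longrightarrow> spline_of d c p = 0" unfolding spline_of_def by simp
  have poly: "bidegree_poly_on d f (spline_of d c)" if "f \<in> cells M" for f
    unfolding bidegree_poly_on_def
    using spline_of_eval[OF d c that] by (intro exI[of _ "\<lambda>k l. c (f, k, l)"]) (simp add: eval_coeffs_def)
  have sx: "smooth_x (d - 1) (mesh_domain M) (spline_of d c)"
    by (rule smooth_x_glue[OF d spline_of_eval[OF d c] _ jump_form[OF c]]) (simp_all add: out)
  have "smooth_x (d - 1) (mesh_domain (transpose_mesh M)) (spline_of d c \<circ> prod.swap)"
  proof (rule T.smooth_x_glue[OF d, of _ "\<lambda>f k l. c (flip f, l, k)"])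
    fix f p assume "f \<in> cells (transpose_mesh M)" "p \<in> f"
    then obtain g where g: "g \<in> cells M" "f = flip g" unfolding cells_transpose by (elim imageE)
    obtain y x where p: "p = (y, x)" by fastforce
    have "(x, y) \<in> g" using \<open>p \<in> f\<close> unfolding p g(2) by simp
    then have "spline_of d c (x, y) = eval_coeffs d (\<lambda>k l. c (g, k, l)) (x, y)" by (rule spline_of_eval[OF d c g(1)])
    then show "(spline_of d c \<circ> prod.swap) p = eval_coeffs d (\<lambda>k l. c (flip f, l, k)) p"
      using eval_coeffs_swap[of d "\<lambda>k l. c (g, k, l)" y x] unfolding p g(2) flip_flip comp_apply swap_simp by simp
  next
    fix p assume "p \<notin> mesh_domain (transpose_mesh M)"
    then have "prod.swap p \<notin> mesh_domain M" by (metis mesh_domain_transpose swap_in_flip swap_swap)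
    then show "(spline_of d c \<circ> prod.swap) p = 0" unfolding comp_apply using out by metis
  next
    fix f f' p assume "f \<in> cells (transpose_mesh M)" "f' \<in> cells (transpose_mesh M)" "p \<in> f" "p \<in> f'"
    then obtain g g' where g: "g \<in> cells M" "f = flip g" "g' \<in> cells M" "f' = flip g'"
      unfolding cells_transpose by (elim imageE)
    obtain y x where p: "p = (y, x)" by fastforce
    have "(x, y) \<in> g" "(x, y) \<in> g'" using \<open>p \<in> f\<close> \<open>p \<in> f'\<close> unfolding p g(2,4) by simp_all
    then obtain q q' where q: "\<forall>k\<le>d. \<forall>l\<le>d. c (g, k, l) - c (g', k, l) =
        shifted_power d x k * q l + q' k * shifted_power d y l"
      using jump_form[OF c g(1,3)] by fastforce
    have "\<forall>k\<le>d. \<forall>l\<le>d. c (flip f, l, k) - c (flip f', l, k) =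
        shifted_power d (fst p) k * q' l + q k * shifted_power d (snd p) l"
      unfolding g(2,4) flip_flip p fst_conv snd_conv using q by (simp add: mult.commute add.commute)
    then show "\<exists>q q'. \<forall>k\<le>d. \<forall>l\<le>d. c (flip f, l, k) - c (flip f', l, k) =
        shifted_power d (fst p) k * q l + q' k * shifted_power d (snd p) l" by metis
  qed
  then have sy: "smooth_y (d - 1) (mesh_domain M) (spline_of d c)"
    unfolding smooth_y_iff mesh_domain_transpose .
  show ?thesis unfolding spline_space_def using out poly sx sy by simp
qed

lemma spline_is_spline_of:
  assumes d: "d \<ge> 1" and s: "s \<in> spline_space d M"
  shows "\<exists>c\<in>coeff_space d. s = spline_of d c"
proof -
  have out: "\<And>p. p \<notin> mesh_domain M \<Longrightarrow> s p = 0" and pw: "\<And>f. f \<in> cells M \<Longrightarrow> bidegree_poly_on d f s"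
    and sx: "smooth_x (d - 1) (mesh_domain M) s" and sy: "smooth_y (d - 1) (mesh_domain M) s"
    using s unfolding spline_space_def by auto
  have "\<exists>b. \<forall>p\<in>f. s p = eval_coeffs d b p" if f: "f \<in> cells M" for f
  proof -
    obtain b where "\<forall>x y. (x, y) \<in> f \<longrightarrow> s (x, y) = (\<Sum>i\<le>d. \<Sum>j\<le>d. b i j * x ^ i * y ^ j)"
      using pw[OF f] unfolding bidegree_poly_on_def by (rule exE)
    then show ?thesis unfolding eval_coeffs_def by (intro exI[of _ b]) auto
  qed
  then obtain b where b: "\<And>f p. f \<in> cells M \<Longrightarrow> p \<in> f \<Longrightarrow> s p = eval_coeffs d (b f) p" by metis
  define c where "c = (\<lambda>(f, k, l). if f \<in> cells M \<and> k \<le> d \<and> l \<le> d then b f k l else 0)"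
  have cs: "s p = eval_coeffs d (\<lambda>k l. c (f, k, l)) p" if "f \<in> cells M" "p \<in> f" for f p
    using b[OF that] that(1) unfolding eval_coeffs_def c_def by simp
  have gcs: "s p = eval_coeffs d (\<lambda>k l. c (own Q, k, l)) p" if "Q \<in> inside" "p \<in> gc Q" for Q p
    using cs own_cell[OF that(1)] that(2) by (metis subsetD)
  have zero: "c (f, k, l) = 0" if "f \<notin> cells M \<or> k > d \<or> l > d" for f k l
    using that unfolding c_def by auto
  have v: "c (own (i, j), k, l) - c (own (i - 1, j), k, l) =
      shifted_power d (xs i) k * (c (own (i, j), d, l) - c (own (i - 1, j), d, l))"
    if ij: "(i, j) \<in> inside" "(i - 1, j) \<in> inside" for i j k l
  proof (cases "k \<le> d \<and> l \<le> d")
    case True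
    have "{xs (i - 1)..xs (i + 1)} \<times> {ys j..ys (j + 1)} \<subseteq> gc (i - 1, j) \<union> gc (i, j)"
      by (auto simp: gc_def)
    then have D: "{xs (i - 1)..xs (i + 1)} \<times> {ys j..ys (j + 1)} \<subseteq> mesh_domain M"
      using gc_subset_domain[OF ij(1)] gc_subset_domain[OF ij(2)] by auto
    have L: "s (x, y) = eval_coeffs d (\<lambda>k l. c (own (i - 1, j), k, l)) (x, y)"
      if "xs (i - 1) \<le> x" "x \<le> xs i" "ys j \<le> y" "y \<le> ys (j + 1)" for x y
      using gcs[OF ij(2), of "(x, y)"] that by (simp add: gc_def)
    have R: "s (x, y) = eval_coeffs d (\<lambda>k l. c (own (i, j), k, l)) (x, y)"
      if "xs i \<le> x" "x \<le> xs (i + 1)" "ys j \<le> y" "y \<le> ys (j + 1)" for x y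
      using gcs[OF ij(1), of "(x, y)"] that by (simp add: gc_def)
    have lt: "xs (i - 1) < xs i" "xs i < xs (i + 1)" "ys j < ys (j + 1)" by simp_all
    show ?thesis
      by (rule smooth_x_jump[where c = "\<lambda>k l. c (own (i - 1, j), k, l)" and
          c' = "\<lambda>k l. c (own (i, j), k, l)", OF d sx lt D L R]) (use True in simp_all)
  qed (use zero shifted_power_beyond in auto)
  have h: "c (own (i, j), k, l) - c (own (i, j - 1), k, l) =
      (c (own (i, j), k, d) - c (own (i, j - 1), k, d)) * shifted_power d (ys j) l"
    if ij: "(i, j) \<in> inside" "(i, j - 1) \<in> inside" for i j k l
  proof (cases "k \<le> d \<and> l \<le> d")
    case True
    have "{xs i..xs (i + 1)} \<times> {ys (j - 1)..ys (j + 1)} \<subseteq> gc (i, j - 1) \<union> gc (i, j)"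
      by (auto simp: gc_def)
    then have D: "{xs i..xs (i + 1)} \<times> {ys (j - 1)..ys (j + 1)} \<subseteq> mesh_domain M"
      using gc_subset_domain[OF ij(1)] gc_subset_domain[OF ij(2)] by auto
    have L: "s (x, y) = eval_coeffs d (\<lambda>k l. c (own (i, j - 1), k, l)) (x, y)"
      if "xs i \<le> x" "x \<le> xs (i + 1)" "ys (j - 1) \<le> y" "y \<le> ys j" for x y
      using gcs[OF ij(2), of "(x, y)"] that by (simp add: gc_def)
    have R: "s (x, y) = eval_coeffs d (\<lambda>k l. c (own (i, j), k, l)) (x, y)"
      if "xs i \<le> x" "x \<le> xs (i + 1)" "ys j \<le> y" "y \<le> ys (j + 1)" for x y
      using gcs[OF ij(1), of "(x, y)"] that by (simp add: gc_def)
    have lt: "xs i < xs (i + 1)" "ys (j - 1) < ys j" "ys j < ys (j + 1)" by simp_all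
    show ?thesis
      by (rule smooth_y_jump[where c = "\<lambda>k l. c (own (i, j - 1), k, l)" and
          c' = "\<lambda>k l. c (own (i, j), k, l)", OF d sy lt D L R]) (use True in simp_all)
  qed (use zero shifted_power_beyond in auto)
  have c: "c \<in> coeff_space d" unfolding coeff_space_def using zero v h by blast
  have "s = spline_of d c"
  proof
    fix p
    show "s p = spline_of d c p"
    proof (cases "p \<in> mesh_domain M")
      case True
      then obtain f where f: "f \<in> cells M" "p \<in> f" unfolding mesh_domain_def by auto
      then show ?thesis using cs[OF f] spline_of_eval[OF d c f] by simp
    qed (simp add: out spline_of_def)
  qed
  then show ?thesis using c by metis
qed

lemma inj_spline_of:
  assumes d: "d \<ge> 1" shows "inj_on (spline_of d) (coeff_space d)"
proof (rule inj_onI, rule ext)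
  fix c c' :: "point set \<times> nat \<times> nat \<Rightarrow> real" and q :: "point set \<times> nat \<times> nat"
  assume c: "c \<in> coeff_space d" "c' \<in> coeff_space d" "spline_of d c = spline_of d c'"
  obtain f k l where q: "q = (f, k, l)" by (cases q)
  show "c q = c' q"
  proof (cases "f \<in> cells M \<and> k \<le> d \<and> l \<le> d")
    case True
    then obtain a b e h where f: "a < b" "e < h" "f = {xs a..xs b} \<times> {ys e..ys h}" using cells_on_grid by metis
    have lt: "xs a < xs b" "ys e < ys h" using f by simp_all
    have "eval_coeffs d (\<lambda>k l. c (f, k, l)) (x, y) = eval_coeffs d (\<lambda>k l. c' (f, k, l)) (x, y)"
      if "xs a < x" "x < xs b" "ys e < y" "y < ys h" for x y
    proof -
      have "(x, y) \<in> f" using that unfolding f(3) by simp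
      then show ?thesis using spline_of_eval[OF d c(1)] spline_of_eval[OF d c(2)] c(3) True by metis
    qed
    from eval_coeffs_unique[OF lt this, of k l] show ?thesis using True unfolding q by simp
  next
    case False
    then have "f \<notin> cells M \<or> k > d \<or> l > d" by auto
    then show ?thesis unfolding q using coeff_space_zero[OF c(1)] coeff_space_zero[OF c(2)] by simp
  qed
qed

lemma dim_spline_space:
  assumes "d \<ge> 1" shows "fun_vs.dim (spline_space d M) = fun_vs.dim (coeff_space d)"
proof -
  have "spline_space d M = spline_of d ` coeff_space d"
    using spline_is_spline_of[OF assms] spline_of_in_spline_space[OF assms] by auto
  then show ?thesis
    using dim_linear_image[OF linear_spline_of subspace_coeff_space inj_spline_of[OF assms]] by simp
qed

end

section \<open>Cofactors along a line\<close>

lemma telescope: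
  fixes H D :: "int \<Rightarrow> real"
  assumes "\<And>i. a < i \<Longrightarrow> i < b \<Longrightarrow> H i - H (i - 1) = D i" "a \<le> m" "m < b"
  shows "H m = H a + sum D {a + 1..m}"
  using assms(2,3)
proof (induction m rule: int_ge_induct)
  case base then show ?case by simp
next
  case (step m)
  have "{a + 1..m + 1} = insert (m + 1) {a + 1..m}" using step.hyps by auto
  then have "sum D {a + 1..m + 1} = D (m + 1) + sum D {a + 1..m}" by simp
  then show ?case using step assms(1)[of "m + 1"] by simp
qed

lemma sum_int_first: "a \<le> (b :: int) \<Longrightarrow> sum D {a..b} = D a + sum D {a + 1..b}" for D :: "int \<Rightarrow> real"
proof -
  assume "a \<le> b"
  then have "{a..b} = insert a {a + 1..b}" by auto
  then show ?thesis by simp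
qed

lemma sum_int_last: "a \<le> (b :: int) \<Longrightarrow> sum D {a..b} = sum D {a..b - 1} + D b" for D :: "int \<Rightarrow> real"
proof -
  assume "a \<le> b"
  then have "{a..b} = insert b {a..b - 1}" by auto
  then show ?thesis by simp
qed

context grid_mesh
begin

abbreviation interior_point :: "int \<Rightarrow> int \<Rightarrow> bool" where
  "interior_point i j \<equiv> (xs i, ys j) \<in> interior (mesh_domain M)"

lemma interior_point_in_run:
  assumes "run_h a b j" "a < i" "i < b" shows "interior_point i j"
proof -
  have "act_h i j" "act_h (i - 1) j" using assms unfolding run_h_def by auto
  then show ?thesis unfolding interior_vertex_iff act_h_def by simp
qed

text \<open>Beyond an interior end point the cofactor is zero.\<close>

lemma cofactors_at_ends:
  assumes step: "\<And>i j. interior_point i j \<Longrightarrow> H i j - H (i - 1) j = (D i j :: real)"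
    and zero: "\<And>i j. (i, j) \<in> inside \<Longrightarrow> (i, j - 1) \<in> inside \<Longrightarrow> \<not> act_h i j \<Longrightarrow> H i j = 0"
    and run: "run_h a b j"
  shows "interior_point a j \<Longrightarrow> H a j = D a j" "interior_point b j \<Longrightarrow> H (b - 1) j = - D b j"
proof -
  have n: "\<not> act_h (a - 1) j" "\<not> act_h b j" using run unfolding run_h_def by simp_all
  show "H a j = D a j" if "interior_point a j"
  proof -
    have "(a - 1, j) \<in> inside" "(a - 1, j - 1) \<in> inside" using that unfolding interior_vertex_iff by simp_all
    then show ?thesis using step[OF that] zero n(1) by simp
  qed
  show "H (b - 1) j = - D b j" if "interior_point b j"
  proof -
    have "(b, j) \<in> inside" "(b, j - 1) \<in> inside" using that unfolding interior_vertex_iff by simp_all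
    then show ?thesis using step[OF that] zero n(2) by simp
  qed
qed

text \<open>The cofactor of a T l-edge starts and ends with zero, so its steps sum up to zero.\<close>

lemma cofactors_run_sum:
  assumes step: "\<And>i j. interior_point i j \<Longrightarrow> H i j - H (i - 1) j = (D i j :: real)"
    and zero: "\<And>i j. (i, j) \<in> inside \<Longrightarrow> (i, j - 1) \<in> inside \<Longrightarrow> \<not> act_h i j \<Longrightarrow> H i j = 0"
    and run: "run_h a b j" "interior_point a j" "interior_point b j"
  shows "(\<Sum>i=a..b. D i j) = 0"
proof -
  have ab: "a < b" using run(1) unfolding run_h_def by simp
  have "H (b - 1) j = H a j + (\<Sum>i=a + 1..b - 1. D i j)"
    by (rule telescope[of a b "\<lambda>i. H i j" "\<lambda>i. D i j" "b - 1"])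
      (use step interior_point_in_run[OF run(1)] ab in auto)
  then have "(\<Sum>i=a + 1..b - 1. D i j) = - D b j - D a j"
    using cofactors_at_ends[where H = H and D = D, OF step zero run(1)] run(2,3) by simp
  then show ?thesis using sum_int_first[of a b "\<lambda>i. D i j"] sum_int_last[of "a + 1" b "\<lambda>i. D i j"] ab by simp
qed

lemma cofactors_vanish:
  assumes step: "\<And>i j. interior_point i j \<Longrightarrow> H i j - H (i - 1) j = (0 :: real)"
    and zero: "\<And>i j. (i, j) \<in> inside \<Longrightarrow> (i, j - 1) \<in> inside \<Longrightarrow> \<not> act_h i j \<Longrightarrow> H i j = 0"
    and cut: "\<And>a b j. run_h a b j \<Longrightarrow> \<not> interior_point a j \<Longrightarrow> \<not> interior_point b j \<Longrightarrow> H a j = 0"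
    and act: "act_h i j"
  shows "H i j = 0"
proof -
  obtain a b where run: "run_h a b j" "a \<le> i" "i < b" using act_h_in_run[OF act] by metis
  have ab: "a < b" using run by simp
  have tel: "H m j = H a j" if "a \<le> m" "m < b" for m
    using telescope[of a b "\<lambda>i. H i j" "\<lambda>_. 0" m] step interior_point_in_run[OF run(1)] that by simp
  have "H a j = 0"
  proof (cases "interior_point a j")
    case True
    show ?thesis
      by (rule cofactors_at_ends(1)[of H "\<lambda>_ _. 0" a b j]) (fact step zero run(1) True)+
  next
    case False
    show ?thesis
    proof (cases "interior_point b j")
      case True
      have "H (b - 1) j = - 0"
        by (rule cofactors_at_ends(2)[of H "\<lambda>_ _. 0" a b j]) (fact step zero run(1) True)+
      then show ?thesis using tel[of "b - 1"] ab by simp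
    qed (rule cut[OF run(1) False])
  qed
  then show ?thesis using tel[OF run(2,3)] by simp
qed

text \<open>On each run the cofactor is the sum of its steps, with the starting value forced by an interior end
  point and prescribed by \<open>q\<close> if there is none. For a run with two interior ends both
  requirements agree by the vanishing sum.\<close>

lemma cofactors_exist:
  fixes D :: "int \<Rightarrow> int \<Rightarrow> real"
  assumes zero: "\<And>i j. interior_point i j \<Longrightarrow> \<not> act_h i j \<Longrightarrow> \<not> act_h (i - 1) j \<Longrightarrow> D i j = 0"
    and sum0: "\<And>a b j. run_h a b j \<Longrightarrow> interior_point a j \<Longrightarrow> interior_point b j \<Longrightarrow> (\<Sum>i=a..b. D i j) = 0"
  shows "\<exists>H. (\<forall>i j. interior_point i j \<longrightarrow> H i j - H (i - 1) j = D i j) \<and> (\<forall>i j. \<not> act_h i j \<longrightarrow> H i j = 0) \<and>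
    (\<forall>a b j. run_h a b j \<longrightarrow> \<not> interior_point a j \<longrightarrow> \<not> interior_point b j \<longrightarrow> H a j = q a j)"
proof -
  define S where "S = (\<lambda>a b j. if interior_point a j then D a j
    else if interior_point b j then - (\<Sum>i=a + 1..b. D i j) else q a j)"
  define G where "G = (\<lambda>a b j i. S a b j + (\<Sum>i'=a + 1..i. D i' j))"
  have "\<forall>i j. \<exists>ab. act_h i j \<longrightarrow> run_h (fst ab) (snd ab) j \<and> fst ab \<le> i \<and> i < snd ab"
  proof (intro allI)
    fix i j
    show "\<exists>ab. act_h i j \<longrightarrow> run_h (fst ab) (snd ab) j \<and> fst ab \<le> i \<and> i < snd ab"
    proof (cases "act_h i j")
      case True
      then obtain a b where "run_h a b j" "a \<le> i" "i < b" using act_h_in_run by metis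
      then show ?thesis by (intro exI[of _ "(a, b)"]) simp
    qed simp
  qed
  then obtain R where R: "\<And>i j. act_h i j \<Longrightarrow> run_h (fst (R i j)) (snd (R i j)) j \<and> fst (R i j) \<le> i \<and> i < snd (R i j)"
    by metis
  define H where "H = (\<lambda>i j. if act_h i j then G (fst (R i j)) (snd (R i j)) j i else 0)"
  have HG: "H i j = G a b j i" if run: "run_h a b j" and i: "a \<le> i" "i < b" for a b i j
  proof -
    have act: "act_h i j" using run i unfolding run_h_def by simp
    have "fst (R i j) = a" "snd (R i j) = b"
      using run_h_unique[OF run, of "fst (R i j)" "snd (R i j)" i] R[OF act] i by simp_all
    then show ?thesis unfolding H_def using act by simp
  qed
  have H0: "H i j = 0" if "\<not> act_h i j" for i j using that unfolding H_def by simp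
  have Ga: "G a b j a = S a b j" for a b j unfolding G_def by simp
  have step: "H i j - H (i - 1) j = D i j" if p: "interior_point i j" for i j
  proof -
    consider "act_h i j" "act_h (i - 1) j" | "act_h i j" "\<not> act_h (i - 1) j"
      | "\<not> act_h i j" "act_h (i - 1) j" | "\<not> act_h i j" "\<not> act_h (i - 1) j" by auto
    then show ?thesis
    proof cases
      case 1
      obtain a b where run: "run_h a b j" "a \<le> i - 1" "i - 1 < b" using act_h_in_run[OF 1(2)] by metis
      have "i < b" using run 1(1) unfolding run_h_def by (metis add.commute diff_add_cancel linorder_cases zle_diff1_eq less_irrefl not_less)
      then have e: "H i j = G a b j i" "H (i - 1) j = G a b j (i - 1)" using HG[OF run(1)] run by simp_all
      show ?thesis unfolding e G_def using sum_int_last[of "a + 1" i "\<lambda>i. D i j"] run by simp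
    next
      case 2
      obtain a b where run: "run_h a b j" "a \<le> i" "i < b" using act_h_in_run[OF 2(1)] by metis
      have "a = i"
      proof (rule ccontr)
        assume "a \<noteq> i"
        then have "act_h (i - 1) j" using run unfolding run_h_def by simp
        then show False using 2(2) by simp
      qed
      then show ?thesis using HG[OF run] H0[OF 2(2)] Ga[of i b j] p unfolding S_def by simp
    next
      case 3
      obtain a b where run: "run_h a b j" "a \<le> i - 1" "i - 1 < b" using act_h_in_run[OF 3(2)] by metis
      have b: "b = i"
      proof (rule ccontr)
        assume "b \<noteq> i"
        then have "act_h i j" using run unfolding run_h_def by simp
        then show False using 3(1) by simp
      qed
      have ai: "a < i" using run by simp
      have H: "H i j - H (i - 1) j = - (S a i j + (\<Sum>i'=a + 1..i - 1. D i' j))"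
        using HG[OF run] H0[OF 3(1)] unfolding G_def b by simp
      show ?thesis
      proof (cases "interior_point a j")
        case True
        then have "S a i j = D a j" unfolding S_def by simp
        moreover have "(\<Sum>i'=a..i. D i' j) = 0" using sum0[OF run(1)[unfolded b] True p] .
        ultimately show ?thesis unfolding H
          using sum_int_first[of a i "\<lambda>i. D i j"] sum_int_last[of "a + 1" i "\<lambda>i. D i j"] ai by simp
      next
        case False
        then have "S a i j = - (\<Sum>i'=a + 1..i. D i' j)" unfolding S_def using p by simp
        then show ?thesis unfolding H using sum_int_last[of "a + 1" i "\<lambda>i. D i j"] ai by simp
      qed
    next
      case 4
      then show ?thesis using H0 zero[OF p] by simp
    qed
  qed
  have "H a j = q a j" if "run_h a b j" "\<not> interior_point a j" "\<not> interior_point b j" for a b j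
    using HG[OF that(1), of a] that unfolding Ga S_def run_h_def by simp
  then show ?thesis using step H0 by (intro exI[of _ H]) auto
qed

lemma transposed_interior_point:
  "(ys j, xs i) \<in> interior (mesh_domain (transpose_mesh M)) \<longleftrightarrow> interior_point i j"
  unfolding mesh_domain_transpose interior_flip Pair_in_flip ..

lemma cofactors_run_sum_v:
  assumes step: "\<And>i j. interior_point i j \<Longrightarrow> V i j - V i (j - 1) = (D i j :: real)"
    and zero: "\<And>i j. (i, j) \<in> inside \<Longrightarrow> (i - 1, j) \<in> inside \<Longrightarrow> \<not> act_v i j \<Longrightarrow> V i j = 0"
    and run: "run_v a b i" "interior_point i a" "interior_point i b"
  shows "(\<Sum>j=a..b. D i j) = 0"
proof -
  interpret T: grid_mesh "transpose_mesh M" ys xs by (rule transposed)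
  show ?thesis
    using T.cofactors_run_sum[of "\<lambda>j i. V i j" "\<lambda>j i. D i j" a b i]
    unfolding transposed_interior_point transposed_inside transposed_act transposed_run
    using step zero run by simp
qed

lemma cofactors_vanish_v:
  assumes step: "\<And>i j. interior_point i j \<Longrightarrow> V i j - V i (j - 1) = (0 :: real)"
    and zero: "\<And>i j. (i, j) \<in> inside \<Longrightarrow> (i - 1, j) \<in> inside \<Longrightarrow> \<not> act_v i j \<Longrightarrow> V i j = 0"
    and cut: "\<And>a b i. run_v a b i \<Longrightarrow> \<not> interior_point i a \<Longrightarrow> \<not> interior_point i b \<Longrightarrow> V i a = 0"
    and act: "act_v i j"
  shows "V i j = 0"
proof -
  interpret T: grid_mesh "transpose_mesh M" ys xs by (rule transposed)
  show ?thesis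
    using T.cofactors_vanish[of "\<lambda>j i. V i j" j i]
    unfolding transposed_interior_point transposed_inside transposed_act transposed_run
    using step zero cut act by simp
qed

lemma cofactors_exist_v:
  fixes D :: "int \<Rightarrow> int \<Rightarrow> real"
  assumes zero: "\<And>i j. interior_point i j \<Longrightarrow> \<not> act_v i j \<Longrightarrow> \<not> act_v i (j - 1) \<Longrightarrow> D i j = 0"
    and sum0: "\<And>a b i. run_v a b i \<Longrightarrow> interior_point i a \<Longrightarrow> interior_point i b \<Longrightarrow> (\<Sum>j=a..b. D i j) = 0"
  shows "\<exists>V. (\<forall>i j. interior_point i j \<longrightarrow> V i j - V i (j - 1) = D i j) \<and> (\<forall>i j. \<not> act_v i j \<longrightarrow> V i j = 0) \<and>
    (\<forall>a b i. run_v a b i \<longrightarrow> \<not> interior_point i a \<longrightarrow> \<not> interior_point i b \<longrightarrow> V i a = q a i)"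
proof -
  interpret T: grid_mesh "transpose_mesh M" ys xs by (rule transposed)
  obtain H where H: "(\<forall>j i. interior_point i j \<longrightarrow> H j i - H (j - 1) i = D i j) \<and> (\<forall>j i. \<not> act_v i j \<longrightarrow> H j i = 0) \<and>
    (\<forall>a b i. run_v a b i \<longrightarrow> \<not> interior_point i a \<longrightarrow> \<not> interior_point i b \<longrightarrow> H a i = q a i)"
    using T.cofactors_exist[of "\<lambda>j i. D i j" q]
    unfolding transposed_interior_point transposed_inside transposed_act transposed_run
    using zero sum0 by auto
  then show ?thesis by (intro exI[of _ "\<lambda>i j. H j i"]) auto
qed

section \<open>From cofactors to coefficients\<close>

text \<open>A mesh cell is a rectangular block of grid cells, which can be traversed along a row and a column.\<close>

lemma own_connected:
  assumes v: "\<And>i j. (i, j) \<in> inside \<Longrightarrow> (i - 1, j) \<in> inside \<Longrightarrow> own (i, j) = own (i - 1, j) \<Longrightarrow> \<phi> (i, j) = \<phi> (i - 1, j)"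
    and h: "\<And>i j. (i, j) \<in> inside \<Longrightarrow> (i, j - 1) \<in> inside \<Longrightarrow> own (i, j) = own (i, j - 1) \<Longrightarrow> \<phi> (i, j) = \<phi> (i, j - 1)"
    and Q: "Q \<in> inside" "Q' \<in> inside" "own Q = own Q'"
  shows "\<phi> Q = \<phi> Q'"
proof -
  have f: "own Q \<in> cells M" "gc Q \<subseteq> own Q" "gc Q' \<subseteq> own Q"
    using own_cell[OF Q(1)] own_cell[OF Q(2)] Q(3) by simp_all
  obtain a b c e where abce: "a < b" "c < e" "own Q = {xs a..xs b} \<times> {ys c..ys e}" using cells_on_grid[OF f(1)] by metis
  have ins: "(i, j) \<in> inside" "own (i, j) = own Q" if "a \<le> i" "i < b" "c \<le> j" "j < e" for i j
  proof -
    have "gc (i, j) \<subseteq> own Q" unfolding abce(3) gc_subset_iff using that by simp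
    then show "(i, j) \<in> inside" "own (i, j) = own Q" using insideI[OF f(1)] own_eqI[OF f(1)] by simp_all
  qed
  have row: "\<phi> (i, j) = \<phi> (a, j)" if j: "c \<le> j" "j < e" and "a \<le> i" "i < b" for i j
    using that(3,4)
  proof (induction i rule: int_ge_induct)
    case (step i)
    then show ?case using v[of "i + 1" j] ins[of "i + 1" j] ins[of i j] j by simp
  qed simp
  have col: "\<phi> (a, j) = \<phi> (a, c)" if "c \<le> j" "j < e" for j
    using that
  proof (induction j rule: int_ge_induct)
    case (step j)
    then show ?case using h[of a "j + 1"] ins[of a "j + 1"] ins[of a j] abce(1) by simp
  qed simp
  have "\<phi> R = \<phi> (a, c)" if "gc R \<subseteq> own Q" for R
  proof -
    obtain i j where R: "R = (i, j)" by fastforce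
    have "a \<le> i \<and> i < b \<and> c \<le> j \<and> j < e" using that unfolding R abce(3) gc_subset_iff .
    then have "\<phi> (i, j) = \<phi> (a, j)" "\<phi> (a, j) = \<phi> (a, c)" using row[of j i] col[of j] by blast+
    then show ?thesis unfolding R by (rule trans)
  qed
  then show ?thesis using f by simp
qed

text \<open>Around a vertex the edge cofactors integrate to a local potential: at an interior vertex the
  total jump around it vanishes, and at any other vertex a quadrant is missing, so that there is no
  loop around it.\<close>

lemma local_potential:
  fixes hb va :: "int \<Rightarrow> int \<Rightarrow> real"
  assumes "interior_point i j \<Longrightarrow> (hb i j - hb (i - 1) j) * py = (va i j - va i (j - 1)) * px"
  shows "\<exists>m :: int \<times> int \<Rightarrow> real.
    ((i, j) \<in> inside \<and> (i - 1, j) \<in> inside \<longrightarrow> m (i, j) - m (i - 1, j) = px * va i j) \<and>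
    ((i, j - 1) \<in> inside \<and> (i - 1, j - 1) \<in> inside \<longrightarrow> m (i, j - 1) - m (i - 1, j - 1) = px * va i (j - 1)) \<and>
    ((i, j) \<in> inside \<and> (i, j - 1) \<in> inside \<longrightarrow> m (i, j) - m (i, j - 1) = hb i j * py) \<and>
    ((i - 1, j) \<in> inside \<and> (i - 1, j - 1) \<in> inside \<longrightarrow> m (i - 1, j) - m (i - 1, j - 1) = hb (i - 1) j * py)"
proof -
  define mk :: "real \<Rightarrow> real \<Rightarrow> real \<Rightarrow> real \<Rightarrow> int \<times> int \<Rightarrow> real" where
    "mk = (\<lambda>x y z w R. if R = (i, j) then x else if R = (i - 1, j) then y
      else if R = (i - 1, j - 1) then z else w)"
  have mk: "mk x y z w (i, j) = x" "mk x y z w (i - 1, j) = y" "mk x y z w (i - 1, j - 1) = z"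
    "mk x y z w (i, j - 1) = w" for x y z w unfolding mk_def by simp_all
  consider "interior_point i j" | "(i, j) \<notin> inside" | "(i - 1, j) \<notin> inside" | "(i - 1, j - 1) \<notin> inside"
    | "(i, j - 1) \<notin> inside" using interior_vertex_iff[of i j] by blast
  then show ?thesis
  proof cases
    case 1
    have "hb (i - 1) j * py + px * va i j - px * va i (j - 1) = hb i j * py"
      using assms[OF 1] by (simp add: algebra_simps)
    then show ?thesis
      by (intro exI[of _ "mk (hb (i - 1) j * py + px * va i j) (hb (i - 1) j * py) 0 (px * va i (j - 1))"])
        (simp add: mk)
  next
    case 2
    show ?thesis
      by (intro exI[of _ "mk 0 (hb (i - 1) j * py) 0 (px * va i (j - 1))"]) (use 2 in \<open>simp add: mk\<close>)
  next
    case 3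
    show ?thesis
      by (intro exI[of _ "mk (hb i j * py) 0 (- (px * va i (j - 1))) 0"]) (use 3 in \<open>simp add: mk\<close>)
  next
    case 4
    show ?thesis
      by (intro exI[of _ "mk 0 (- (px * va i j)) 0 (- (hb i j * py))"]) (use 4 in \<open>simp add: mk\<close>)
  next
    case 5
    show ?thesis
      by (intro exI[of _ "mk (px * va i j) 0 (- (hb (i - 1) j * py)) 0"]) (use 5 in \<open>simp add: mk\<close>)
  qed
qed

text \<open>For each pair of exponents the jumps prescribed by the cofactors have local potentials and
  therefore a global one, which is constant on mesh cells because it jumps only across active
  segments.\<close>

lemma coefficients_exist:
  fixes hb va :: "int \<Rightarrow> int \<Rightarrow> nat \<Rightarrow> real"
  assumes hb: "\<And>i j k. interior_point i j \<Longrightarrow> hb i j k - hb (i - 1) j k = \<delta> i j * shifted_power d (xs i) k"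
    and va: "\<And>i j l. interior_point i j \<Longrightarrow> va i j l - va i (j - 1) l = \<delta> i j * shifted_power d (ys j) l"
    and hb0: "\<And>i j k. \<not> act_h i j \<Longrightarrow> hb i j k = 0" and va0: "\<And>i j l. \<not> act_v i j \<Longrightarrow> va i j l = 0"
    and f0: "f0 \<in> cells M"
  shows "\<exists>c\<in>coeff_space d. (\<forall>k\<le>d. \<forall>l\<le>d. c (f0, k, l) = w k l) \<and>
    (\<forall>i j k l. (i, j) \<in> inside \<longrightarrow> (i, j - 1) \<in> inside \<longrightarrow> k \<le> d \<longrightarrow> l \<le> d \<longrightarrow>
      c (own (i, j), k, l) - c (own (i, j - 1), k, l) = hb i j k * shifted_power d (ys j) l) \<and>
    (\<forall>i j k l. (i, j) \<in> inside \<longrightarrow> (i - 1, j) \<in> inside \<longrightarrow> k \<le> d \<longrightarrow> l \<le> d \<longrightarrow>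
      c (own (i, j), k, l) - c (own (i - 1, j), k, l) = shifted_power d (xs i) k * va i j l)"
proof -
  let ?pw = "shifted_power d"
  have "\<exists>K :: int \<times> int \<Rightarrow> real.
    (\<forall>i j. (i, j) \<in> inside \<longrightarrow> (i, j - 1) \<in> inside \<longrightarrow> K (i, j) - K (i, j - 1) = hb i j k * ?pw (ys j) l) \<and>
    (\<forall>i j. (i, j) \<in> inside \<longrightarrow> (i - 1, j) \<in> inside \<longrightarrow> K (i, j) - K (i - 1, j) = ?pw (xs i) k * va i j l)" for k l
  proof -
    define P where "P = (\<lambda>i j (m :: int \<times> int \<Rightarrow> real).
      ((i, j) \<in> inside \<and> (i - 1, j) \<in> inside \<longrightarrow> m (i, j) - m (i - 1, j) = ?pw (xs i) k * va i j l) \<and>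
      ((i, j - 1) \<in> inside \<and> (i - 1, j - 1) \<in> inside \<longrightarrow> m (i, j - 1) - m (i - 1, j - 1) = ?pw (xs i) k * va i (j - 1) l) \<and>
      ((i, j) \<in> inside \<and> (i, j - 1) \<in> inside \<longrightarrow> m (i, j) - m (i, j - 1) = hb i j k * ?pw (ys j) l) \<and>
      ((i - 1, j) \<in> inside \<and> (i - 1, j - 1) \<in> inside \<longrightarrow> m (i - 1, j) - m (i - 1, j - 1) = hb (i - 1) j k * ?pw (ys j) l))"
    have "\<exists>m. P i j m" for i j
      unfolding P_def
      by (rule local_potential[of i j "\<lambda>i j. hb i j k" "?pw (ys j) l" "\<lambda>i j. va i j l" "?pw (xs i) k"])
        (simp add: hb va)
    then obtain m where Pm: "\<And>i j. P i j (m i j)" by metis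
    have m:
      "\<And>i j. (i, j) \<in> inside \<Longrightarrow> (i - 1, j) \<in> inside \<Longrightarrow> m i j (i, j) - m i j (i - 1, j) = ?pw (xs i) k * va i j l"
      "\<And>i j. (i, j - 1) \<in> inside \<Longrightarrow> (i - 1, j - 1) \<in> inside \<Longrightarrow> m i j (i, j - 1) - m i j (i - 1, j - 1) = ?pw (xs i) k * va i (j - 1) l"
      "\<And>i j. (i, j) \<in> inside \<Longrightarrow> (i, j - 1) \<in> inside \<Longrightarrow> m i j (i, j) - m i j (i, j - 1) = hb i j k * ?pw (ys j) l"
      "\<And>i j. (i - 1, j) \<in> inside \<Longrightarrow> (i - 1, j - 1) \<in> inside \<Longrightarrow> m i j (i - 1, j) - m i j (i - 1, j - 1) = hb (i - 1) j k * ?pw (ys j) l"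
      using Pm unfolding P_def by simp_all
    define n where "n = (\<lambda>v. m (fst v) (snd v))"
    have "\<exists>K :: int \<times> int \<Rightarrow> real. \<forall>v Q Q'. Q \<in> inside \<longrightarrow> Q' \<in> inside \<longrightarrow> corner v Q \<longrightarrow> corner v Q' \<longrightarrow>
      K Q - K Q' = n v Q - n v Q'"
    proof (rule real_potential)
      fix i j assume a: "(i, j) \<in> inside" "(i, j - 1) \<in> inside"
      show "n (i, j) (i, j) - n (i, j) (i, j - 1) = n (i + 1, j) (i, j) - n (i + 1, j) (i, j - 1)"
        unfolding n_def fst_conv snd_conv using m(3)[OF a] m(4)[of "i + 1" j] a by simp
    next
      fix i j assume a: "(i, j) \<in> inside" "(i - 1, j) \<in> inside"
      show "n (i, j) (i, j) - n (i, j) (i - 1, j) = n (i, j + 1) (i, j) - n (i, j + 1) (i - 1, j)"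
        unfolding n_def fst_conv snd_conv using m(1)[OF a] m(2)[of i "j + 1"] a by simp
    qed
    then obtain K :: "int \<times> int \<Rightarrow> real" where K: "\<And>v Q Q'. Q \<in> inside \<Longrightarrow> Q' \<in> inside \<Longrightarrow> corner v Q \<Longrightarrow>
      corner v Q' \<Longrightarrow> K Q - K Q' = n v Q - n v Q'" by metis
    have "K (i, j) - K (i, j - 1) = hb i j k * ?pw (ys j) l" if a: "(i, j) \<in> inside" "(i, j - 1) \<in> inside" for i j
      using K[OF a, of "(i, j)"] m(3)[OF a] unfolding n_def by (simp add: corner_def)
    moreover have "K (i, j) - K (i - 1, j) = ?pw (xs i) k * va i j l" if a: "(i, j) \<in> inside" "(i - 1, j) \<in> inside" for i j
      using K[OF a, of "(i, j)"] m(1)[OF a] unfolding n_def by (simp add: corner_def)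
    ultimately show ?thesis by (intro exI[of _ K]) simp
  qed
  then obtain K :: "nat \<Rightarrow> nat \<Rightarrow> int \<times> int \<Rightarrow> real" where
    Kh: "\<And>k l i j. (i, j) \<in> inside \<Longrightarrow> (i, j - 1) \<in> inside \<Longrightarrow> K k l (i, j) - K k l (i, j - 1) = hb i j k * ?pw (ys j) l" and
    Kv: "\<And>k l i j. (i, j) \<in> inside \<Longrightarrow> (i - 1, j) \<in> inside \<Longrightarrow> K k l (i, j) - K k l (i - 1, j) = ?pw (xs i) k * va i j l"
    by metis
  have Kown: "K k l Q = K k l Q'" if "Q \<in> inside" "Q' \<in> inside" "own Q = own Q'" for k l Q Q'
  proof (rule own_connected[OF _ _ that])
    fix i j assume a: "(i, j) \<in> inside" "(i - 1, j) \<in> inside" "own (i, j) = own (i - 1, j)"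
    then have "\<not> act_v i j" unfolding act_v_def by simp
    then show "K k l (i, j) = K k l (i - 1, j)" using Kv[OF a(1,2), of k l] va0 by simp
  next
    fix i j assume a: "(i, j) \<in> inside" "(i, j - 1) \<in> inside" "own (i, j) = own (i, j - 1)"
    then have "\<not> act_h i j" unfolding act_h_def by simp
    then show "K k l (i, j) = K k l (i, j - 1)" using Kh[OF a(1,2), of k l] hb0 by simp
  qed
  define rep where "rep = (\<lambda>f. SOME Q. Q \<in> inside \<and> own Q = f)"
  have rep: "rep f \<in> inside \<and> own (rep f) = f" if f: "f \<in> cells M" for f
  proof -
    obtain a b c e where abce: "a < b" "c < e" "f = {xs a..xs b} \<times> {ys c..ys e}" using cells_on_grid[OF f] by metis
    have "gc (a, c) \<subseteq> f" unfolding abce(3) gc_subset_iff using abce by simp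
    then have "\<exists>Q. Q \<in> inside \<and> own Q = f" using insideI[OF f] own_eqI[OF f] by metis
    then show ?thesis unfolding rep_def by (rule someI_ex)
  qed
  define c where "c = (\<lambda>(f, k, l). if f \<in> cells M \<and> k \<le> d \<and> l \<le> d
    then K k l (rep f) - K k l (rep f0) + w k l else 0)"
  have cown: "c (own Q, k, l) = K k l Q - K k l (rep f0) + w k l" if "Q \<in> inside" "k \<le> d" "l \<le> d" for Q k l
    using own_cell[OF that(1)] rep[of "own Q"] Kown[of "rep (own Q)" Q k l] that unfolding c_def by simp
  have c0: "c (f, k, l) = 0" if "f \<notin> cells M \<or> k > d \<or> l > d" for f k l
    using that unfolding c_def by auto
  have h: "c (own (i, j), k, l) - c (own (i, j - 1), k, l) = hb i j k * ?pw (ys j) l"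
    if "(i, j) \<in> inside" "(i, j - 1) \<in> inside" "k \<le> d" "l \<le> d" for i j k l
    using cown[OF that(1,3,4)] cown[OF that(2,3,4)] Kh[OF that(1,2), of k l] by simp
  have v: "c (own (i, j), k, l) - c (own (i - 1, j), k, l) = ?pw (xs i) k * va i j l"
    if "(i, j) \<in> inside" "(i - 1, j) \<in> inside" "k \<le> d" "l \<le> d" for i j k l
    using cown[OF that(1,3,4)] cown[OF that(2,3,4)] Kv[OF that(1,2), of k l] by simp
  have h': "c (own (i, j), k, l) - c (own (i, j - 1), k, l) =
      (c (own (i, j), k, d) - c (own (i, j - 1), k, d)) * ?pw (ys j) l"
    if "(i, j) \<in> inside" "(i, j - 1) \<in> inside" for i j k l
  proof (cases "k \<le> d \<and> l \<le> d")
    case True then show ?thesis using h[OF that, of k l] h[OF that, of k d] by simp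
  qed (use c0 shifted_power_beyond in auto)
  have v': "c (own (i, j), k, l) - c (own (i - 1, j), k, l) =
      ?pw (xs i) k * (c (own (i, j), d, l) - c (own (i - 1, j), d, l))"
    if "(i, j) \<in> inside" "(i - 1, j) \<in> inside" for i j k l
  proof (cases "k \<le> d \<and> l \<le> d")
    case True then show ?thesis using v[OF that, of k l] v[OF that, of d l] by simp
  qed (use c0 shifted_power_beyond in auto)
  have "c \<in> coeff_space d" unfolding coeff_space_def using c0 h' v' by blast
  moreover have "c (f0, k, l) = w k l" if "k \<le> d" "l \<le> d" for k l
    unfolding c_def using that f0 by simp
  ultimately show ?thesis using h v by (intro bexI[of _ c]) auto
qed

end

section \<open>The dimension formula\<close>

text \<open>The coefficients of \<open>(t - x) ^ d\<close> are the powers of \<open>x\<close> in reverse order, up to nonzero factors.\<close>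

lemma moments_iff:
  fixes x \<delta> :: "'i \<Rightarrow> real"
  shows "(\<forall>k\<le>d. (\<Sum>i\<in>A. x i ^ k * \<delta> i) = 0) \<longleftrightarrow> (\<forall>k\<le>d. (\<Sum>i\<in>A. \<delta> i * shifted_power d (x i) k) = 0)"
proof -
  have e: "(\<Sum>i\<in>A. \<delta> i * shifted_power d (x i) k) =
      of_nat (d choose k) * (- 1) ^ (d - k) * (\<Sum>i\<in>A. x i ^ (d - k) * \<delta> i)" for k
    unfolding shifted_power_def power_minus[of "x _"] sum_distrib_left
    by (intro sum.cong refl) (simp add: mult.commute mult.left_commute)
  show ?thesis
  proof (intro iffI allI impI)
    fix k assume "\<forall>k\<le>d. (\<Sum>i\<in>A. x i ^ k * \<delta> i) = 0" "k \<le> d"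
    then show "(\<Sum>i\<in>A. \<delta> i * shifted_power d (x i) k) = 0" unfolding e by simp
  next
    fix k assume a: "\<forall>k\<le>d. (\<Sum>i\<in>A. \<delta> i * shifted_power d (x i) k) = 0" "k \<le> d"
    then have "(\<Sum>i\<in>A. \<delta> i * shifted_power d (x i) (d - k)) = 0" by simp
    then have "of_nat (d choose (d - k)) * (- 1) ^ (d - (d - k)) * (\<Sum>i\<in>A. x i ^ (d - (d - k)) * \<delta> i) = 0"
      unfolding e .
    moreover have "d - (d - k) = k" using a(2) by simp
    moreover have "d choose (d - k) \<noteq> 0" by simp
    ultimately show "(\<Sum>i\<in>A. x i ^ k * \<delta> i) = 0" by simp
  qed
qed

text \<open>The data that determine a spline: the coefficients of the polynomial on one cell, the coefficients of
  the cofactor at the start of each cross-cut, and the number attached to each interior vertex.\<close>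

datatype dof = Base nat nat | Cut "point set" nat | Vert point

definition dofs :: "nat \<Rightarrow> tmesh \<Rightarrow> dof set" where
  "dofs d M = {Base k l |k l. k \<le> d \<and> l \<le> d} \<union> {Cut l k |l k. l \<in> cross_cuts M \<and> k \<le> d} \<union>
    Vert ` interior_vertices M"

definition vertex_part :: "(point \<Rightarrow> real) \<Rightarrow> dof \<Rightarrow> real" where
  "vertex_part u t = (case t of Vert v \<Rightarrow> u v | _ \<Rightarrow> 0)"

lemma vertex_part_simps [simp]: "vertex_part u (Vert v) = u v" "vertex_part u (Base k l) = 0"
  "vertex_part u (Cut e k) = 0"
  unfolding vertex_part_def by simp_all

definition conformality_row :: "tmesh \<Rightarrow> point set \<times> nat \<Rightarrow> point \<Rightarrow> real" where
  "conformality_row M r = (\<lambda>v. if v \<in> T_vertices M then conformality_matrix r v else 0)"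

text \<open>Extending the rows of the matrix by zero to all data does not change their rank.\<close>

lemma conformality_rank_eq:
  "conformality_rank d M = fun_vs.dim (vertex_part ` conformality_row M ` (T_l_edges M \<times> {..d}))"
proof -
  let ?X = "conformality_row M ` (T_l_edges M \<times> {..d})"
  interpret vp: vector_space_pair "fun_scale :: real \<Rightarrow> (point \<Rightarrow> real) \<Rightarrow> _"
      "fun_scale :: real \<Rightarrow> (dof \<Rightarrow> real) \<Rightarrow> _"
    by unfold_locales
  have lin: "Vector_Spaces.linear fun_scale fun_scale vertex_part"
    by unfold_locales (auto simp: fun_eq_iff fun_scale_def vertex_part_def split: dof.splits)
  have inj: "inj_on vertex_part S" for S
    by (rule inj_onI) (metis ext vertex_part_simps(1))
  have "fun_vs.dim (vertex_part ` ?X) = fun_vs.dim (fun_vs.span (vertex_part ` ?X))" by simp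
  also have "\<dots> = fun_vs.dim (vertex_part ` fun_vs.span ?X)"
    using vp.linear_span_image[OF lin, of ?X] by simp
  also have "\<dots> = fun_vs.dim (fun_vs.span ?X)"
    by (rule dim_linear_image[OF lin fun_vs.subspace_span inj])
  finally show ?thesis unfolding conformality_rank_def matrix_rank_def conformality_row_def[abs_def] by simp
qed

context grid_mesh
begin

lemma finite_interior_l_edges: "finite (interior_l_edges M)"
proof -
  have "interior_l_edges M \<subseteq> Union ` Pow (interior_edges M)"
    unfolding interior_l_edges_def maximal_segments_def segments_def by auto
  then show ?thesis using interior_edges_finite(1) by (meson finite_Pow_iff finite_imageI finite_subset)
qed

lemma finite_vertices: "finite (vertices M)"
proof -
  have "finite (endpoints l)" if "l \<in> edges M" for l
  proof (cases "horizontal l")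
    case True
    then obtain a b y where "a < b" "l = {a..b} \<times> {y}" unfolding horizontal_def by auto
    then show ?thesis by (simp add: endpoints_horizontal)
  next
    case False
    then obtain x a b where "a < b" "l = {x} \<times> {a..b}" using edge_cases[OF \<open>l \<in> edges M\<close>] unfolding vertical_def by auto
    then show ?thesis by (simp add: endpoints_vertical)
  qed
  then show ?thesis unfolding vertices_def using finite_edges by simp
qed

lemma finite_interior_vertices: "finite (interior_vertices M)"
  unfolding interior_vertices_def using finite_vertices by simp

lemma finite_cross_cuts: "finite (cross_cuts M)" and finite_T_l_edges: "finite (T_l_edges M)"
  unfolding cross_cuts_def T_l_edges_def using finite_interior_l_edges by simp_all

lemma finite_dofs: "finite (dofs d M)" and card_dofs:
  "card (dofs d M) = (d + 1)\<^sup>2 + (d + 1) * card (cross_cuts M) + card (interior_vertices M)"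
proof -
  have B: "{Base k l |k l. k \<le> d \<and> l \<le> d} = (\<lambda>(k, l). Base k l) ` ({..d} \<times> {..d})" by auto
  have C: "{Cut l k |l k. l \<in> cross_cuts M \<and> k \<le> d} = (\<lambda>(l, k). Cut l k) ` (cross_cuts M \<times> {..d})" by auto
  have iB: "inj_on (\<lambda>(k, l). Base k l) ({..d} \<times> {..d})" and iC: "inj_on (\<lambda>(l, k). Cut l k) (cross_cuts M \<times> {..d})"
    and iV: "inj_on Vert (interior_vertices M)" by (auto simp: inj_on_def)
  have fin: "finite {Base k l |k l. k \<le> d \<and> l \<le> d}" "finite {Cut l k |l k. l \<in> cross_cuts M \<and> k \<le> d}"
    "finite (Vert ` interior_vertices M)"
    unfolding B C using finite_cross_cuts finite_interior_vertices by simp_all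
  then show "finite (dofs d M)" unfolding dofs_def by simp
  have cards: "card {Base k l |k l. k \<le> d \<and> l \<le> d} = (d + 1)\<^sup>2"
    "card {Cut l k |l k. l \<in> cross_cuts M \<and> k \<le> d} = (d + 1) * card (cross_cuts M)"
    "card (Vert ` interior_vertices M) = card (interior_vertices M)"
    unfolding B C card_image[OF iB] card_image[OF iC] card_image[OF iV]
    by (simp_all add: card_cartesian_product power2_eq_square)
  have "card (dofs d M) = card ({Base k l |k l. k \<le> d \<and> l \<le> d} \<union> {Cut l k |l k. l \<in> cross_cuts M \<and> k \<le> d}) +
      card (Vert ` interior_vertices M)"
    unfolding dofs_def using fin by (intro card_Un_disjoint) auto
  also have "card ({Base k l |k l. k \<le> d \<and> l \<le> d} \<union> {Cut l k |l k. l \<in> cross_cuts M \<and> k \<le> d}) =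
      card {Base k l |k l. k \<le> d \<and> l \<le> d} + card {Cut l k |l k. l \<in> cross_cuts M \<and> k \<le> d}"
    using fin by (intro card_Un_disjoint) auto
  finally show "card (dofs d M) = (d + 1)\<^sup>2 + (d + 1) * card (cross_cuts M) + card (interior_vertices M)"
    unfolding cards .
qed

lemma run_h_classify:
  assumes "run_h a b j"
  shows "seg_h a b j \<in> cross_cuts M \<longleftrightarrow> \<not> interior_point a j \<and> \<not> interior_point b j"
    and "seg_h a b j \<in> T_l_edges M \<longleftrightarrow> interior_point a j \<and> interior_point b j"
proof -
  have "a < b" using assms unfolding run_h_def by simp
  then have e: "endpoints (seg_h a b j) = {(xs a, ys j), (xs b, ys j)}"
    unfolding seg_h_def by (simp add: endpoints_horizontal)
  show "seg_h a b j \<in> cross_cuts M \<longleftrightarrow> \<not> interior_point a j \<and> \<not> interior_point b j"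
    unfolding cross_cuts_def mem_Collect_eq e boundary_vertices_def
    using run_l_edge[OF assms] run_h_endpoints[OF assms] by simp
  show "seg_h a b j \<in> T_l_edges M \<longleftrightarrow> interior_point a j \<and> interior_point b j"
    unfolding T_l_edges_def mem_Collect_eq e interior_vertices_def
    using run_l_edge[OF assms] run_h_endpoints[OF assms] by simp
qed

lemma run_v_classify:
  assumes "run_v a b i"
  shows "seg_v a b i \<in> cross_cuts M \<longleftrightarrow> \<not> interior_point i a \<and> \<not> interior_point i b"
    and "seg_v a b i \<in> T_l_edges M \<longleftrightarrow> interior_point i a \<and> interior_point i b"
proof -
  interpret T: grid_mesh "transpose_mesh M" ys xs by (rule transposed)
  have "T.run_h a b i" using assms unfolding transposed_run .
  from T.run_h_endpoints[OF this] have v: "(xs i, ys a) \<in> vertices M" "(xs i, ys b) \<in> vertices M"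
    unfolding vertices_transpose Pair_in_flip .
  have "a < b" using assms unfolding run_v_def by simp
  then have e: "endpoints (seg_v a b i) = {(xs i, ys a), (xs i, ys b)}"
    unfolding seg_v_def by (simp add: endpoints_vertical)
  show "seg_v a b i \<in> cross_cuts M \<longleftrightarrow> \<not> interior_point i a \<and> \<not> interior_point i b"
    unfolding cross_cuts_def mem_Collect_eq e boundary_vertices_def
    using run_v_l_edge[OF assms] v by simp
  show "seg_v a b i \<in> T_l_edges M \<longleftrightarrow> interior_point i a \<and> interior_point i b"
    unfolding T_l_edges_def mem_Collect_eq e interior_vertices_def
    using run_v_l_edge[OF assms] v by simp
qed

lemma seg_h_inj: "a < b \<Longrightarrow> seg_h a b j = seg_h a' b' j' \<Longrightarrow> a' < b' \<Longrightarrow> a = a' \<and> b = b' \<and> j = j'"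
proof -
  assume a: "a < b" "seg_h a b j = seg_h a' b' j'" "a' < b'"
  have "(xs a, ys j) \<in> seg_h a' b' j'" "(xs b, ys j) \<in> seg_h a' b' j'" unfolding a(2)[symmetric] using a(1) by simp_all
  moreover have "(xs a', ys j') \<in> seg_h a b j" "(xs b', ys j') \<in> seg_h a b j" unfolding a(2) using a(3) by simp_all
  ultimately show ?thesis by simp
qed

lemma seg_v_inj: "a < b \<Longrightarrow> seg_v a b j = seg_v a' b' j' \<Longrightarrow> a' < b' \<Longrightarrow> a = a' \<and> b = b' \<and> j = j'"
proof -
  assume a: "a < b" "seg_v a b j = seg_v a' b' j'" "a' < b'"
  have "(xs j, ys a) \<in> seg_v a' b' j'" "(xs j, ys b) \<in> seg_v a' b' j'" unfolding a(2)[symmetric] using a(1) by simp_all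
  moreover have "(xs j', ys a') \<in> seg_v a b j" "(xs j', ys b') \<in> seg_v a b j" unfolding a(2) using a(3) by simp_all
  ultimately show ?thesis by simp
qed

lemma seg_v_not_horizontal: "a < b \<Longrightarrow> \<not> horizontal (seg_v a b i)"
proof
  assume "a < b" "horizontal (seg_v a b i)"
  moreover have "vertical (seg_v a b i)" unfolding seg_v_def vertical_def using \<open>a < b\<close> ys_less by metis
  ultimately show False using horizontal_not_vertical by metis
qed

definition start_h :: "point set \<Rightarrow> int \<times> int" where
  "start_h l = (SOME p. \<exists>b. fst p < b \<and> l = seg_h (fst p) b (snd p))"

definition start_v :: "point set \<Rightarrow> int \<times> int" where
  "start_v l = (SOME p. \<exists>b. fst p < b \<and> l = seg_v (fst p) b (snd p))"

lemma start_h: "a < b \<Longrightarrow> start_h (seg_h a b j) = (a, j)"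
proof -
  assume ab: "a < b"
  have "\<exists>b'. fst (start_h (seg_h a b j)) < b' \<and>
      seg_h a b j = seg_h (fst (start_h (seg_h a b j))) b' (snd (start_h (seg_h a b j)))"
    unfolding start_h_def by (rule someI[of _ "(a, j)"]) (use ab in auto)
  then show ?thesis using seg_h_inj[OF ab] by (metis prod.collapse)
qed

lemma start_v: "a < b \<Longrightarrow> start_v (seg_v a b i) = (a, i)"
proof -
  assume ab: "a < b"
  have "\<exists>b'. fst (start_v (seg_v a b i)) < b' \<and>
      seg_v a b i = seg_v (fst (start_v (seg_v a b i))) b' (snd (start_v (seg_v a b i)))"
    unfolding start_v_def by (rule someI[of _ "(a, i)"]) (use ab in auto)
  then show ?thesis using seg_v_inj[OF ab] by (metis prod.collapse)
qed

definition h_cofactor :: "nat \<Rightarrow> (point set \<times> nat \<times> nat \<Rightarrow> real) \<Rightarrow> int \<Rightarrow> int \<Rightarrow> nat \<Rightarrow> real" where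
  "h_cofactor d c i j k = c (own (i, j), k, d) - c (own (i, j - 1), k, d)"

definition v_cofactor :: "nat \<Rightarrow> (point set \<times> nat \<times> nat \<Rightarrow> real) \<Rightarrow> int \<Rightarrow> int \<Rightarrow> nat \<Rightarrow> real" where
  "v_cofactor d c i j l = c (own (i, j), d, l) - c (own (i - 1, j), d, l)"

definition vertex_cofactor :: "nat \<Rightarrow> (point set \<times> nat \<times> nat \<Rightarrow> real) \<Rightarrow> int \<Rightarrow> int \<Rightarrow> real" where
  "vertex_cofactor d c i j = c (own (i, j), d, d) - c (own (i - 1, j), d, d) +
    c (own (i - 1, j - 1), d, d) - c (own (i, j - 1), d, d)"

definition column_index :: "real \<Rightarrow> int" where "column_index x = (THE i. xs i = x)"
definition row_index :: "real \<Rightarrow> int" where "row_index y = (THE j. ys j = y)"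

lemma column_index [simp]: "column_index (xs i) = i" and row_index [simp]: "row_index (ys j) = j"
  unfolding column_index_def row_index_def by (simp_all add: the_equality)

definition dof_values :: "nat \<Rightarrow> point set \<Rightarrow> (point set \<times> nat \<times> nat \<Rightarrow> real) \<Rightarrow> dof \<Rightarrow> real" where
  "dof_values d f0 c t = (if t \<in> dofs d M then (case t of
      Base k l \<Rightarrow> c (f0, k, l)
    | Cut l k \<Rightarrow> (if horizontal l then h_cofactor d c (fst (start_h l)) (snd (start_h l)) k
        else v_cofactor d c (snd (start_v l)) (fst (start_v l)) k)
    | Vert v \<Rightarrow> vertex_cofactor d c (column_index (fst v)) (row_index (snd v))) else 0)"

lemma linear_dof_values: "Vector_Spaces.linear fun_scale fun_scale (dof_values d f0)"
  by unfold_locales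
    (auto simp: fun_eq_iff dof_values_def h_cofactor_def v_cofactor_def vertex_cofactor_def fun_scale_def
      algebra_simps split: dof.splits)

text \<open>Going around an interior vertex, the jumps cancel: \<open>(b - b') \<otimes> (y - ys j) ^ d\<close> equals
  \<open>(x - xs i) ^ d \<otimes> (a - a')\<close> for the cofactors \<open>b, b'\<close> of the horizontal and \<open>a, a'\<close> of the vertical
  segments. Comparing the leading coefficients in one variable gives both differences.\<close>

lemma cofactor_steps:
  assumes c: "c \<in> coeff_space d" and p: "interior_point i j"
  shows "h_cofactor d c i j k - h_cofactor d c (i - 1) j k = vertex_cofactor d c i j * shifted_power d (xs i) k"
    and "v_cofactor d c i j l - v_cofactor d c i (j - 1) l = vertex_cofactor d c i j * shifted_power d (ys j) l"
proof -
  have ins: "(i, j) \<in> inside" "(i - 1, j) \<in> inside" "(i - 1, j - 1) \<in> inside" "(i, j - 1) \<in> inside"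
    using p unfolding interior_vertex_iff by simp_all
  have e: "(h_cofactor d c i j k - h_cofactor d c (i - 1) j k) * shifted_power d (ys j) l =
      shifted_power d (xs i) k * (v_cofactor d c i j l - v_cofactor d c i (j - 1) l)" for k l
    unfolding h_cofactor_def v_cofactor_def left_diff_distrib right_diff_distrib[of "shifted_power d (xs i) k"]
    using coeff_space_h[OF c ins(1,4), of k l] coeff_space_h[OF c ins(2,3), of k l]
      coeff_space_v[OF c ins(1,2), of k l] coeff_space_v[OF c ins(4,3), of k l]
    by (simp add: algebra_simps)
  have vd: "v_cofactor d c i j d - v_cofactor d c i (j - 1) d = vertex_cofactor d c i j"
    "h_cofactor d c i j d - h_cofactor d c (i - 1) j d = vertex_cofactor d c i j"
    unfolding h_cofactor_def v_cofactor_def vertex_cofactor_def by simp_all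
  show "h_cofactor d c i j k - h_cofactor d c (i - 1) j k = vertex_cofactor d c i j * shifted_power d (xs i) k"
    using e[of k d] unfolding vd by (simp add: mult.commute)
  show "v_cofactor d c i j l - v_cofactor d c i (j - 1) l = vertex_cofactor d c i j * shifted_power d (ys j) l"
    using e[of d l] unfolding vd by (simp add: mult.commute)
qed

lemma cofactor_inactive:
  "(i, j) \<in> inside \<Longrightarrow> (i, j - 1) \<in> inside \<Longrightarrow> \<not> act_h i j \<Longrightarrow> h_cofactor d c i j k = 0"
  "(i, j) \<in> inside \<Longrightarrow> (i - 1, j) \<in> inside \<Longrightarrow> \<not> act_v i j \<Longrightarrow> v_cofactor d c i j l = 0"
  unfolding h_cofactor_def v_cofactor_def act_h_def act_v_def by simp_all

text \<open>At a grid point in the domain that is no vertex, the two horizontal or the two vertical unit segments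
  are inactive.\<close>

lemma vertex_cofactor_zero:
  assumes c: "c \<in> coeff_space d" and p: "interior_point i j" and n: "(xs i, ys j) \<notin> interior_vertices M"
  shows "vertex_cofactor d c i j = 0"
proof -
  have ins: "(i, j) \<in> inside" "(i - 1, j) \<in> inside" "(i - 1, j - 1) \<in> inside" "(i, j - 1) \<in> inside"
    using p unfolding interior_vertex_iff by simp_all
  have "\<not> act_h (i - 1) j \<and> \<not> act_h i j \<or> \<not> act_v i (j - 1) \<and> \<not> act_v i j"
    using n p unfolding interior_vertices_iff by simp
  then show ?thesis
  proof
    assume "\<not> act_h (i - 1) j \<and> \<not> act_h i j"
    then have "h_cofactor d c i j d = 0" "h_cofactor d c (i - 1) j d = 0"
      using cofactor_inactive(1)[OF ins(1,4)] cofactor_inactive(1)[OF ins(2,3)] by simp_all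
    then show ?thesis using cofactor_steps(1)[OF c p, of d] by simp
  next
    assume "\<not> act_v i (j - 1) \<and> \<not> act_v i j"
    then have "v_cofactor d c i j d = 0" "v_cofactor d c i (j - 1) d = 0"
      using cofactor_inactive(2)[OF ins(1,2)] cofactor_inactive(2)[OF ins(4,3)] by simp_all
    then show ?thesis using cofactor_steps(2)[OF c p, of d] by simp
  qed
qed

lemma dof_values_Base: "k \<le> d \<Longrightarrow> l \<le> d \<Longrightarrow> dof_values d f0 c (Base k l) = c (f0, k, l)"
  unfolding dof_values_def dofs_def by simp

lemma dof_values_Vert: "dof_values d f0 c (Vert (xs i, ys j)) =
    (if (xs i, ys j) \<in> interior_vertices M then vertex_cofactor d c i j else 0)"
  unfolding dof_values_def dofs_def by (auto simp: image_iff)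

lemma dof_values_Cut_h:
  assumes "run_h a b j" "\<not> interior_point a j" "\<not> interior_point b j" "k \<le> d"
  shows "Cut (seg_h a b j) k \<in> dofs d M" "dof_values d f0 c (Cut (seg_h a b j) k) = h_cofactor d c a j k"
proof -
  have ab: "a < b" using assms(1) unfolding run_h_def by simp
  show D: "Cut (seg_h a b j) k \<in> dofs d M"
    unfolding dofs_def using run_h_classify(1)[OF assms(1)] assms by simp
  show "dof_values d f0 c (Cut (seg_h a b j) k) = h_cofactor d c a j k"
    using D unfolding dof_values_def by (simp add: start_h[OF ab] seg_h_horizontal[OF ab])
qed

lemma dof_values_Cut_v:
  assumes "run_v a b i" "\<not> interior_point i a" "\<not> interior_point i b" "k \<le> d"
  shows "Cut (seg_v a b i) k \<in> dofs d M" "dof_values d f0 c (Cut (seg_v a b i) k) = v_cofactor d c i a k"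
proof -
  have ab: "a < b" using assms(1) unfolding run_v_def by simp
  show D: "Cut (seg_v a b i) k \<in> dofs d M"
    unfolding dofs_def using run_v_classify(1)[OF assms(1)] assms by simp
  show "dof_values d f0 c (Cut (seg_v a b i) k) = v_cofactor d c i a k"
    using D unfolding dof_values_def by (simp add: start_v[OF ab] seg_v_not_horizontal[OF ab])
qed

lemma dofs_cases:
  assumes "t \<in> dofs d M"
  obtains (base) k l where "t = Base k l" "k \<le> d" "l \<le> d"
  | (cut_h) a b j k where "t = Cut (seg_h a b j) k" "run_h a b j" "\<not> interior_point a j" "\<not> interior_point b j" "k \<le> d"
  | (cut_v) a b i k where "t = Cut (seg_v a b i) k" "run_v a b i" "\<not> interior_point i a" "\<not> interior_point i b" "k \<le> d"
  | (vert) i j where "t = Vert (xs i, ys j)" "(xs i, ys j) \<in> interior_vertices M"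
proof (cases t)
  case (Base k l)
  then show ?thesis using base assms unfolding dofs_def by auto
next
  case (Vert v)
  then have v: "v \<in> interior_vertices M" using assms unfolding dofs_def by auto
  then have "v \<in> vertices M" unfolding interior_vertices_def by simp
  then obtain i j where "v = (xs i, ys j)" by (rule vertex_on_grid)
  then show ?thesis using vert v Vert by metis
next
  case (Cut l k)
  then have l: "l \<in> cross_cuts M" "k \<le> d" using assms unfolding dofs_def by auto
  then have li: "l \<in> interior_l_edges M" unfolding cross_cuts_def by simp
  show ?thesis
  proof (cases "horizontal l")
    case True
    obtain a b j where "run_h a b j" "l = seg_h a b j" using horizontal_l_edge_run[OF li True] by metis
    then show ?thesis using cut_h[of a b j k] run_h_classify(1)[of a b j] l Cut by simp
  next
    case False
    then have v: "vertical l" using interior_l_edge_cases[OF li] by simp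
    obtain a b i where "run_v a b i" "l = seg_v a b i" using vertical_l_edge_run[OF li v] by metis
    then show ?thesis using cut_v[of a b i k] run_v_classify(1)[of a b i] l Cut by simp
  qed
qed

text \<open>Without vertex data and starting values all cofactors vanish, so the pieces on adjacent cells agree, and
  all pieces equal the one on the base cell.\<close>

lemma dof_values_inj:
  assumes c: "c \<in> coeff_space d" and f0: "f0 \<in> cells M" and z: "dof_values d f0 c = 0"
  shows "c = 0"
proof -
  have vz: "vertex_cofactor d c i j = 0" if "interior_point i j" for i j
    using vertex_cofactor_zero[OF c that] dof_values_Vert[of d f0 c i j] z by (auto split: if_splits)
  have h: "h_cofactor d c i j k = 0" if act: "act_h i j" and k: "k \<le> d" for i j k
  proof (rule cofactors_vanish[of "\<lambda>i j. h_cofactor d c i j k", OF _ _ _ act])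
    show "h_cofactor d c i j k - h_cofactor d c (i - 1) j k = 0" if "interior_point i j" for i j
      using cofactor_steps(1)[OF c that] vz[OF that] by simp
    show "h_cofactor d c i j k = 0" if "(i, j) \<in> inside" "(i, j - 1) \<in> inside" "\<not> act_h i j" for i j
      by (rule cofactor_inactive(1)[OF that])
    show "h_cofactor d c a j k = 0" if "run_h a b j" "\<not> interior_point a j" "\<not> interior_point b j" for a b j
      using dof_values_Cut_h(2)[OF that k, of f0 c] z by simp
  qed
  have v: "v_cofactor d c i j k = 0" if act: "act_v i j" and k: "k \<le> d" for i j k
  proof (rule cofactors_vanish_v[of "\<lambda>i j. v_cofactor d c i j k", OF _ _ _ act])
    show "v_cofactor d c i j k - v_cofactor d c i (j - 1) k = 0" if "interior_point i j" for i j
      using cofactor_steps(2)[OF c that] vz[OF that] by simp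
    show "v_cofactor d c i j k = 0" if "(i, j) \<in> inside" "(i - 1, j) \<in> inside" "\<not> act_v i j" for i j
      by (rule cofactor_inactive(2)[OF that])
    show "v_cofactor d c i a k = 0" if "run_v a b i" "\<not> interior_point i a" "\<not> interior_point i b" for a b i
      using dof_values_Cut_v(2)[OF that k, of f0 c] z by simp
  qed
  have const: "c (own Q, k, l) = c (own Q', k, l)" if "Q \<in> inside" "Q' \<in> inside" "k \<le> d" "l \<le> d" for Q Q' k l
  proof (rule edge_connected[of "\<lambda>Q. c (own Q, k, l)", OF _ _ that(1,2)])
    fix i j assume ij: "(i, j) \<in> inside" "(i - 1, j) \<in> inside"
    have "v_cofactor d c i j l = 0" using v[OF _ that(4)] cofactor_inactive(2)[OF ij] by metis
    then show "c (own (i, j), k, l) = c (own (i - 1, j), k, l)"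
      using coeff_space_v[OF c ij, of k l] unfolding v_cofactor_def by simp
  next
    fix i j assume ij: "(i, j) \<in> inside" "(i, j - 1) \<in> inside"
    have "h_cofactor d c i j k = 0" using h[OF _ that(3)] cofactor_inactive(1)[OF ij] by metis
    then show "c (own (i, j), k, l) = c (own (i, j - 1), k, l)"
      using coeff_space_h[OF c ij, of k l] unfolding h_cofactor_def by simp
  qed
  have rep: "\<exists>Q\<in>inside. own Q = f" if "f \<in> cells M" for f
  proof -
    obtain a b e g where f: "a < b" "e < g" "f = {xs a..xs b} \<times> {ys e..ys g}"
      using cells_on_grid[OF \<open>f \<in> cells M\<close>] by metis
    have "(xs a, ys e) \<in> f" unfolding f(3) using f(1,2) by simp
    then show ?thesis using cell_covered[OF that] by metis
  qed
  have "c (f, k, l) = 0" for f k l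
  proof (cases "f \<in> cells M \<and> k \<le> d \<and> l \<le> d")
    case True
    obtain Q where Q: "Q \<in> inside" "own Q = f" using rep True by metis
    obtain Q0 where Q0: "Q0 \<in> inside" "own Q0 = f0" using rep f0 by metis
    have "c (f, k, l) = c (f0, k, l)" using const[OF Q(1) Q0(1), of k l] Q(2) Q0(2) True by simp
    also have "\<dots> = 0" using dof_values_Base[of k d l f0 c] z True by simp
    finally show ?thesis .
  qed (use coeff_space_zero[OF c, of f k l] in auto)
  then show ?thesis by (simp add: fun_eq_iff)
qed

definition dof_equations :: "nat \<Rightarrow> (dof \<Rightarrow> real) set" where
  "dof_equations d = vertex_part ` conformality_row M ` (T_l_edges M \<times> {..d})"

definition dof_space :: "nat \<Rightarrow> (dof \<Rightarrow> real) set" where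
  "dof_space d = {z. (\<forall>t. t \<notin> dofs d M \<longrightarrow> z t = 0) \<and> (\<forall>r\<in>dof_equations d. pairing (dofs d M) r z = 0)}"

lemma T_vertices_interior: "T_vertices M \<subseteq> interior_vertices M"
proof
  fix v assume "v \<in> T_vertices M"
  then obtain l where v: "v \<in> vertices M" "l \<in> T_l_edges M" "v \<in> l" unfolding T_vertices_def by auto
  obtain i j where ij: "v = (xs i, ys j)" using vertex_on_grid[OF v(1)] by metis
  have li: "l \<in> interior_l_edges M" using v(2) unfolding T_l_edges_def by simp
  have "interior_point i j"
  proof (cases "horizontal l")
    case True
    obtain a b j' where r: "run_h a b j'" "l = seg_h a b j'" using horizontal_l_edge_run[OF li True] by metis
    have "j' = j" "a \<le> i" "i \<le> b" using v(3) unfolding ij r(2) by simp_all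
    then show ?thesis using run_h_classify(2)[OF r(1)] v(2) interior_point_in_run[OF r(1), of i] unfolding r(2)
      by (cases "i = a \<or> i = b") auto
  next
    case False
    then have vl: "vertical l" using interior_l_edge_cases[OF li] by simp
    obtain a b i' where r: "run_v a b i'" "l = seg_v a b i'" using vertical_l_edge_run[OF li vl] by metis
    have ii: "i' = i" "a \<le> j" "j \<le> b" using v(3) unfolding ij r(2) by simp_all
    interpret T: grid_mesh "transpose_mesh M" ys xs by (rule transposed)
    have "interior_point i j" if "a < j" "j < b"
      using T.interior_point_in_run[of a b i j] r(1) ii(1) that
      unfolding transposed_run transposed_interior_point by simp
    then show ?thesis using run_v_classify(2)[OF r(1)] v(2) ii unfolding r(2)
      by (cases "j = a \<or> j = b") auto
  qed
  then show "v \<in> interior_vertices M" using v(1) unfolding interior_vertices_def ij by simp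
qed

lemma pairing_row:
  assumes "\<forall>t. t \<notin> dofs d M \<longrightarrow> z t = 0"
  shows "pairing (dofs d M) (vertex_part (conformality_row M (l, k))) z =
    (\<Sum>v\<in>T_vertices M \<inter> l. coord_along l v ^ k * z (Vert v))"
proof -
  have fin: "finite (T_vertices M \<inter> l)"
    using finite_subset[OF T_vertices_interior finite_interior_vertices] by simp
  have sub: "Vert ` (T_vertices M \<inter> l) \<subseteq> dofs d M" using T_vertices_interior unfolding dofs_def by auto
  have "pairing (dofs d M) (vertex_part (conformality_row M (l, k))) z =
    (\<Sum>t\<in>Vert ` (T_vertices M \<inter> l). vertex_part (conformality_row M (l, k)) t * z t)"
    unfolding pairing_def
  proof (rule sum.mono_neutral_right[OF finite_dofs sub], rule ballI)
    fix t assume "t \<in> dofs d M - Vert ` (T_vertices M \<inter> l)"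
    then have "vertex_part (conformality_row M (l, k)) t = 0"
      by (cases t) (auto simp: conformality_row_def conformality_matrix_def)
    then show "vertex_part (conformality_row M (l, k)) t * z t = 0" by simp
  qed
  also have "\<dots> = (\<Sum>v\<in>T_vertices M \<inter> l. conformality_row M (l, k) v * z (Vert v))"
    by (subst sum.reindex) (auto simp: inj_on_def)
  also have "\<dots> = (\<Sum>v\<in>T_vertices M \<inter> l. coord_along l v ^ k * z (Vert v))"
    by (rule sum.cong) (auto simp: conformality_row_def conformality_matrix_def)
  finally show ?thesis .
qed

lemma T_sum_h:
  assumes z: "\<forall>t. t \<notin> dofs d M \<longrightarrow> z t = (0 :: real)" and run: "run_h a b j" and T: "seg_h a b j \<in> T_l_edges M"
  shows "(\<Sum>v\<in>T_vertices M \<inter> seg_h a b j. coord_along (seg_h a b j) v ^ k * z (Vert v)) =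
    (\<Sum>i=a..b. xs i ^ k * z (Vert (xs i, ys j)))"
proof -
  have hor: "horizontal (seg_h a b j)" using run seg_h_horizontal unfolding run_h_def by simp
  have sub: "T_vertices M \<inter> seg_h a b j \<subseteq> (\<lambda>i. (xs i, ys j)) ` {a..b}"
  proof
    fix v assume v: "v \<in> T_vertices M \<inter> seg_h a b j"
    then have "v \<in> vertices M" unfolding T_vertices_def by simp
    then obtain i j' where "v = (xs i, ys j')" by (rule vertex_on_grid)
    then show "v \<in> (\<lambda>i. (xs i, ys j)) ` {a..b}" using v by auto
  qed
  have "(\<Sum>v\<in>T_vertices M \<inter> seg_h a b j. coord_along (seg_h a b j) v ^ k * z (Vert v)) =
      (\<Sum>v\<in>(\<lambda>i. (xs i, ys j)) ` {a..b}. coord_along (seg_h a b j) v ^ k * z (Vert v))"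
  proof (rule sum.mono_neutral_left[OF _ sub], simp, rule ballI)
    fix v assume v: "v \<in> (\<lambda>i. (xs i, ys j)) ` {a..b} - T_vertices M \<inter> seg_h a b j"
    then have "v \<in> seg_h a b j" by auto
    then have "v \<notin> vertices M" using v T unfolding T_vertices_def by auto
    then have "Vert v \<notin> dofs d M" unfolding dofs_def interior_vertices_def by auto
    then show "coord_along (seg_h a b j) v ^ k * z (Vert v) = 0" using z by simp
  qed
  also have "\<dots> = (\<Sum>i=a..b. xs i ^ k * z (Vert (xs i, ys j)))"
    by (subst sum.reindex) (auto simp: inj_on_def coord_along_def hor)
  finally show ?thesis .
qed

lemma T_sum_v:
  assumes z: "\<forall>t. t \<notin> dofs d M \<longrightarrow> z t = (0 :: real)" and run: "run_v a b i" and T: "seg_v a b i \<in> T_l_edges M"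
  shows "(\<Sum>v\<in>T_vertices M \<inter> seg_v a b i. coord_along (seg_v a b i) v ^ k * z (Vert v)) =
    (\<Sum>j=a..b. ys j ^ k * z (Vert (xs i, ys j)))"
proof -
  have hor: "\<not> horizontal (seg_v a b i)" using run seg_v_not_horizontal unfolding run_v_def by simp
  have sub: "T_vertices M \<inter> seg_v a b i \<subseteq> (\<lambda>j. (xs i, ys j)) ` {a..b}"
  proof
    fix v assume v: "v \<in> T_vertices M \<inter> seg_v a b i"
    then have "v \<in> vertices M" unfolding T_vertices_def by simp
    then obtain i' j' where "v = (xs i', ys j')" by (rule vertex_on_grid)
    then show "v \<in> (\<lambda>j. (xs i, ys j)) ` {a..b}" using v by auto
  qed
  have "(\<Sum>v\<in>T_vertices M \<inter> seg_v a b i. coord_along (seg_v a b i) v ^ k * z (Vert v)) =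
      (\<Sum>v\<in>(\<lambda>j. (xs i, ys j)) ` {a..b}. coord_along (seg_v a b i) v ^ k * z (Vert v))"
  proof (rule sum.mono_neutral_left[OF _ sub], simp, rule ballI)
    fix v assume v: "v \<in> (\<lambda>j. (xs i, ys j)) ` {a..b} - T_vertices M \<inter> seg_v a b i"
    then have "v \<in> seg_v a b i" by auto
    then have "v \<notin> vertices M" using v T unfolding T_vertices_def by auto
    then have "Vert v \<notin> dofs d M" unfolding dofs_def interior_vertices_def by auto
    then show "coord_along (seg_v a b i) v ^ k * z (Vert v) = 0" using z by simp
  qed
  also have "\<dots> = (\<Sum>j=a..b. ys j ^ k * z (Vert (xs i, ys j)))"
    by (subst sum.reindex) (auto simp: inj_on_def coord_along_def hor)
  finally show ?thesis .
qed

text \<open>The conformality equations say that on each run with two interior ends the vertex data times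
  \<open>(t - x\<^sub>i) ^ d\<close> sum up to zero.\<close>

lemma dof_space_iff:
  assumes z: "\<forall>t. t \<notin> dofs d M \<longrightarrow> z t = 0"
  shows "z \<in> dof_space d \<longleftrightarrow>
    (\<forall>a b j. run_h a b j \<longrightarrow> interior_point a j \<longrightarrow> interior_point b j \<longrightarrow>
      (\<forall>k\<le>d. (\<Sum>i=a..b. z (Vert (xs i, ys j)) * shifted_power d (xs i) k) = 0)) \<and>
    (\<forall>a b i. run_v a b i \<longrightarrow> interior_point i a \<longrightarrow> interior_point i b \<longrightarrow>
      (\<forall>k\<le>d. (\<Sum>j=a..b. z (Vert (xs i, ys j)) * shifted_power d (ys j) k) = 0))"
proof -
  have "z \<in> dof_space d \<longleftrightarrow> (\<forall>l\<in>T_l_edges M. \<forall>k\<le>d. (\<Sum>v\<in>T_vertices M \<inter> l. coord_along l v ^ k * z (Vert v)) = 0)"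
    (is "_ \<longleftrightarrow> (\<forall>l\<in>T_l_edges M. ?E l)")
    unfolding dof_space_def dof_equations_def mem_Collect_eq image_image ball_simps(9)
    using z by (auto simp: pairing_row[OF z])
  also have "\<dots> \<longleftrightarrow> (\<forall>a b j. run_h a b j \<longrightarrow> seg_h a b j \<in> T_l_edges M \<longrightarrow> ?E (seg_h a b j)) \<and>
      (\<forall>a b i. run_v a b i \<longrightarrow> seg_v a b i \<in> T_l_edges M \<longrightarrow> ?E (seg_v a b i))"
    (is "?L \<longleftrightarrow> ?R")
  proof
    assume R: ?R
    show ?L
    proof
      fix l assume l: "l \<in> T_l_edges M"
      then have li: "l \<in> interior_l_edges M" unfolding T_l_edges_def by simp
      show "?E l"
      proof (cases "horizontal l")
        case True
        obtain a b j where r: "run_h a b j" "l = seg_h a b j" using horizontal_l_edge_run[OF li True] by metis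
        show ?thesis using conjunct1[OF R] r l by simp
      next
        case False
        then have vl: "vertical l" using interior_l_edge_cases[OF li] by simp
        obtain a b i where r: "run_v a b i" "l = seg_v a b i" using vertical_l_edge_run[OF li vl] by metis
        show ?thesis using conjunct2[OF R] r l by simp
      qed
    qed
  qed simp
  also have "(\<forall>a b j. run_h a b j \<longrightarrow> seg_h a b j \<in> T_l_edges M \<longrightarrow> ?E (seg_h a b j)) \<longleftrightarrow>
    (\<forall>a b j. run_h a b j \<longrightarrow> interior_point a j \<longrightarrow> interior_point b j \<longrightarrow>
      (\<forall>k\<le>d. (\<Sum>i=a..b. z (Vert (xs i, ys j)) * shifted_power d (xs i) k) = 0))"
  proof -
    have "?E (seg_h a b j) \<longleftrightarrow> (\<forall>k\<le>d. (\<Sum>i=a..b. z (Vert (xs i, ys j)) * shifted_power d (xs i) k) = 0)"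
      if "run_h a b j" "seg_h a b j \<in> T_l_edges M" for a b j
      using T_sum_h[OF z that] moments_iff[where x = xs and \<delta> = "\<lambda>i. z (Vert (xs i, ys j))" and d = d and A = "{a..b}"]
      by simp
    note E = this
    show ?thesis
    proof (intro iff_allI)
      fix a b j
      show "(run_h a b j \<longrightarrow> seg_h a b j \<in> T_l_edges M \<longrightarrow> ?E (seg_h a b j)) \<longleftrightarrow>
        (run_h a b j \<longrightarrow> interior_point a j \<longrightarrow> interior_point b j \<longrightarrow> (\<forall>k\<le>d. (\<Sum>i=a..b. z (Vert (xs i, ys j)) * shifted_power d (xs i) k) = 0))"
        using E[of a b j] run_h_classify(2)[of a b j] by blast
    qed
  qed
  also have "(\<forall>a b i. run_v a b i \<longrightarrow> seg_v a b i \<in> T_l_edges M \<longrightarrow> ?E (seg_v a b i)) \<longleftrightarrow>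
    (\<forall>a b i. run_v a b i \<longrightarrow> interior_point i a \<longrightarrow> interior_point i b \<longrightarrow>
      (\<forall>k\<le>d. (\<Sum>j=a..b. z (Vert (xs i, ys j)) * shifted_power d (ys j) k) = 0))"
  proof -
    have "?E (seg_v a b i) \<longleftrightarrow> (\<forall>k\<le>d. (\<Sum>j=a..b. z (Vert (xs i, ys j)) * shifted_power d (ys j) k) = 0)"
      if "run_v a b i" "seg_v a b i \<in> T_l_edges M" for a b i
      using T_sum_v[OF z that] moments_iff[where x = ys and \<delta> = "\<lambda>j. z (Vert (xs i, ys j))" and d = d and A = "{a..b}"]
      by simp
    note E = this
    show ?thesis
    proof (intro iff_allI)
      fix a b j
      show "(run_v a b j \<longrightarrow> seg_v a b j \<in> T_l_edges M \<longrightarrow> ?E (seg_v a b j)) \<longleftrightarrow>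
        (run_v a b j \<longrightarrow> interior_point j a \<longrightarrow> interior_point j b \<longrightarrow> (\<forall>k\<le>d. (\<Sum>i=a..b. z (Vert (xs j, ys i)) * shifted_power d (ys i) k) = 0))"
        using E[of a b j] run_v_classify(2)[of a b j] by blast
    qed
  qed
  finally show ?thesis .
qed

lemma vertex_cofactor_dof:
  assumes "c \<in> coeff_space d" "interior_point i j"
  shows "dof_values d f0 c (Vert (xs i, ys j)) = vertex_cofactor d c i j"
  using vertex_cofactor_zero[OF assms] unfolding dof_values_Vert by simp

lemma interior_point_along_v: "run_v a b i \<Longrightarrow> a < j \<Longrightarrow> j < b \<Longrightarrow> interior_point i j"
proof -
  assume a: "run_v a b i" "a < j" "j < b"
  interpret T: grid_mesh "transpose_mesh M" ys xs by (rule transposed)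
  show "interior_point i j"
    using T.interior_point_in_run[of a b i j] a unfolding transposed_run transposed_interior_point by simp
qed

lemma dof_values_in_space:
  assumes c: "c \<in> coeff_space d" shows "dof_values d f0 c \<in> dof_space d"
proof -
  have supp: "\<forall>t. t \<notin> dofs d M \<longrightarrow> dof_values d f0 c t = 0" unfolding dof_values_def by simp
  have "(\<Sum>i=a..b. dof_values d f0 c (Vert (xs i, ys j)) * shifted_power d (xs i) k) = 0"
    if run: "run_h a b j" "interior_point a j" "interior_point b j" for a b j k
  proof -
    have ip: "interior_point i j" if "i \<in> {a..b}" for i
      using that run interior_point_in_run[OF run(1), of i] by (cases "i = a \<or> i = b") auto
    have "(\<Sum>i=a..b. dof_values d f0 c (Vert (xs i, ys j)) * shifted_power d (xs i) k) =
        (\<Sum>i=a..b. vertex_cofactor d c i j * shifted_power d (xs i) k)"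
      using vertex_cofactor_dof[OF c ip] by (intro sum.cong) simp_all
    also have "\<dots> = 0"
      using cofactors_run_sum[of "\<lambda>i j. h_cofactor d c i j k" "\<lambda>i j. vertex_cofactor d c i j * shifted_power d (xs i) k" a b j]
        cofactor_steps(1)[OF c] cofactor_inactive(1) run by simp
    finally show ?thesis .
  qed
  moreover have "(\<Sum>j=a..b. dof_values d f0 c (Vert (xs i, ys j)) * shifted_power d (ys j) k) = 0"
    if run: "run_v a b i" "interior_point i a" "interior_point i b" for a b i k
  proof -
    have ip: "interior_point i j" if "j \<in> {a..b}" for j
      using that run interior_point_along_v[OF run(1), of j] by (cases "j = a \<or> j = b") auto
    have "(\<Sum>j=a..b. dof_values d f0 c (Vert (xs i, ys j)) * shifted_power d (ys j) k) =
        (\<Sum>j=a..b. vertex_cofactor d c i j * shifted_power d (ys j) k)"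
      using vertex_cofactor_dof[OF c ip] by (intro sum.cong) simp_all
    also have "\<dots> = 0"
      using cofactors_run_sum_v[of "\<lambda>i j. v_cofactor d c i j k" "\<lambda>i j. vertex_cofactor d c i j * shifted_power d (ys j) k" a b i]
        cofactor_steps(2)[OF c] cofactor_inactive(2) run by simp
    finally show ?thesis .
  qed
  ultimately show ?thesis unfolding dof_space_iff[OF supp] by simp
qed

text \<open>The cofactors are built along the runs from the vertex data and the starting values of the
  cross-cuts; then they are integrated to coefficients.\<close>

lemma dof_values_surj:
  assumes z: "z \<in> dof_space d" and f0: "f0 \<in> cells M"
  shows "\<exists>c\<in>coeff_space d. dof_values d f0 c = z"
proof -
  have supp: "\<forall>t. t \<notin> dofs d M \<longrightarrow> z t = 0" using z unfolding dof_space_def by simp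
  define \<delta> where "\<delta> = (\<lambda>i j. z (Vert (xs i, ys j)))"
  have \<delta>0: "\<delta> i j = 0" if "(xs i, ys j) \<notin> interior_vertices M" for i j
    unfolding \<delta>_def by (rule supp[rule_format]) (use that in \<open>auto simp: dofs_def\<close>)
  have sumh: "(\<Sum>i=a..b. \<delta> i j * shifted_power d (xs i) k) = 0"
    if "run_h a b j" "interior_point a j" "interior_point b j" for a b j k
  proof (cases "k \<le> d")
    case True
    then show ?thesis using z that unfolding dof_space_iff[OF supp] \<delta>_def by simp
  qed (simp add: shifted_power_beyond)
  have sumv: "(\<Sum>j=a..b. \<delta> i j * shifted_power d (ys j) k) = 0"
    if "run_v a b i" "interior_point i a" "interior_point i b" for a b i k
  proof (cases "k \<le> d")
    case True
    then show ?thesis using z that unfolding dof_space_iff[OF supp] \<delta>_def by simp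
  qed (simp add: shifted_power_beyond)
  have "\<exists>H. (\<forall>i j. interior_point i j \<longrightarrow> H i j - H (i - 1) j = \<delta> i j * shifted_power d (xs i) k) \<and>
      (\<forall>i j. \<not> act_h i j \<longrightarrow> H i j = 0) \<and>
      (\<forall>a b j. run_h a b j \<longrightarrow> \<not> interior_point a j \<longrightarrow> \<not> interior_point b j \<longrightarrow>
        H a j = z (Cut (seg_h a (SOME b. run_h a b j) j) k))" for k
  proof (rule cofactors_exist)
    fix i j assume "interior_point i j" "\<not> act_h i j" "\<not> act_h (i - 1) j"
    then have "\<delta> i j = 0" using \<delta>0[of i j] unfolding interior_vertices_iff by simp
    then show "\<delta> i j * shifted_power d (xs i) k = 0" by simp
  qed (rule sumh)
  then obtain H where H:
    "\<And>k i j. interior_point i j \<Longrightarrow> H k i j - H k (i - 1) j = \<delta> i j * shifted_power d (xs i) k"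
    "\<And>k i j. \<not> act_h i j \<Longrightarrow> H k i j = 0"
    "\<And>k a b j. run_h a b j \<Longrightarrow> \<not> interior_point a j \<Longrightarrow> \<not> interior_point b j \<Longrightarrow>
        H k a j = z (Cut (seg_h a (SOME b. run_h a b j) j) k)"
    by metis
  have "\<exists>V. (\<forall>i j. interior_point i j \<longrightarrow> V i j - V i (j - 1) = \<delta> i j * shifted_power d (ys j) k) \<and>
      (\<forall>i j. \<not> act_v i j \<longrightarrow> V i j = 0) \<and>
      (\<forall>a b i. run_v a b i \<longrightarrow> \<not> interior_point i a \<longrightarrow> \<not> interior_point i b \<longrightarrow>
        V i a = z (Cut (seg_v a (SOME b. run_v a b i) i) k))" for k
  proof (rule cofactors_exist_v)
    fix i j assume "interior_point i j" "\<not> act_v i j" "\<not> act_v i (j - 1)"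
    then have "\<delta> i j = 0" using \<delta>0[of i j] unfolding interior_vertices_iff by simp
    then show "\<delta> i j * shifted_power d (ys j) k = 0" by simp
  qed (rule sumv)
  then obtain V where V:
    "\<And>k i j. interior_point i j \<Longrightarrow> V k i j - V k i (j - 1) = \<delta> i j * shifted_power d (ys j) k"
    "\<And>k i j. \<not> act_v i j \<Longrightarrow> V k i j = 0"
    "\<And>k a b i. run_v a b i \<Longrightarrow> \<not> interior_point i a \<Longrightarrow> \<not> interior_point i b \<Longrightarrow>
        V k i a = z (Cut (seg_v a (SOME b. run_v a b i) i) k)"
    by metis
  have run_h_end: "(SOME b. run_h a b j) = b" if run: "run_h a b j" for a b j
  proof (rule some_equality[where P = "\<lambda>b. run_h a b j", OF run])
    fix b' assume run': "run_h a b' j"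
    then show "b' = b" using run_h_unique(2)[OF run' run, of a] run unfolding run_h_def by simp
  qed
  have run_v_end: "(SOME b. run_v a b i) = b" if run: "run_v a b i" for a b i
  proof (rule some_equality[where P = "\<lambda>b. run_v a b i", OF run])
    interpret T: grid_mesh "transpose_mesh M" ys xs by (rule transposed)
    fix b' assume run': "run_v a b' i"
    show "b' = b" using T.run_h_unique(2)[of a b' i a b a] run run' unfolding transposed_run run_v_def by simp
  qed
  have "\<exists>c\<in>coeff_space d. (\<forall>k\<le>d. \<forall>l\<le>d. c (f0, k, l) = z (Base k l)) \<and>
    (\<forall>i j k l. (i, j) \<in> inside \<longrightarrow> (i, j - 1) \<in> inside \<longrightarrow> k \<le> d \<longrightarrow> l \<le> d \<longrightarrow>
      c (own (i, j), k, l) - c (own (i, j - 1), k, l) = H k i j * shifted_power d (ys j) l) \<and>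
    (\<forall>i j k l. (i, j) \<in> inside \<longrightarrow> (i - 1, j) \<in> inside \<longrightarrow> k \<le> d \<longrightarrow> l \<le> d \<longrightarrow>
      c (own (i, j), k, l) - c (own (i - 1, j), k, l) = shifted_power d (xs i) k * V l i j)"
    (is "\<exists>c\<in>coeff_space d. ?P c")
    by (rule coefficients_exist[where hb = "\<lambda>i j k. H k i j" and va = "\<lambda>i j l. V l i j" and \<delta> = \<delta>
        and w = "\<lambda>k l. z (Base k l)"]) (fact H(1) V(1) H(2) V(2) f0)+
  then obtain c where "c \<in> coeff_space d" "?P c" by (rule bexE)
  then have c: "c \<in> coeff_space d" "\<And>k l. k \<le> d \<Longrightarrow> l \<le> d \<Longrightarrow> c (f0, k, l) = z (Base k l)"
    "\<And>i j k l. (i, j) \<in> inside \<Longrightarrow> (i, j - 1) \<in> inside \<Longrightarrow> k \<le> d \<Longrightarrow> l \<le> d \<Longrightarrow>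
      c (own (i, j), k, l) - c (own (i, j - 1), k, l) = H k i j * shifted_power d (ys j) l"
    "\<And>i j k l. (i, j) \<in> inside \<Longrightarrow> (i - 1, j) \<in> inside \<Longrightarrow> k \<le> d \<Longrightarrow> l \<le> d \<Longrightarrow>
      c (own (i, j), k, l) - c (own (i - 1, j), k, l) = shifted_power d (xs i) k * V l i j"
    by simp_all
  have hc: "h_cofactor d c i j k = H k i j" if "act_h i j" "k \<le> d" for i j k
    using c(3)[of i j k d] that unfolding h_cofactor_def act_h_def by simp
  have vc: "v_cofactor d c i j k = V k i j" if "act_v i j" "k \<le> d" for i j k
    using c(4)[of i j d k] that unfolding v_cofactor_def act_v_def by simp
  have dc: "vertex_cofactor d c i j = \<delta> i j" if p: "interior_point i j" for i j
  proof -
    have ins: "(i, j) \<in> inside" "(i - 1, j) \<in> inside" "(i - 1, j - 1) \<in> inside" "(i, j - 1) \<in> inside"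
      using p unfolding interior_vertex_iff by simp_all
    show ?thesis using c(3)[OF ins(1,4), of d d] c(3)[OF ins(2,3), of d d] H(1)[OF p, of d]
      unfolding vertex_cofactor_def by simp
  qed
  have "dof_values d f0 c t = z t" for t
  proof (cases "t \<in> dofs d M")
    case True
    then show ?thesis
    proof (cases rule: dofs_cases)
      case (base k l)
      then show ?thesis using dof_values_Base c(2) by simp
    next
      case (cut_h a b j k)
      have "act_h a j" using cut_h(2) unfolding run_h_def by simp
      then show ?thesis unfolding cut_h(1) dof_values_Cut_h(2)[OF cut_h(2-5)]
        using hc[of a j k] H(3)[OF cut_h(2-4), of k] run_h_end[OF cut_h(2)] cut_h(5) by simp
    next
      case (cut_v a b i k)
      have "act_v i a" using cut_v(2) unfolding run_v_def by simp
      then show ?thesis unfolding cut_v(1) dof_values_Cut_v(2)[OF cut_v(2-5)]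
        using vc[of i a k] V(3)[OF cut_v(2-4), of k] run_v_end[OF cut_v(2)] cut_v(5) by simp
    next
      case (vert i j)
      have "interior_point i j" using vert(2) unfolding interior_vertices_def by simp
      then show ?thesis unfolding vert(1) dof_values_Vert using vert(2) dc unfolding \<delta>_def by simp
    qed
  next
    case False
    then show ?thesis using supp unfolding dof_values_def by simp
  qed
  then show ?thesis using c(1) by (intro bexI[of _ c] ext) simp_all
qed

text \<open>Splines correspond to the solutions of the conformality equations, whose number of unknowns
  is the right-hand side.\<close>

theorem dim_spline_space_formula:
  assumes d: "d \<ge> 1" and ne: "cells M \<noteq> {}"
  shows "fun_vs.dim (spline_space d M) + conformality_rank d M =
    (d + 1)\<^sup>2 + (d + 1) * card (cross_cuts M) + card (interior_vertices M)"
proof -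
  obtain f0 where f0: "f0 \<in> cells M" using ne by auto
  have inj: "inj_on (dof_values d f0) (coeff_space d)"
  proof (rule inj_onI)
    fix a b assume ab: "a \<in> coeff_space d" "b \<in> coeff_space d" "dof_values d f0 a = dof_values d f0 b"
    interpret vp: vector_space_pair "fun_scale :: real \<Rightarrow> (point set \<times> nat \<times> nat \<Rightarrow> real) \<Rightarrow> _"
      "fun_scale :: real \<Rightarrow> (dof \<Rightarrow> real) \<Rightarrow> _"
      by unfold_locales
    have "dof_values d f0 (a - b) = dof_values d f0 a - dof_values d f0 b"
      by (rule vp.linear_diff[OF linear_dof_values])
    then have "dof_values d f0 (a - b) = 0" unfolding ab(3) by (simp only: diff_self)
    then have "a - b = 0"
      using dof_values_inj[OF fun_vs.subspace_diff[OF subspace_coeff_space ab(1,2)] f0] by simp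
    then show "a = b" by (simp only: eq_iff_diff_eq_0[symmetric])
  qed
  have image: "dof_values d f0 ` coeff_space d = dof_space d"
    using dof_values_in_space dof_values_surj[OF _ f0] by (auto simp: image_iff) metis
  have "fun_vs.dim (spline_space d M) = fun_vs.dim (dof_space d)"
    using dim_spline_space[OF d] dim_linear_image[OF linear_dof_values subspace_coeff_space inj]
    unfolding image by simp
  moreover have "fun_vs.dim (dof_space d) + fun_vs.dim (dof_equations d) = card (dofs d M)"
    unfolding dof_space_def
  proof (rule dim_solutions[OF finite_dofs])
    show "finite (dof_equations d)" unfolding dof_equations_def using finite_T_l_edges by simp
    fix r t assume "r \<in> dof_equations d" and t: "t \<notin> dofs d M"
    then obtain q where r: "r = vertex_part (conformality_row M q)" unfolding dof_equations_def by auto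
    show "r t = 0"
    proof (cases t)
      case (Vert v)
      then have "v \<notin> T_vertices M" using t T_vertices_interior unfolding dofs_def by auto
      then show ?thesis unfolding r Vert by (simp add: conformality_row_def)
    qed (simp_all add: r)
  qed
  ultimately show ?thesis unfolding conformality_rank_eq dof_equations_def card_dofs by simp
qed

end

section \<open>Invariance under structural isomorphism\<close>

text \<open>The condition on boundary l-edges refers to intersections of l-edges only, so that it can be
  transported by a structural isomorphism.\<close>

definition interior_crossings :: "tmesh \<Rightarrow> point set set set" where
  "interior_crossings M = {{l, l'} |l l'. l \<in> interior_l_edges M \<and> l' \<in> interior_l_edges M \<and> l \<noteq> l' \<and>
    l \<inter> l' \<noteq> {} \<and> (\<forall>b\<in>boundary_l_edges M. b \<inter> l = {} \<or> b \<inter> l' = {})}"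

lemma interior_crossingsI:
  "l \<in> interior_l_edges M \<Longrightarrow> l' \<in> interior_l_edges M \<Longrightarrow> l \<noteq> l' \<Longrightarrow> l \<inter> l' \<noteq> {} \<Longrightarrow>
    (\<And>b. b \<in> boundary_l_edges M \<Longrightarrow> b \<inter> l = {} \<or> b \<inter> l' = {}) \<Longrightarrow> {l, l'} \<in> interior_crossings M"
  unfolding interior_crossings_def mem_Collect_eq by (intro exI[of _ l] exI[of _ l']) simp

lemma boundary_l_edge_in_frontier: "b \<in> boundary_l_edges M \<Longrightarrow> b \<subseteq> frontier (mesh_domain M)"
  unfolding boundary_l_edges_def maximal_segments_def segments_def boundary_edges_def by auto

lemma interior_l_edge_not_in_frontier:
  assumes "l \<in> interior_l_edges M" shows "\<not> l \<subseteq> frontier (mesh_domain M)"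
proof -
  obtain F where F: "F \<subseteq> interior_edges M" "F \<noteq> {}" "l = \<Union>F"
    using assms unfolding interior_l_edges_def maximal_segments_def segments_def by auto
  then obtain m where "m \<in> F" by auto
  then have "m \<subseteq> l" "m \<in> interior_edges M" using F by auto
  then show ?thesis unfolding interior_edges_def by auto
qed

lemma l_edges_disjoint: "boundary_l_edges M \<inter> interior_l_edges M = {}"
  using boundary_l_edge_in_frontier[of _ M] interior_l_edge_not_in_frontier[of _ M] by (meson disjoint_iff)

context grid_mesh
begin

lemma edge_nonempty: "l \<in> edges M \<Longrightarrow> l \<noteq> {}"
proof
  assume "l \<in> edges M" "l = {}"
  then consider "horizontal ({} :: point set)" | "vertical ({} :: point set)" using edge_cases by auto
  then show False
  proof cases
    case 1
    then obtain a b y :: real where "a < b" "{} = {a..b} \<times> {y}" unfolding horizontal_def by (elim exE conjE)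
    moreover from this(1) have "(a, y) \<in> {a..b} \<times> {y}" by simp
    ultimately show False by (metis empty_iff)
  next
    case 2
    then obtain x a b :: real where "a < b" "{} = {x} \<times> {a..b}" unfolding vertical_def by (elim exE conjE)
    moreover from this(1) have "(x, a) \<in> {x} \<times> {a..b}" by simp
    ultimately show False by (metis empty_iff)
  qed
qed

lemma edges_empty:
  assumes "cells M = {}" shows "edges M = {}"
proof (rule equals0I)
  fix l assume l: "l \<in> edges M"
  then obtain p where "p \<in> l" using edge_nonempty by (meson ex_in_conv)
  then show False using edge_in_frontiers[OF l] assms by simp
qed


text \<open>Overlapping runs are equal, and runs that only share an end point do not exist, because a run is not
  followed by an active segment.\<close>

lemma horizontal_l_edges_eq:
  assumes "l \<in> interior_l_edges M" "l' \<in> interior_l_edges M" "horizontal l" "horizontal l'" "l \<inter> l' \<noteq> {}"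
  shows "l = l'"
proof -
  obtain a b j where r: "run_h a b j" "l = seg_h a b j" using horizontal_l_edge_run[OF assms(1,3)] by metis
  obtain a' b' j' where r': "run_h a' b' j'" "l' = seg_h a' b' j'" using horizontal_l_edge_run[OF assms(2,4)] by metis
  obtain x y where "(x, y) \<in> l" "(x, y) \<in> l'" using assms(5) by auto
  then have p: "xs a \<le> x" "x \<le> xs b" "xs a' \<le> x" "x \<le> xs b'" "ys j = ys j'" unfolding r r' by simp_all
  have j: "j' = j" using p(5) by simp
  have "xs a \<le> xs b'" "xs a' \<le> xs b" using p by linarith+
  then have le: "a \<le> b'" "a' \<le> b" by simp_all
  have ab: "a < b" "a' < b'" "\<not> act_h b j" "\<not> act_h b' j" using r(1) r'(1) unfolding run_h_def j by simp_all
  have "a \<noteq> b'" "a' \<noteq> b"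
    using r(1) r'(1) unfolding run_h_def j by auto
  then have lt: "a < b'" "a' < b" using le by simp_all
  have "a = a'" "b = b'"
    using run_h_unique[OF r(1) r'(1)[unfolded j], of "max a a'"] ab(1,2) lt by simp_all
  then show ?thesis unfolding r(2) r'(2) j by simp
qed

lemma vertical_l_edges_eq:
  assumes "l \<in> interior_l_edges M" "l' \<in> interior_l_edges M" "vertical l" "vertical l'" "l \<inter> l' \<noteq> {}"
  shows "l = l'"
proof -
  interpret T: grid_mesh "transpose_mesh M" ys xs by (rule transposed)
  have "flip l \<inter> flip l' \<noteq> {}" using assms(5) unfolding flip_Int[symmetric] by simp
  then have "flip l = flip l'"
    using T.horizontal_l_edges_eq[of "flip l" "flip l'"] assms(1-4) flip_interior_l_edges by simp
  then show ?thesis by simp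
qed

lemma l_edges_through_interior_vertex:
  assumes v: "v \<in> interior_vertices M"
  obtains l l' where "l \<in> interior_l_edges M" "l' \<in> interior_l_edges M" "horizontal l" "vertical l'"
    "l \<inter> l' = {v}" "{m \<in> interior_l_edges M. v \<in> m} = {l, l'}"
proof -
  interpret T: grid_mesh "transpose_mesh M" ys xs by (rule transposed)
  have "v \<in> vertices M" using v unfolding interior_vertices_def by simp
  then obtain i j where ij: "v = (xs i, ys j)" by (rule vertex_on_grid)
  obtain k where k: "act_h k j" "k = i \<or> k = i - 1" using v unfolding ij interior_vertices_iff by auto
  obtain a b where r: "run_h a b j" "a \<le> k" "k < b" "seg_h a b j \<in> interior_l_edges M"
    using act_h_in_run[OF k(1)] by metis
  obtain m where m: "act_v i m" "m = j \<or> m = j - 1" using v unfolding ij interior_vertices_iff by auto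
  then have "T.act_h m i" unfolding transposed_act by simp
  then obtain c e where "T.run_h c e i" "c \<le> m" "m < e" by (rule T.act_h_in_run)
  then have w: "run_v c e i" "c \<le> m" "m < e" unfolding transposed_run by simp_all
  let ?l = "seg_h a b j" and ?l' = "seg_v c e i"
  have li: "?l' \<in> interior_l_edges M" using run_v_l_edge[OF w(1)] .
  have hv: "horizontal ?l" "vertical ?l'"
    using seg_h_horizontal[of a b j] seg_v_not_horizontal[of c e i] interior_l_edge_cases[OF li] r w by simp_all
  have vin: "v \<in> ?l" "v \<in> ?l'" unfolding ij using r w k(2) m(2) by auto
  have "?l \<inter> ?l' = {v}"
  proof
    show "?l \<inter> ?l' \<subseteq> {v}" unfolding ij by auto
  qed (use vin in simp)
  moreover have "{m \<in> interior_l_edges M. v \<in> m} = {?l, ?l'}"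
  proof
    show "{m \<in> interior_l_edges M. v \<in> m} \<subseteq> {?l, ?l'}"
    proof
      fix m assume "m \<in> {m \<in> interior_l_edges M. v \<in> m}"
      then have m: "m \<in> interior_l_edges M" "v \<in> m" by simp_all
      show "m \<in> {?l, ?l'}"
      proof (cases "horizontal m")
        case True
        then show ?thesis using horizontal_l_edges_eq[OF m(1) r(4) True hv(1)] m(2) vin(1) by auto
      next
        case False
        then have "vertical m" using interior_l_edge_cases[OF m(1)] by simp
        then show ?thesis using vertical_l_edges_eq[OF m(1) li _ hv(2)] m(2) vin(2) by auto
      qed
    qed
  qed (use vin r(4) li in simp)
  ultimately show ?thesis using that[OF r(4) li hv] by simp
qed

text \<open>An interior vertex is the crossing of exactly one horizontal and one vertical interior l-edge.
  Conversely, two interior l-edges that meet do so in an interior vertex unless they both end in a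
  reentrant corner of the domain, where a boundary l-edge meets both of them.\<close>

lemma bij_interior_crossings:
  "bij_betw (\<lambda>v. {l \<in> interior_l_edges M. v \<in> l}) (interior_vertices M) (interior_crossings M)"
  unfolding bij_betw_def
proof
  let ?f = "\<lambda>v. {l \<in> interior_l_edges M. v \<in> l}"
  show "inj_on ?f (interior_vertices M)"
  proof (rule inj_onI)
    fix v v' assume v: "v \<in> interior_vertices M" "v' \<in> interior_vertices M" "?f v = ?f v'"
    obtain l l' where l: "l \<inter> l' = {v}" "?f v = {l, l'}" using l_edges_through_interior_vertex[OF v(1)] by metis
    have "l \<in> ?f v'" "l' \<in> ?f v'" unfolding v(3)[symmetric] l(2) by simp_all
    then have "v' \<in> l \<inter> l'" by simp
    then show "v = v'" unfolding l(1) by simp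
  qed
  show "?f ` interior_vertices M = interior_crossings M"
  proof
    show "?f ` interior_vertices M \<subseteq> interior_crossings M"
    proof
      fix s assume "s \<in> ?f ` interior_vertices M"
      then obtain v where v: "v \<in> interior_vertices M" "s = ?f v" by auto
      obtain l l' where l: "l \<in> interior_l_edges M" "l' \<in> interior_l_edges M" "horizontal l" "vertical l'"
        "l \<inter> l' = {v}" "?f v = {l, l'}" by (rule l_edges_through_interior_vertex[OF v(1)])
      obtain a b y where h: "l = {a..b} \<times> {y}" using l(3) unfolding horizontal_def by (elim exE conjE)
      obtain x c e where w: "l' = {x} \<times> {c..e}" using l(4) unfolding vertical_def by (elim exE conjE)
      have "v \<in> l" "v \<in> l'" using l(5) by auto
      then have vxy: "v = (x, y)" unfolding h w by auto
      have "l \<noteq> l'" using l(3,4) horizontal_not_vertical by auto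
      moreover have "l \<inter> l' \<noteq> {}" using l(5) by simp
      moreover have "B \<inter> l = {} \<or> B \<inter> l' = {}" if B: "B \<in> boundary_l_edges M" for B
      proof (rule ccontr)
        assume "\<not> (B \<inter> l = {} \<or> B \<inter> l' = {})"
        then obtain p q where pq: "p \<in> B" "p \<in> l" "q \<in> B" "q \<in> l'" by auto
        have py: "snd p = y" "fst q = x" using pq(2,4) unfolding h w by (simp_all add: mem_Times_iff)
        have "v \<in> B"
          using boundary_l_edge_cases[OF B]
        proof
          assume "horizontal B"
          then obtain r s t where Bh: "B = {r..s} \<times> {t}" unfolding horizontal_def by (elim exE conjE)
          have "t = y" using pq(1) py(1) unfolding Bh by (simp add: mem_Times_iff)
          then show "v \<in> B" using pq(3) py(2) unfolding Bh vxy by (simp add: mem_Times_iff)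
        next
          assume "vertical B"
          then obtain t r s where Bv: "B = {t} \<times> {r..s}" unfolding vertical_def by (elim exE conjE)
          have "t = x" using pq(3) py(2) unfolding Bv by (simp add: mem_Times_iff)
          then show "v \<in> B" using pq(1) py(1) unfolding Bv vxy by (simp add: mem_Times_iff)
        qed
        then have "v \<in> frontier (mesh_domain M)" using boundary_l_edge_in_frontier[OF B] by auto
        then show False using v(1) unfolding interior_vertices_def frontier_def by simp
      qed
      ultimately show "s \<in> interior_crossings M" unfolding v(2) l(6) by (intro interior_crossingsI l(1,2))
    qed
    show "interior_crossings M \<subseteq> ?f ` interior_vertices M"
    proof
      fix s assume "s \<in> interior_crossings M"
      then obtain k k' where k: "s = {k, k'}" "k \<in> interior_l_edges M" "k' \<in> interior_l_edges M" "k \<noteq> k'"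
        "k \<inter> k' \<noteq> {}" "\<forall>b\<in>boundary_l_edges M. b \<inter> k = {} \<or> b \<inter> k' = {}"
        unfolding interior_crossings_def by auto
      have main: "\<exists>v\<in>interior_vertices M. ?f v = {l, l'}"
        if l: "l \<in> interior_l_edges M" "l' \<in> interior_l_edges M" "horizontal l" "vertical l'" "l \<inter> l' \<noteq> {}"
          "\<forall>b\<in>boundary_l_edges M. b \<inter> l = {} \<or> b \<inter> l' = {}" for l l'
      proof -
        obtain a b j where r: "run_h a b j" "l = seg_h a b j" using horizontal_l_edge_run[OF l(1,3)] by metis
        obtain c e i where w: "run_v c e i" "l' = seg_v c e i" using vertical_l_edge_run[OF l(2,4)] by metis
        obtain x y where "(x, y) \<in> l" "(x, y) \<in> l'" using l(5) by auto
        then have xy: "x = xs i" "y = ys j" "a \<le> i" "i \<le> b" "c \<le> j" "j \<le> e" unfolding r w by auto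
        let ?p = "(xs i, ys j)"
        have p: "?p \<in> l" "?p \<in> l'" unfolding r w using xy by simp_all
        have h: "act_h (i - 1) j \<or> act_h i j"
          using r(1) xy(3,4) unfolding run_h_def by (cases "i < b") auto
        have v: "act_v i (j - 1) \<or> act_v i j"
          using w(1) xy(5,6) unfolding run_v_def by (cases "j < e") auto
        have "?p \<in> gc (i - 1, j)" "?p \<in> gc (i, j)" by (simp_all add: gc_def)
        then have "?p \<in> mesh_domain M" using h gc_subset_domain unfolding act_h_def by auto
        have "interior_point i j"
        proof (rule ccontr)
          assume n: "\<not> interior_point i j"
          obtain B where B: "B \<in> boundary_l_edges M" "?p \<in> B"
            by (rule boundary_point_l_edge[OF \<open>?p \<in> mesh_domain M\<close> n])
          then have "B \<inter> l \<noteq> {}" "B \<inter> l' \<noteq> {}" using p by auto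
          then show False using bspec[OF l(6) B(1)] by simp
        qed
        then have vi: "?p \<in> interior_vertices M" unfolding interior_vertices_iff using h v by simp
        obtain m m' where m: "?f ?p = {m, m'}" "horizontal m" "vertical m'"
          using l_edges_through_interior_vertex[OF vi] by metis
        have "l \<in> ?f ?p" "l' \<in> ?f ?p" using l p by simp_all
        then have "l = m" "l' = m'" unfolding m(1) using m(2,3) l(3,4) horizontal_not_vertical by auto
        then show ?thesis using vi m(1) by auto
      qed
      have "horizontal k \<and> vertical k' \<or> horizontal k' \<and> vertical k"
        using interior_l_edge_cases[OF k(2)] interior_l_edge_cases[OF k(3)] k(4,5)
          horizontal_l_edges_eq[OF k(2,3)] vertical_l_edges_eq[OF k(2,3)] by auto
      then have "\<exists>v\<in>interior_vertices M. ?f v = s"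
      proof
        assume "horizontal k \<and> vertical k'"
        then show ?thesis unfolding k(1) using main[OF k(2,3)] k(5,6) by simp
      next
        assume a: "horizontal k' \<and> vertical k"
        have "k' \<inter> k \<noteq> {}" "\<forall>b\<in>boundary_l_edges M. b \<inter> k' = {} \<or> b \<inter> k = {}" using k(5,6) by auto
        then show ?thesis unfolding k(1) using main[OF k(3,2)] a by (simp add: insert_commute)
      qed
      then show "s \<in> ?f ` interior_vertices M" by auto
    qed
  qed
qed

end

lemma card_interior_vertices:
  assumes "t_mesh M" shows "card (interior_vertices M) = card (interior_crossings M)"
proof -
  obtain xs ys where "grid_mesh M xs ys" using grid_mesh_exists[OF assms] by metis
  then interpret grid_mesh M xs ys .
  show ?thesis using bij_interior_crossings by (rule bij_betw_same_card)
qed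

lemma boundary_l_edges_empty_iff:
  assumes "t_mesh M" shows "boundary_l_edges M = {} \<longleftrightarrow> cells M = {}"
proof
  obtain xs ys where "grid_mesh M xs ys" using grid_mesh_exists[OF assms] by metis
  then interpret grid_mesh M xs ys .
  show "cells M = {}" if "boundary_l_edges M = {}" using boundary_l_edges_nonempty that by auto
  assume "cells M = {}"
  then have "edges M = {}" by (rule edges_empty)
  then show "boundary_l_edges M = {}"
    unfolding boundary_l_edges_def maximal_segments_def segments_def boundary_edges_def by auto
qed

text \<open>A mesh without boundary l-edges has no cells, and its spline space is zero; the base polynomial
  contributes only if there is a cell.\<close>

definition structural_dimension :: "nat \<Rightarrow> tmesh \<Rightarrow> nat" where
  "structural_dimension d M = (if boundary_l_edges M = {} then 0 else
    (d + 1)\<^sup>2 + (d + 1) * card (cross_cuts M) + card (interior_crossings M))"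

lemma dim_plus_rank:
  assumes "d \<ge> 1" "t_mesh M"
  shows "fun_vs.dim (spline_space d M) + conformality_rank d M = structural_dimension d M"
proof (cases "cells M = {}")
  case False
  obtain xs ys where "grid_mesh M xs ys" using grid_mesh_exists[OF assms(2)] by metis
  then interpret grid_mesh M xs ys .
  show ?thesis using dim_spline_space_formula[OF assms(1) False] False
    unfolding structural_dimension_def boundary_l_edges_empty_iff[OF assms(2)] card_interior_vertices[OF assms(2)]
    by simp
next
  case True
  obtain xs ys where "grid_mesh M xs ys" using grid_mesh_exists[OF assms(2)] by metis
  then interpret grid_mesh M xs ys .
  have "edges M = {}" using True by (rule edges_empty)
  then have "T_l_edges M = {}"
    unfolding T_l_edges_def interior_l_edges_def maximal_segments_def segments_def interior_edges_def by auto
  then have "conformality_rank d M = fun_vs.dim ({} :: (point \<Rightarrow> real) set)"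
    unfolding conformality_rank_def matrix_rank_def by simp
  moreover have "spline_space d M \<subseteq> fun_vs.span {}"
    unfolding spline_space_def mesh_domain_def True by (auto simp: fun_eq_iff)
  then have "fun_vs.dim (spline_space d M) \<le> 0" using fun_vs.dim_le_card[of _ "{}"] by simp
  moreover have "fun_vs.dim ({} :: (point \<Rightarrow> real) set) \<le> 0" using fun_vs.dim_le_card[of "{}" "{}"] by simp
  ultimately show ?thesis
    unfolding structural_dimension_def boundary_l_edges_empty_iff[OF assms(2)] True by simp
qed

text \<open>A structural isomorphism maps boundary l-edges to boundary l-edges, hence interior to interior ones, and
  preserves intersections; so it induces a bijection of the crossings.\<close>

lemma structural_dimension_invariant:
  assumes "structurally_isomorphic M N"
  shows "structural_dimension d M = structural_dimension d N"
proof -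
  obtain \<alpha> where "structurally_isomorphic_map M N \<alpha>" using assms unfolding structurally_isomorphic_def by auto
  then have bij: "bij_betw \<alpha> (l_edges M) (l_edges N)" and bd: "\<alpha> ` boundary_l_edges M = boundary_l_edges N"
    and cc: "\<alpha> ` cross_cuts M = cross_cuts N"
    and meet: "\<And>l l'. l \<in> l_edges M \<Longrightarrow> l' \<in> l_edges M \<Longrightarrow> l \<inter> l' \<noteq> {} \<longleftrightarrow> \<alpha> l \<inter> \<alpha> l' \<noteq> {}"
    unfolding structurally_isomorphic_map_def by auto
  have inj: "inj_on \<alpha> (l_edges M)" using bij unfolding bij_betw_def by simp
  have int: "interior_l_edges K = l_edges K - boundary_l_edges K" for K
    using l_edges_disjoint[of K] unfolding l_edges_def by auto
  have bsub: "boundary_l_edges M \<subseteq> l_edges M" "interior_l_edges M \<subseteq> l_edges M" unfolding l_edges_def by auto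
  have ii: "\<alpha> ` interior_l_edges M = interior_l_edges N"
    unfolding int using inj_on_image_set_diff[OF inj _ bsub(1), of "l_edges M"] bij bd
    unfolding bij_betw_def by auto
  have "cross_cuts M \<subseteq> l_edges M" using bsub(2) unfolding cross_cuts_def by auto
  then have ccc: "card (cross_cuts M) = card (cross_cuts N)"
    unfolding cc[symmetric] using inj by (metis card_image inj_on_subset)
  have crossing: "{l, l'} \<in> interior_crossings M \<longleftrightarrow> {\<alpha> l, \<alpha> l'} \<in> interior_crossings N"
    if l: "l \<in> interior_l_edges M" "l' \<in> interior_l_edges M" for l l'
  proof -
    have cr: "{a, b} \<in> interior_crossings K \<longleftrightarrow> a \<noteq> b \<and> a \<inter> b \<noteq> {} \<and>
        (\<forall>B\<in>boundary_l_edges K. B \<inter> a = {} \<or> B \<inter> b = {})"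
      if ab: "a \<in> interior_l_edges K" "b \<in> interior_l_edges K" for a b K
    proof
      assume "{a, b} \<in> interior_crossings K"
      then obtain x y where xy: "{a, b} = {x, y}" "x \<noteq> y" "x \<inter> y \<noteq> {}"
        "\<forall>B\<in>boundary_l_edges K. B \<inter> x = {} \<or> B \<inter> y = {}"
        unfolding interior_crossings_def by auto
      then have "a = x \<and> b = y \<or> a = y \<and> b = x" by (auto simp: doubleton_eq_iff)
      then show "a \<noteq> b \<and> a \<inter> b \<noteq> {} \<and> (\<forall>B\<in>boundary_l_edges K. B \<inter> a = {} \<or> B \<inter> b = {})"
        using xy(2-4) by auto
    qed (intro interior_crossingsI ab; simp)
    have lM: "l \<in> l_edges M" "l' \<in> l_edges M" using l bsub(2) by auto
    have al: "\<alpha> l \<in> interior_l_edges N" "\<alpha> l' \<in> interior_l_edges N" using l ii by auto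
    have "l \<noteq> l' \<longleftrightarrow> \<alpha> l \<noteq> \<alpha> l'" using inj lM by (metis inj_on_contraD)
    moreover have "l \<inter> l' \<noteq> {} \<longleftrightarrow> \<alpha> l \<inter> \<alpha> l' \<noteq> {}" using meet[OF lM] .
    moreover have "(\<forall>B\<in>boundary_l_edges M. B \<inter> l = {} \<or> B \<inter> l' = {}) \<longleftrightarrow>
        (\<forall>B\<in>boundary_l_edges N. B \<inter> \<alpha> l = {} \<or> B \<inter> \<alpha> l' = {})"
      unfolding bd[symmetric] ball_simps(9)
    proof (rule ball_cong[OF refl])
      fix B assume "B \<in> boundary_l_edges M"
      then have "B \<in> l_edges M" using bsub(1) by auto
      then show "(B \<inter> l = {} \<or> B \<inter> l' = {}) = (\<alpha> B \<inter> \<alpha> l = {} \<or> \<alpha> B \<inter> \<alpha> l' = {})"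
        using meet[of B l] meet[of B l'] lM by simp
    qed
    ultimately show ?thesis unfolding cr[OF l] cr[OF al] by simp
  qed
  have doubletons: "\<exists>l l'. s = {l, l'} \<and> l \<in> interior_l_edges K \<and> l' \<in> interior_l_edges K"
    if "s \<in> interior_crossings K" for s K
    using that unfolding interior_crossings_def by auto
  have "(`) \<alpha> ` interior_crossings M = interior_crossings N"
  proof
    show "(`) \<alpha> ` interior_crossings M \<subseteq> interior_crossings N"
    proof
      fix t assume "t \<in> (`) \<alpha> ` interior_crossings M"
      then obtain s where s: "s \<in> interior_crossings M" "t = \<alpha> ` s" by auto
      obtain l l' where l: "s = {l, l'}" "l \<in> interior_l_edges M" "l' \<in> interior_l_edges M"
        using doubletons[OF s(1)] by auto
      then show "t \<in> interior_crossings N" using crossing[OF l(2,3)] s by simp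
    qed
    show "interior_crossings N \<subseteq> (`) \<alpha> ` interior_crossings M"
    proof
      fix t assume t: "t \<in> interior_crossings N"
      obtain m m' where m: "t = {m, m'}" "m \<in> interior_l_edges N" "m' \<in> interior_l_edges N"
        using doubletons[OF t] by auto
      obtain l l' where l: "l \<in> interior_l_edges M" "m = \<alpha> l" "l' \<in> interior_l_edges M" "m' = \<alpha> l'"
        using m(2,3) unfolding ii[symmetric] by auto
      have "{l, l'} \<in> interior_crossings M" using crossing[OF l(1,3)] t unfolding m(1) l(2,4) by simp
      moreover have "t = \<alpha> ` {l, l'}" unfolding m(1) l(2,4) by simp
      ultimately show "t \<in> (`) \<alpha> ` interior_crossings M" by (rule rev_image_eqI)
    qed
  qed
  moreover have "inj_on ((`) \<alpha>) (interior_crossings M)"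
  proof (rule inj_on_subset[OF inj_on_image_Pow[OF inj]])
    show "interior_crossings M \<subseteq> Pow (l_edges M)"
    proof
      fix s assume "s \<in> interior_crossings M"
      from doubletons[OF this] show "s \<in> Pow (l_edges M)" using bsub(2) by auto
    qed
  qed
  ultimately have "card (interior_crossings M) = card (interior_crossings N)" by (metis card_image)
  moreover have "boundary_l_edges M = {} \<longleftrightarrow> boundary_l_edges N = {}" unfolding bd[symmetric] by simp
  ultimately show ?thesis unfolding structural_dimension_def ccc by simp
qed

theorem theorem3p1:
  fixes d :: nat and M :: tmesh
  assumes "d \<ge> 1"
    and "t_mesh M"
    and "T_connected M"
    and "\<And>l. l \<in> T_l_edges M \<Longrightarrow> \<not> vanishable d M l"
  shows "dimensionally_stable d M \<longleftrightarrow>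
    (\<forall>M1\<in>iso_class M. \<forall>M2\<in>iso_class M. conformality_rank d M1 = conformality_rank d M2)"
proof -
  have sum: "fun_vs.dim (spline_space d N) + conformality_rank d N = structural_dimension d M"
    if "N \<in> iso_class M" for N
    using that dim_plus_rank[OF assms(1), of N] structural_dimension_invariant[of M N d]
    unfolding iso_class_def by simp
  have "fun_vs.dim (spline_space d M1) = fun_vs.dim (spline_space d M2) \<longleftrightarrow>
      conformality_rank d M1 = conformality_rank d M2"
    if "M1 \<in> iso_class M" "M2 \<in> iso_class M" for M1 M2
    using sum[OF that(1)] sum[OF that(2)] by linarith
  then show ?thesis unfolding dimensionally_stable_def by simp
qed

end
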